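(* Let $d\ge2$, let $\mathbf{v}=(0,\dots,0,1)\in\mathbb{S}^d$, let $\mu$ be a polar measure on $\mathbb{S}^d$ with pole at $\mathbf{v}$, with polar part $\mu_p$, and let $N\ge1$ be an integer. Then $$\rho(d,\mu,N)=2\pi\,\rho(\mu_p,N).$$ Moreover, if $N<\#\operatorname{supp}(\mu_p)$, then the function $$\widetilde f(\mathbf{x})=f\Big(\tfrac{1}{2\pi}\arccos(\mathbf{x}\cdot\mathbf{v})\Big),\qquad \mathbf{x}\in\mathbb{S}^d,$$ is an extremizer for $\rho(d,\mu,N)$ (that is, $0\not\equiv\widetilde f\in\mathcal{T}(d,\mu,N)$ and $\mathrm{r}(\widetilde f)=\rho(d,\mu,N)$), where $f:\mathbb{R}/\mathbb{Z}\to\mathbb{R}$ is $$f(x)=\frac{|A_{N+1}(e^{2\pi i x};d\mu_p)|^2}{\cos(2\pi\theta_1)-\cos(2\pi x)},\qquad \theta_1=\min\{|\theta|:A_{N+1}(e^{2\pi i\theta};d\mu_p)=0\}.$$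
   Context: Radius of last sign change. Let $\mathbb{X}$ be $\mathbb{R}/\mathbb{Z}$ (with its usual distance, $|x|$ = distance to $0$, distinguished point $x^*=0$) or $\mathbb{S}^d\subset\mathbb{R}^{d+1}$ (with geodesic distance, distinguished point $x^*=\mathbf{v}$). $B_r(x^* )$ is the open ball. A function $f:\mathbb{X}\to\mathbb{R}$ is eventually non-negative if $f\ge0$ on $\mathbb{X}\setminus B_r(x^* )$ for some $r>0$; $\mathrm{r}(f)=\inf\{r>0: f\ge0\text{ on }\mathbb{X}\setminus B_r(x^* )\}$. One-dimensional problem. For an even finite Borel measure $\nu$ on $\mathbb{R}/\mathbb{Z}$ and $N\ge1$, $\mathcal{T}(\nu,N)$ is the set of real-valued, eventually non-negative trigonometric polynomials $f(x)=\sum_{|n|\le N}\widehat f(n)e^{2\pi i n x}$ with $\int f\,d\nu\le0$, and $\rho(\nu,N)=\inf_{0\not\equiv f\in\mathcal{T}(\nu,N)}\mathrm{r}(f)$. Polar measures. $\mathrm{SO}_{\mathbf{v}}(d+1)$ is the subgroup of rotations in $\mathrm{SO}(d+1)$ fixing $\mathbf{v}$. A finite Borel measure $\mu$ on $\mathbb{S}^d$ is a polar measure (with pole at $\mathbf{v}$) if $\mu(R(A))=\mu(A)$ for all Borel $A\subseteq\mathbb{S}^d$ and $R\in\mathrm{SO}_{\mathbf{v}}(d+1)$. Its polar part is the even measure $\mu_p$ on $\mathbb{R}/\mathbb{Z}$ given by $$\mu_p(A)=\mu(A^{+,d})+\mu(A^{-,d})+2\mu(A^d\cap\{\mathbf{v},-\mathbf{v}\}),$$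 where $A^d=\{(\mathbf{x}'\sin(2\pi\theta),\cos(2\pi\theta)):\theta\in A,\ \mathbf{x}'\in\mathbb{S}^{d-1}\}$ and $A^{\pm,d}=\{(\mathbf{x}'\sin(2\pi\theta),\cos(2\pi\theta)):\theta\in(0,1/2),\ \pm\theta\in A,\ \mathbf{x}'\in\mathbb{S}^{d-1}\}$. Higher-dimensional problem. $\mathscr{H}_k$ is the space of spherical harmonics of degree $k$ on $\mathbb{S}^d$. $\mathcal{T}(d,\mu,N)$ is the set of functions $f:\mathbb{S}^d\to\mathbb{R}$ of the form $f=\sum_{k=0}^NY_k$ with $Y_k\in\mathscr{H}_k$, eventually non-negative, with $\int_{\mathbb{S}^d}f\,d\mu\le0$; and $\rho(d,\mu,N)=\inf_{0\not\equiv f\in\mathcal{T}(d,\mu,N)}\mathrm{r}(f)$. The polynomials $A_n$. A measure on $\mathbb{R}/\mathbb{Z}$ is identified with one on the unit circle $\partial\mathbb{D}$ via $\theta\mapsto e^{2\pi i\theta}$. For a probability measure $\nu$ on $\partial\mathbb{D}$, let $\Phi_n(z;d\nu)$ be the monic orthogonal polynomials of degree $n$ in $L^2(\partial\mathbb{D},d\nu)$ and $\varphi_n=\Phi_n/\|\Phi_n\|_{L^2(d\nu)}$, well defined for $0\le n<\#\operatorname{supp}(\nu)$. For a polynomial $P$ of degree $n$ put $P^*(z)=z^n\overline{P(1/\overline z)}$. Set $A_n(z;d\nu)=\frac12(\varphi_n+\varphi_n^* )$ if $n<\#\operatorname{supp}(\nu)$, and $A_n(z;d\nu)=\frac12(z\varphi_{n-1}+\varphi_{n-1}^*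 )$ if $n=\#\operatorname{supp}(\nu)$. For a nonzero finite measure $\nu$, $A_n(z;d\nu)$ refers to the normalized measure $\nu/\nu(\mathbb{R}/\mathbb{Z})$. The quotient defining $f$ is understood at $x=\pm\theta_1$ by continuous extension. *)

theory Defs
  imports "HOL-Analysis.Analysis" "HOL-Computational_Algebra.Polynomial"
begin

section \<open>Radius of last sign change\<close>

text \<open>A space is given by its points \<open>X\<close> and the distance \<open>\<delta>\<close> to the distinguished point,
  so \<open>\<delta> x < r\<close> says that \<open>x\<close> lies in the open ball of radius \<open>r\<close>.\<close>

definition nonneg_outside_ball ::
    "'a set \<Rightarrow> ('a \<Rightarrow> real) \<Rightarrow> ('a \<Rightarrow> real) \<Rightarrow> real \<Rightarrow> bool" where
  "nonneg_outside_ball X \<delta> f r \<longleftrightarrow> (\<forall>x \<in> X - {x. \<delta> x < r}. 0 \<le> f x)"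

definition eventually_nonneg :: "'a set \<Rightarrow> ('a \<Rightarrow> real) \<Rightarrow> ('a \<Rightarrow> real) \<Rightarrow> bool" where
  "eventually_nonneg X \<delta> f \<longleftrightarrow> (\<exists>r>0. nonneg_outside_ball X \<delta> f r)"

definition sign_radius :: "'a set \<Rightarrow> ('a \<Rightarrow> real) \<Rightarrow> ('a \<Rightarrow> real) \<Rightarrow> real" where
  "sign_radius X \<delta> f = Inf {r. 0 < r \<and> nonneg_outside_ball X \<delta> f r}"


section \<open>The one-dimensional problem\<close>

text \<open>Points, subsets and functions of \<open>\<real>/\<int>\<close> are represented by real numbers, 1-periodic
  subsets of the line and 1-periodic functions on the line. The distance of the class of \<open>x\<close>
  to \<open>0\<close> is the distance of \<open>x\<close> to the integers.\<close>

definition torus_exp :: "real \<Rightarrow> complex" where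
  "torus_exp x = cis (2 * pi * x)"

abbreviation torus_norm :: "real \<Rightarrow> real" where
  "torus_norm x \<equiv> infdist x \<int>"

text \<open>The measurable sets are the preimages of Borel sets under \<open>torus_exp\<close>, that is, the
  1-periodic Borel subsets of the line. A Borel measure on \<open>\<real>/\<int>\<close> is a measure with this
  \<open>\<sigma>\<close>-algebra.\<close>

definition torus_borel :: "real measure" where
  "torus_borel = vimage_algebra UNIV torus_exp borel"

definition torus_class :: "real measure \<Rightarrow> nat \<Rightarrow> (real \<Rightarrow> real) set" where
  "torus_class \<nu> N = {f.
     (\<exists>c :: int \<Rightarrow> complex. \<forall>x.
        complex_of_real (f x) = (\<Sum>n\<in>{- int N..int N}. c n * torus_exp (of_int n * x))) \<and>
     eventually_nonneg UNIV torus_norm f \<and>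
     integral\<^sup>L \<nu> f \<le> 0}"

definition torus_rho :: "real measure \<Rightarrow> nat \<Rightarrow> real" where
  "torus_rho \<nu> N =
     (INF f \<in> {f \<in> torus_class \<nu> N. \<exists>x. f x \<noteq> 0}. sign_radius UNIV torus_norm f)"


section \<open>Polar measures\<close>

text \<open>With \<open>d = CARD('d)\<close>, the space \<open>\<real>\<close>-to-the-\<open>(d+1)\<close> is \<open>real ^ 'd option\<close>: the index
  \<open>None\<close> is the last coordinate, and the indices \<open>Some j\<close> are the first \<open>d\<close> coordinates.\<close>

definition pole :: "real ^ 'd::finite option" where
  "pole = axis None 1"

definition polar_point :: "real ^ 'd::finite \<Rightarrow> real \<Rightarrow> real ^ 'd option" where
  "polar_point x' \<theta> =
     (\<chi> i. case i of None \<Rightarrow> cos (2 * pi * \<theta>) | Some j \<Rightarrow> x' $ j * sin (2 * pi * \<theta>))"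

definition polar_measure :: "(real ^ 'd::finite option) measure \<Rightarrow> bool" where
  "polar_measure \<mu> \<longleftrightarrow>
     finite_measure \<mu> \<and> sets \<mu> = sets (restrict_space borel (sphere 0 1)) \<and>
     (\<forall>R :: real ^ 'd option ^ 'd option. rotation_matrix R \<and> R *v pole = pole \<longrightarrow>
        (\<forall>A \<in> sets \<mu>. emeasure \<mu> ((\<lambda>x. R *v x) ` A) = emeasure \<mu> A))"

definition polar_lift :: "real set \<Rightarrow> (real ^ 'd::finite option) set" where
  "polar_lift A = {polar_point x' \<theta> | x' \<theta>. \<theta> \<in> A \<and> x' \<in> sphere 0 1}"

definition polar_lift_pos :: "real set \<Rightarrow> (real ^ 'd::finite option) set" where
  "polar_lift_pos A =
     {polar_point x' \<theta> | x' \<theta>. \<theta> \<in> {0<..<1/2} \<and> \<theta> \<in> A \<and> x' \<in> sphere 0 1}"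

definition polar_lift_neg :: "real set \<Rightarrow> (real ^ 'd::finite option) set" where
  "polar_lift_neg A =
     {polar_point x' \<theta> | x' \<theta>. \<theta> \<in> {0<..<1/2} \<and> - \<theta> \<in> A \<and> x' \<in> sphere 0 1}"

definition polar_part :: "(real ^ 'd::finite option) measure \<Rightarrow> real measure" where
  "polar_part \<mu> = measure_of UNIV (sets torus_borel)
     (\<lambda>A. emeasure \<mu> (polar_lift_pos A) + emeasure \<mu> (polar_lift_neg A)
        + 2 * emeasure \<mu> (polar_lift A \<inter> {pole, - pole}))"


section \<open>The higher-dimensional problem\<close>

definition laplacian :: "('a::euclidean_space \<Rightarrow> real) \<Rightarrow> 'a \<Rightarrow> real" where
  "laplacian p x = (\<Sum>b\<in>Basis. (deriv ^^ 2) (\<lambda>t. p (x + t *\<^sub>R b)) 0)"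

text \<open>Functions on the sphere are represented by functions on the ambient space, whose values
  off the sphere are irrelevant. Spherical harmonics of degree \<open>k\<close> are the restrictions to the
  sphere of the harmonic homogeneous polynomials of degree \<open>k\<close>.\<close>

definition spherical_harmonics :: "nat \<Rightarrow> ('a::euclidean_space \<Rightarrow> real) set" where
  "spherical_harmonics k = {Y. \<exists>p. real_polynomial_function p \<and>
     (\<forall>c x. p (c *\<^sub>R x) = c ^ k * p x) \<and>
     (\<forall>x. laplacian p x = 0) \<and>
     (\<forall>x \<in> sphere 0 1. Y x = p x)}"

definition geodesic_dist :: "'a::euclidean_space \<Rightarrow> 'a \<Rightarrow> real" where
  "geodesic_dist x y = arccos (x \<bullet> y)"

abbreviation sphere_sign_radius :: "(real ^ 'd::finite option \<Rightarrow> real) \<Rightarrow> real" where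
  "sphere_sign_radius f \<equiv> sign_radius (sphere 0 1) (geodesic_dist pole) f"

definition sphere_class ::
    "(real ^ 'd::finite option) measure \<Rightarrow> nat \<Rightarrow> (real ^ 'd option \<Rightarrow> real) set" where
  "sphere_class \<mu> N = {f.
     (\<exists>Y. (\<forall>k\<le>N. Y k \<in> spherical_harmonics k) \<and>
          (\<forall>x \<in> sphere 0 1. f x = (\<Sum>k\<le>N. Y k x))) \<and>
     eventually_nonneg (sphere 0 1) (geodesic_dist pole) f \<and>
     integral\<^sup>L \<mu> f \<le> 0}"

definition sphere_rho :: "(real ^ 'd::finite option) measure \<Rightarrow> nat \<Rightarrow> real" where
  "sphere_rho \<mu> N =
     (INF f \<in> {f \<in> sphere_class \<mu> N. \<exists>x \<in> sphere 0 1. f x \<noteq> 0}. sphere_sign_radius f)"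

definition sphere_extremizer ::
    "(real ^ 'd::finite option) measure \<Rightarrow> nat \<Rightarrow> (real ^ 'd option \<Rightarrow> real) \<Rightarrow> bool" where
  "sphere_extremizer \<mu> N f \<longleftrightarrow>
     f \<in> sphere_class \<mu> N \<and> (\<exists>x \<in> sphere 0 1. f x \<noteq> 0) \<and>
     sphere_sign_radius f = sphere_rho \<mu> N"


section \<open>Orthogonal polynomials on the unit circle\<close>

definition measure_support :: "'a::topological_space measure \<Rightarrow> 'a set" where
  "measure_support M =
     {x \<in> space M. \<forall>U. open U \<and> x \<in> U \<longrightarrow> 0 < emeasure M (U \<inter> space M)}"

text \<open>Comparison with the cardinality of a possibly infinite set, since \<open>card\<close> is \<open>0\<close> on
  infinite sets.\<close>

definition less_card :: "nat \<Rightarrow> 'a set \<Rightarrow> bool" where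
  "less_card n S \<longleftrightarrow> infinite S \<or> n < card S"

definition circle_measure :: "real measure \<Rightarrow> complex measure" where
  "circle_measure \<nu> = distr \<nu> (restrict_space borel (sphere 0 1)) torus_exp"

definition monic_OP :: "complex measure \<Rightarrow> nat \<Rightarrow> complex poly" where
  "monic_OP M n = (THE P. degree P = n \<and> lead_coeff P = 1 \<and>
     (\<forall>Q. degree Q < n \<longrightarrow> (\<integral>z. poly P z * cnj (poly Q z) \<partial>M) = 0))"

definition orthonormal_OP :: "complex measure \<Rightarrow> nat \<Rightarrow> complex poly" where
  "orthonormal_OP M n =
     smult (complex_of_real (1 / sqrt (\<integral>z. (cmod (poly (monic_OP M n) z))\<^sup>2 \<partial>M))) (monic_OP M n)"

definition poly_star :: "complex poly \<Rightarrow> complex poly" where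
  "poly_star P = reflect_poly (map_poly cnj P)"

lemma poly_poly_star:
  assumes "z \<noteq> 0"
  shows "poly (poly_star P) z = z ^ degree P * cnj (poly P (1 / cnj z))"
  using assms by (simp add: poly_star_def poly_reflect_poly_nz degree_map_poly inverse_eq_divide)

text \<open>The second case is meant for \<open>n\<close> equal to the number of points of the support; larger
  \<open>n\<close> have no meaning.\<close>

definition circle_A :: "complex measure \<Rightarrow> nat \<Rightarrow> complex poly" where
  "circle_A M n =
     (if less_card n (measure_support M)
      then smult (1/2) (orthonormal_OP M n + poly_star (orthonormal_OP M n))
      else smult (1/2) ([:0, 1:] * orthonormal_OP M (n - 1) + poly_star (orthonormal_OP M (n - 1))))"

definition torus_A :: "real measure \<Rightarrow> nat \<Rightarrow> complex poly" where
  "torus_A \<nu> n = circle_A (circle_measure (scale_measure (1 / emeasure \<nu> (space \<nu>)) \<nu>)) n"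

definition first_zero :: "real measure \<Rightarrow> nat \<Rightarrow> real" where
  "first_zero \<nu> n = Min {torus_norm \<theta> | \<theta>. poly (torus_A \<nu> n) (torus_exp \<theta>) = 0}"

definition extremal_quotient :: "real measure \<Rightarrow> nat \<Rightarrow> real \<Rightarrow> real" where
  "extremal_quotient \<nu> N x =
     (cmod (poly (torus_A \<nu> (N + 1)) (torus_exp x)))\<^sup>2 /
     (cos (2 * pi * first_zero \<nu> (N + 1)) - cos (2 * pi * x))"

text \<open>The quotient, continuously extended to the points \<open>x = \<plusminus>\<theta>\<^sub>1\<close> of \<open>\<real>/\<int>\<close>, where the
  denominator vanishes.\<close>

definition extremal_fun :: "real measure \<Rightarrow> nat \<Rightarrow> real \<Rightarrow> real" where
  "extremal_fun \<nu> N x =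
     (if cos (2 * pi * x) = cos (2 * pi * first_zero \<nu> (N + 1))
      then Lim (at x) (extremal_quotient \<nu> N)
      else extremal_quotient \<nu> N x)"

end

theory Submission
  imports Defs "HOL-Computational_Algebra.Fundamental_Theorem_Algebra"
begin

text \<open>
  Both problems are governed by rotation-invariant data, so the sphere reduces to the circle; on the
  circle, the problem is solved by a quadrature formula with \<open>N + 1\<close> nodes.

  From the circle to the sphere (\<open>sphere_rho_le_torus_rho\<close>): the even part of a trigonometric
  polynomial of degree at most \<open>N\<close> is a polynomial of degree at most \<open>N\<close> in \<open>cos (2 \<pi> x)\<close>. With
  \<open>x \<bullet> pole\<close> in place of the cosine it becomes a sum of zonal harmonics of degrees at most \<open>N\<close>
  (\<open>poly_inner_eq_sum_spherical_harmonics\<close>). Its integral is the right one because the polar part is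
  the sum of the images of \<open>\<mu>\<close> under plus and minus the normalized polar angle
  (\<open>integral_polar_part\<close>). When the radius is at least \<open>1/2\<close> the even part may vanish, but then the
  constant \<open>-1\<close> is as good a competitor.

  From the sphere to the circle (\<open>torus_rho_le_sphere_rho\<close>): a competitor \<open>f\<close> on the sphere
  restricts to a trigonometric polynomial \<open>g\<^sub>u\<close> of degree at most \<open>N\<close> on the great circle through
  the pole and the equatorial point \<open>u\<close>, and no \<open>g\<^sub>u\<close> changes sign later than \<open>f\<close> does. It
  remains to find \<open>u\<close> with \<open>g\<^sub>u \<noteq> 0\<close> and \<open>\<integral>g\<^sub>u d\<mu>\<^sub>p \<le> 0\<close>. If there is none, then \<open>\<integral>g\<^sub>u d\<mu>\<^sub>p\<close> is
  nonnegative for every \<open>u\<close> and positive for some \<open>u\<close>. Its average over \<open>u\<close> is a positive multiple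
  of \<open>\<integral>f d\<mu>\<close>, which would therefore be positive
  (\<open>integral_pos_if_meridian_sums_nonneg\<close>). The points \<open>u\<close> are distributed here like the
  meridian of a \<open>\<mu>\<close>-random point, so that the invariance of \<open>\<mu>\<close> supplies the averaging measure.

  On the circle, \<open>A = A\<^bsub>N+1\<^esub>\<close> has real palindromic coefficients and is orthogonal to
  \<open>z, \<dots>, z\<^bsup>N\<^esup>\<close>. These properties alone force \<open>N + 1\<close> simple zeros on the unit circle, none of them
  at \<open>1\<close>, and an exact quadrature with positive weights at these zeros for trigonometric
  polynomials of degree at most \<open>N\<close> (\<open>quadrature\<close>). A competitor that is nonnegative on a
  neighbourhood of all nodes and has nonpositive integral vanishes at the nodes, to second order, and
  \<open>2 N + 2\<close> zeros are too many (\<open>sign_change_lower_bound\<close>). Conversely, the quotient in the statement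
  is a product of \<open>A\<close> with the conjugate of an element of the span of \<open>z, \<dots>, z\<^bsup>N\<^esup>\<close>, so its integral
  is \<open>0\<close>, and its sign changes exactly at \<open>\<plusminus>\<theta>\<^sub>1\<close> (\<open>extremal_factorization\<close>).
\<close>

section \<open>Trigonometric polynomials\<close>

text \<open>Multiplying by \<open>z\<^bsup>N\<^esup>\<close> turns a trigonometric polynomial into an algebraic one on the unit
  circle; products, root counting and divisibility are then those of polynomials.\<close>

definition trig_poly :: "nat \<Rightarrow> (real \<Rightarrow> complex) \<Rightarrow> bool" where
  "trig_poly N f \<longleftrightarrow>
     (\<exists>p. degree p \<le> 2 * N \<and> (\<forall>x. torus_exp x ^ N * f x = poly p (torus_exp x)))"

lemma torus_exp_nonzero [simp]: "torus_exp x \<noteq> 0"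
  by (simp add: torus_exp_def)

lemma norm_torus_exp [simp]: "cmod (torus_exp x) = 1"
  by (simp add: torus_exp_def)

lemma torus_exp_int_mult: "torus_exp (of_int n * x) = torus_exp x powi n"
  by (simp add: torus_exp_def cis_power_int mult_ac)

lemma torus_exp_add: "torus_exp (x + y) = torus_exp x * torus_exp y"
  by (simp add: torus_exp_def cis_mult ring_distribs)

lemma torus_exp_of_int [simp]: "torus_exp (of_int n) = 1"
  by (simp add: torus_exp_def cis_multiple_2pi)

lemma torus_exp_minus: "torus_exp (- x) = cnj (torus_exp x)"
  by (simp add: torus_exp_def cis_cnj)

lemma cnj_torus_exp: "cnj (torus_exp x) = inverse (torus_exp x)"
  by (simp add: torus_exp_def cis_cnj)

lemma torus_exp_eq_iff: "torus_exp x = torus_exp y \<longleftrightarrow> x - y \<in> \<int>"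
proof -
  have "torus_exp x = torus_exp y \<longleftrightarrow>
      sin (2 * pi * x) = sin (2 * pi * y) \<and> cos (2 * pi * x) = cos (2 * pi * y)"
    by (auto simp: torus_exp_def complex_eq_iff)
  also have "\<dots> \<longleftrightarrow> (\<exists>n::int. 2 * pi * x = 2 * pi * y + 2 * pi * of_int n)"
    by (rule sin_cos_eq_iff)
  also have "\<dots> \<longleftrightarrow> (\<exists>n::int. x - y = of_int n)"
  proof (intro ex_cong1)
    fix n :: int
    have "2 * pi * x = 2 * pi * y + 2 * pi * of_int n \<longleftrightarrow> 2 * pi * x = 2 * pi * (y + of_int n)"
      by (simp add: ring_distribs)
    also have "\<dots> \<longleftrightarrow> x - y = of_int n"
      by auto
    finally show "2 * pi * x = 2 * pi * y + 2 * pi * of_int n \<longleftrightarrow> x - y = of_int n" .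
  qed
  finally show ?thesis
    by (auto elim!: Ints_cases)
qed

lemma poly_sum_upto:
  fixes p :: "'a::comm_semiring_1 poly"
  assumes "degree p \<le> n"
  shows "poly p x = (\<Sum>k\<le>n. coeff p k * x ^ k)"
proof -
  have "poly p x = (\<Sum>k\<le>degree p. coeff p k * x ^ k)"
    by (rule poly_altdef)
  also have "\<dots> = (\<Sum>k\<le>n. coeff p k * x ^ k)"
    by (rule sum.mono_neutral_left) (use assms in \<open>auto simp: coeff_eq_0\<close>)
  finally show ?thesis .
qed

lemma trig_poly_iff:
  "trig_poly N f \<longleftrightarrow>
     (\<exists>c :: int \<Rightarrow> complex. \<forall>x. f x = (\<Sum>n\<in>{- int N..int N}. c n * torus_exp (of_int n * x)))"
proof -
  have shift: "torus_exp x ^ N * (\<Sum>n\<in>{- int N..int N}. c n * torus_exp (of_int n * x))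
      = (\<Sum>k\<le>2 * N. c (int k - int N) * torus_exp x ^ k)" for c :: "int \<Rightarrow> complex" and x
  proof -
    have "(\<Sum>n\<in>{- int N..int N}. c n * torus_exp (of_int n * x))
        = (\<Sum>k\<le>2 * N. c (int k - int N) * torus_exp x powi (int k - int N))"
      unfolding torus_exp_int_mult
      by (rule sum.reindex_bij_witness[of _ "\<lambda>k. int k - int N" "\<lambda>n. nat (n + int N)"]) auto
    then have "torus_exp x ^ N * (\<Sum>n\<in>{- int N..int N}. c n * torus_exp (of_int n * x))
        = (\<Sum>k\<le>2 * N. torus_exp x ^ N * (c (int k - int N) * torus_exp x powi (int k - int N)))"
      by (simp add: sum_distrib_left)
    also have "\<dots> = (\<Sum>k\<le>2 * N. c (int k - int N) * torus_exp x ^ k)"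
      by (intro sum.cong refl) (simp add: power_int_diff field_simps)
    finally show ?thesis .
  qed
  show ?thesis
  proof
    assume "trig_poly N f"
    then obtain p where p: "degree p \<le> 2 * N" "\<And>x. torus_exp x ^ N * f x = poly p (torus_exp x)"
      by (auto simp: trig_poly_def)
    define c where "c n = coeff p (nat (n + int N))" for n
    have "f x = (\<Sum>n\<in>{- int N..int N}. c n * torus_exp (of_int n * x))" for x
    proof -
      have "torus_exp x ^ N * (\<Sum>n\<in>{- int N..int N}. c n * torus_exp (of_int n * x))
          = torus_exp x ^ N * f x"
        unfolding shift p(2) poly_sum_upto[OF p(1)] by (simp add: c_def)
      then show ?thesis by simp
    qed
    then show "\<exists>c :: int \<Rightarrow> complex. \<forall>x. f x = (\<Sum>n\<in>{- int N..int N}. c n * torus_exp (of_int n * x))"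
      by blast
  next
    assume "\<exists>c :: int \<Rightarrow> complex. \<forall>x. f x = (\<Sum>n\<in>{- int N..int N}. c n * torus_exp (of_int n * x))"
    then obtain c :: "int \<Rightarrow> complex"
      where c: "\<And>x. f x = (\<Sum>n\<in>{- int N..int N}. c n * torus_exp (of_int n * x))" by blast
    define p where "p = (\<Sum>k\<le>2 * N. monom (c (int k - int N)) k)"
    have "degree p \<le> 2 * N"
      unfolding p_def by (intro degree_sum_le) (auto intro: order_trans[OF degree_monom_le])
    moreover have "torus_exp x ^ N * f x = poly p (torus_exp x)" for x
      unfolding c shift p_def by (simp add: poly_sum poly_monom)
    ultimately show "trig_poly N f"
      unfolding trig_poly_def by blast
  qed
qed

lemma trig_poly_add:
  assumes "trig_poly N f" "trig_poly N g"
  shows "trig_poly N (\<lambda>x. f x + g x)"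
proof -
  obtain p q where "degree p \<le> 2 * N" "\<And>x. torus_exp x ^ N * f x = poly p (torus_exp x)"
    "degree q \<le> 2 * N" "\<And>x. torus_exp x ^ N * g x = poly q (torus_exp x)"
    using assms by (auto simp: trig_poly_def)
  then show ?thesis
    unfolding trig_poly_def
    by (intro exI[of _ "p + q"]) (auto simp: ring_distribs intro: degree_add_le)
qed

lemma trig_poly_mult:
  assumes "trig_poly M f" "trig_poly N g"
  shows "trig_poly (M + N) (\<lambda>x. f x * g x)"
proof -
  obtain p q where *: "degree p \<le> 2 * M" "\<And>x. torus_exp x ^ M * f x = poly p (torus_exp x)"
    "degree q \<le> 2 * N" "\<And>x. torus_exp x ^ N * g x = poly q (torus_exp x)"
    using assms by (auto simp: trig_poly_def)
  have "degree (p * q) \<le> 2 * (M + N)"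
    using degree_mult_le[of p q] * by simp
  moreover have "torus_exp x ^ (M + N) * (f x * g x) = poly (p * q) (torus_exp x)" for x
    by (simp add: *(2,4)[symmetric] power_add mult_ac)
  ultimately show ?thesis
    unfolding trig_poly_def by blast
qed

lemma trig_poly_const: "trig_poly N (\<lambda>x. c)"
  unfolding trig_poly_def
  by (intro exI[of _ "monom c N"]) (auto simp: poly_monom intro: order_trans[OF degree_monom_le])

lemma trig_poly_mono:
  assumes "trig_poly M f" "M \<le> N"
  shows "trig_poly N f"
  using trig_poly_mult[OF trig_poly_const[of "N - M" 1] assms(1)] assms(2) by simp

lemma trig_poly_cmult: "trig_poly N f \<Longrightarrow> trig_poly N (\<lambda>x. c * f x)"
  using trig_poly_mult[OF trig_poly_const[of 0 c]] by simp

lemma trig_poly_sum: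
  assumes "\<And>i. i \<in> I \<Longrightarrow> trig_poly N (f i)"
  shows "trig_poly N (\<lambda>x. \<Sum>i\<in>I. f i x)"
  using assms
  by (induction I rule: infinite_finite_induct) (auto intro: trig_poly_const trig_poly_add)

lemma cos_torus: "complex_of_real (cos (2 * pi * x)) = (torus_exp x + cnj (torus_exp x)) / 2"
  by (simp add: complex_eq_iff torus_exp_def)

lemma sin_torus: "complex_of_real (sin (2 * pi * x)) = (torus_exp x - cnj (torus_exp x)) / (2 * \<i>)"
  by (simp add: complex_eq_iff torus_exp_def Re_divide Im_divide)

lemma torus_exp_times_cnj: "torus_exp x * cnj (torus_exp x) = 1"
  by (simp add: cnj_torus_exp)

lemma trig_poly_cos: "trig_poly 1 (\<lambda>x. complex_of_real (cos (2 * pi * x)))"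
  unfolding trig_poly_def cos_torus
  by (intro exI[of _ "[:1/2, 0, 1/2:]"])
     (auto simp: field_simps torus_exp_times_cnj power2_eq_square)

lemma trig_poly_sin: "trig_poly 1 (\<lambda>x. complex_of_real (sin (2 * pi * x)))"
  unfolding trig_poly_def sin_torus
  by (intro exI[of _ "[:- 1 / (2 * \<i>), 0, 1 / (2 * \<i>):]"])
     (auto simp: field_simps torus_exp_times_cnj power2_eq_square)

text \<open>On the unit circle \<open>cnj z = 1 / z\<close>, so conjugation reverses the coefficients. The reversal is
  taken with respect to a bound \<open>m\<close> on the degree, not the degree itself.\<close>

lemma conj_poly_on_circle:
  assumes "degree p \<le> m"
  obtains q where "degree q \<le> m" "\<And>z. cmod z = 1 \<Longrightarrow> poly q z = z ^ m * cnj (poly p z)"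
proof
  define q where "q = (\<Sum>k\<le>m. monom (cnj (coeff p k)) (m - k))"
  show "degree q \<le> m"
    unfolding q_def by (intro degree_sum_le) (auto intro: order_trans[OF degree_monom_le])
  show "poly q z = z ^ m * cnj (poly p z)" if "cmod z = 1" for z
  proof -
    have z: "z * cnj z = 1"
      using that complex_norm_square[of z] by simp
    have "z ^ (m - k) = z ^ m * cnj z ^ k" if "k \<le> m" for k
    proof -
      have "z ^ m * cnj z ^ k = z ^ (m - k) * (z * cnj z) ^ k"
        using that by (simp add: power_mult_distrib mult.assoc[symmetric] flip: power_add)
      then show ?thesis by (simp add: z)
    qed
    then show ?thesis
      unfolding q_def poly_sum_upto[OF assms]
      by (auto simp: poly_sum poly_monom sum_distrib_left mult_ac intro!: sum.cong)
  qed
qed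

lemma trig_poly_norm_square:
  assumes "degree p \<le> N"
  shows "trig_poly N (\<lambda>x. complex_of_real ((cmod (poly p (torus_exp x)))\<^sup>2))"
proof -
  obtain q where q: "degree q \<le> N" "\<And>z. cmod z = 1 \<Longrightarrow> poly q z = z ^ N * cnj (poly p z)"
    using conj_poly_on_circle[OF assms] by blast
  have "degree (p * q) \<le> 2 * N"
    using degree_mult_le[of p q] assms q(1) by simp
  moreover have "torus_exp x ^ N * complex_of_real ((cmod (poly p (torus_exp x)))\<^sup>2)
      = poly (p * q) (torus_exp x)" for x
    by (simp add: q(2) complex_norm_square mult_ac flip: of_real_power)
  ultimately show ?thesis
    unfolding trig_poly_def by blast
qed

lemma trig_poly_eq_0:
  assumes f: "trig_poly N f" and inf: "infinite (torus_exp ` {x. f x = 0})"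
  shows "f x = 0"
proof -
  obtain p where p: "degree p \<le> 2 * N" "\<And>x. torus_exp x ^ N * f x = poly p (torus_exp x)"
    using f by (auto simp: trig_poly_def)
  have "torus_exp ` {x. f x = 0} \<subseteq> {z. poly p z = 0}"
    by (auto simp: p(2)[symmetric])
  then have "p = 0"
    using inf infinite_super poly_roots_finite by blast
  with p(2)[of x] show ?thesis by simp
qed

lemma infinite_torus_exp_interval:
  fixes a b :: real
  assumes ab: "a < b" "b < a + 1"
  shows "infinite (torus_exp ` {a..b})"
proof -
  have "inj_on torus_exp {a..b}"
  proof (rule inj_onI)
    fix x y assume *: "x \<in> {a..b}" "y \<in> {a..b}" "torus_exp x = torus_exp y"
    then obtain n where n: "x - y = of_int n"
      by (auto simp: torus_exp_eq_iff elim: Ints_cases)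
    with * ab have "\<bar>real_of_int n\<bar> < 1" by auto
    then have "n = 0" by linarith
    with n show "x = y" by simp
  qed
  then show ?thesis
    using ab(1) by (simp add: finite_image_iff)
qed

text \<open>An arc shorter than the whole circle carries infinitely many points of the circle, more than a
  nonzero polynomial can have as roots.\<close>

lemma trig_poly_eq_0_interval:
  assumes f: "trig_poly N f" and zero: "\<And>x. x \<in> {a..b} \<Longrightarrow> f x = 0" and ab: "a < b" "b < a + 1"
  shows "f x = 0"
proof (rule trig_poly_eq_0[OF f])
  from infinite_torus_exp_interval[OF ab]
  show "infinite (torus_exp ` {x. f x = 0})"
    by (rule contrapos_nn) (erule finite_subset[rotated], use zero in auto)
qed

text \<open>Transfers integrals of \<open>f\<close> to image measures on the circle, where only functions of
  \<open>torus_exp t\<close> can be integrated.\<close>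

lemma trig_poly_continuous_on_circle:
  assumes "trig_poly N (\<lambda>t. complex_of_real (f t))"
  obtains G :: "complex \<Rightarrow> real" where "continuous_on UNIV G" "\<And>t. G (torus_exp t) = f t"
proof -
  obtain p where p: "\<And>t. torus_exp t ^ N * complex_of_real (f t) = poly p (torus_exp t)"
    using assms by (auto simp: trig_poly_def)
  define G where "G z = Re (cnj z ^ N * poly p z)" for z
  have "G (torus_exp t) = f t" for t
  proof -
    have "cnj (torus_exp t) ^ N * (torus_exp t ^ N * complex_of_real (f t)) = complex_of_real (f t)"
      by (simp add: cnj_torus_exp field_simps)
    then show ?thesis
      unfolding G_def p[symmetric] by (simp only: Re_complex_of_real)
  qed
  moreover have "continuous_on UNIV G"
    unfolding G_def by (intro continuous_intros)
  ultimately show ?thesis using that by blast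
qed

fun chebyshev :: "nat \<Rightarrow> real poly" where
  "chebyshev 0 = 1"
| "chebyshev (Suc 0) = [:0, 1:]"
| "chebyshev (Suc (Suc n)) = [:0, 2:] * chebyshev (Suc n) - chebyshev n"

lemma degree_chebyshev: "degree (chebyshev n) \<le> n"
proof (induction n rule: chebyshev.induct)
  case (3 n)
  have "degree ([:0, 2:] * chebyshev (Suc n)) \<le> Suc (Suc n)"
    using degree_mult_le[of "[:0, 2:]" "chebyshev (Suc n)"] 3 by simp
  then show ?case
    using 3 by (auto intro!: degree_diff_le)
qed auto

lemma poly_chebyshev: "poly (chebyshev n) (cos t) = cos (real n * t)"
proof (induction n rule: chebyshev.induct)
  case (3 n)
  define a where "a = real (Suc n) * t"
  have "real (Suc (Suc n)) * t = a + t" "real n * t = a - t"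
    by (simp_all add: a_def ring_distribs)
  then have "cos (real (Suc (Suc n)) * t) = 2 * cos t * cos a - cos (real n * t)"
    by (simp only: cos_add cos_diff) simp
  then show ?case
    using 3 by (simp add: a_def del: of_nat_Suc)
qed auto

lemma even_part_trig_poly:
  assumes "trig_poly N (\<lambda>x. complex_of_real (f x))"
  obtains q where "degree q \<le> N" "\<And>x. f x + f (- x) = poly q (cos (2 * pi * x))"
proof -
  obtain c :: "int \<Rightarrow> complex" where
    c: "\<And>x. complex_of_real (f x) = (\<Sum>n\<in>{- int N..int N}. c n * torus_exp (of_int n * x))"
    using assms unfolding trig_poly_iff by blast
  define q where "q = (\<Sum>n\<in>{- int N..int N}. smult (2 * Re (c n)) (chebyshev (nat \<bar>n\<bar>)))"
  show ?thesis
  proof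
    show "degree q \<le> N"
      unfolding q_def
      by (intro degree_sum_le) (auto intro!: order_trans[OF degree_smult_le] order_trans[OF degree_chebyshev])
    show "f x + f (- x) = poly q (cos (2 * pi * x))" for x
    proof -
      have "c n * torus_exp (of_int n * x) + c n * torus_exp (of_int n * (- x))
          = c n * complex_of_real (2 * poly (chebyshev (nat \<bar>n\<bar>)) (cos (2 * pi * x)))" for n
      proof -
        have "poly (chebyshev (nat \<bar>n\<bar>)) (cos (2 * pi * x)) = cos (2 * pi * (of_int n * x))"
          unfolding poly_chebyshev by (cases "n \<ge> 0") (auto simp: mult_ac)
        then show ?thesis
          by (simp add: torus_exp_minus cos_torus ring_distribs)
      qed
      then have "complex_of_real (f x + f (- x))
          = (\<Sum>n\<in>{- int N..int N}. c n * complex_of_real (2 * poly (chebyshev (nat \<bar>n\<bar>)) (cos (2 * pi * x))))"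
        unfolding of_real_add c sum.distrib[symmetric] by (intro sum.cong) auto
      then have "f x + f (- x) = Re (\<Sum>n\<in>{- int N..int N}. c n * complex_of_real (2 * poly (chebyshev (nat \<bar>n\<bar>)) (cos (2 * pi * x))))"
        by (metis Re_complex_of_real)
      then show ?thesis
        by (simp add: q_def poly_sum mult_ac)
    qed
  qed
qed

section \<open>Para-orthogonal polynomials on the unit circle\<close>

lemma compact_bounded_image:
  assumes "continuous_on S f" "compact S"
  obtains K where "\<And>x. x \<in> S \<Longrightarrow> norm (f x) \<le> K"
  using compact_imp_bounded[OF compact_continuous_image[OF assms]] by (auto simp: bounded_iff)

lemma open_Int_in_restrict_space: "open U \<Longrightarrow> U \<inter> S \<in> sets (restrict_space borel S)"
  unfolding sets_restrict_space by (subst Int_commute) (intro imageI borel_open)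

lemma poly_map_cnj: "poly (map_poly cnj P) z = cnj (poly P (cnj z))"
  using poly_cnj[of P "cnj z"] by simp

locale circle_finite_measure = finite_measure M for M :: "complex measure" +
  assumes sets_M: "sets M = sets (restrict_space borel (sphere 0 1))"
begin

lemma space_M: "space M = sphere 0 1"
  using sets_eq_imp_space_eq[OF sets_M] by (simp add: space_restrict_space)

lemma integrable_continuous:
  fixes f :: "complex \<Rightarrow> 'b::{second_countable_topology, banach}"
  assumes "continuous_on (sphere 0 1) f"
  shows "integrable M f"
proof -
  have "f \<in> borel_measurable M"
    using borel_measurable_continuous_on_restrict[OF assms] measurable_cong_sets[OF sets_M refl] by blast
  moreover obtain C where "\<And>z. z \<in> sphere 0 1 \<Longrightarrow> norm (f z) \<le> C"
    using compact_bounded_image[OF assms compact_sphere] by blast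
  ultimately show ?thesis
    by (intro integrable_const_bound[where B = C]) (auto simp: space_M AE_I2)
qed

definition ip :: "complex poly \<Rightarrow> complex poly \<Rightarrow> complex" where
  "ip P Q = (\<integral>z. poly P z * cnj (poly Q z) \<partial>M)"

lemma integrable_ip: "integrable M (\<lambda>z. poly P z * cnj (poly Q z))"
  by (intro integrable_continuous continuous_intros)

lemma ip_add_left: "ip (P + P') Q = ip P Q + ip P' Q"
  unfolding ip_def by (simp add: ring_distribs Bochner_Integration.integral_add integrable_ip)

lemma ip_smult_left: "ip (smult c P) Q = c * ip P Q"
  unfolding ip_def by (simp add: mult.assoc)

lemma ip_diff_left: "ip (P - P') Q = ip P Q - ip P' Q"
  using ip_add_left[of P "smult (-1) P'" Q] by (simp only: ip_smult_left) simp

lemma ip_commute: "ip Q P = cnj (ip P Q)"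
  unfolding ip_def by (subst Bochner_Integration.integral_cnj[symmetric]) (simp add: mult.commute)

lemma ip_add_right: "ip P (Q + Q') = ip P Q + ip P Q'"
  by (metis ip_add_left ip_commute complex_cnj_add)

lemma ip_smult_right: "ip P (smult c Q) = cnj c * ip P Q"
  by (metis ip_smult_left ip_commute complex_cnj_mult)

lemma ip_zero [simp]: "ip P 0 = 0" "ip 0 P = 0"
  by (simp_all add: ip_def)

lemma ip_self: "ip P P = complex_of_real (\<integral>z. (cmod (poly P z))\<^sup>2 \<partial>M)"
  unfolding ip_def integral_complex_of_real[symmetric] complex_norm_square by simp

text \<open>A nonvanishing value persists on a neighbourhood, which has positive mass around a point of
  the support.\<close>

lemma zero_on_support:
  assumes "(\<integral>z. (cmod (poly P z))\<^sup>2 \<partial>M) = 0" "z \<in> measure_support M"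
  shows "poly P z = 0"
proof (rule ccontr)
  assume z: "poly P z \<noteq> 0"
  have "integrable M (\<lambda>z. (cmod (poly P z))\<^sup>2)"
    by (intro integrable_continuous continuous_intros)
  then have ae: "AE z in M. (cmod (poly P z))\<^sup>2 = 0"
    using assms(1) by (subst (asm) integral_nonneg_eq_0_iff_AE) auto
  define U where "U = {z. poly P z \<noteq> 0}"
  have "open U"
    unfolding U_def by (intro open_Collect_neq continuous_intros)
  then have "0 < emeasure M (U \<inter> space M)"
    using assms(2) z by (auto simp: measure_support_def U_def)
  moreover have "U \<inter> space M \<in> sets M"
    unfolding sets_M space_M by (rule open_Int_in_restrict_space[OF \<open>open U\<close>])
  then have "emeasure M (U \<inter> space M) = 0"
    using ae by (subst (asm) AE_iff_measurable[OF _ refl]) (auto simp: U_def Int_def conj_commute)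
  ultimately show False by simp
qed

text \<open>The inner product is definite on polynomials of degree at most \<open>n\<close> as soon as the support has more
  than \<open>n\<close> points. All later uniqueness arguments rest on this.\<close>

lemma eq_0_if_ip_self_eq_0:
  assumes "less_card n (measure_support M)" "degree P \<le> n" "ip P P = 0"
  shows "P = 0"
proof (rule ccontr)
  assume "P \<noteq> 0"
  then have fin: "finite {z. poly P z = 0}" and card: "card {z. poly P z = 0} \<le> n"
    using poly_roots_finite card_poly_roots_bound assms(2) order_trans by blast+
  have "(\<integral>z. (cmod (poly P z))\<^sup>2 \<partial>M) = 0"
    using assms(3) by (simp add: ip_self)
  then have "measure_support M \<subseteq> {z. poly P z = 0}"
    using zero_on_support by blast
  with fin card assms(1) show False
    unfolding less_card_def by (meson card_mono finite_subset leD le_trans)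
qed

text \<open>Gram-Schmidt. The space of polynomials of degree less than \<open>m\<close> is described by vanishing
  coefficients, so that the case \<open>m = 0\<close> is the zero space and the induction can start there.
  Each step divides by the squared norm of a monic polynomial of degree \<open>m \<le> n\<close>, which the size of the
  support keeps away from \<open>0\<close>.\<close>

lemma ortho_projection:
  assumes "less_card n (measure_support M)" "m \<le> Suc n"
  shows "\<exists>R. (\<forall>i\<ge>m. coeff R i = 0) \<and> (\<forall>Q. (\<forall>i\<ge>m. coeff Q i = 0) \<longrightarrow> ip (F - R) Q = 0)"
  using assms(2)
proof (induction m arbitrary: F)
  case 0
  have "Q = 0" if "\<forall>i\<ge>0. coeff Q i = 0" for Q :: "complex poly"
    using that by (intro poly_eqI) auto
  then have "ip (F - 0) Q = 0" if "\<forall>i\<ge>0. coeff Q i = 0" for Q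
    using that by (metis ip_zero(1))
  then show ?case by (intro exI[of _ 0]) auto
next
  case (Suc m)
  obtain R where R: "\<forall>i\<ge>m. coeff R i = 0" "\<And>Q. \<forall>i\<ge>m. coeff Q i = 0 \<Longrightarrow> ip (F - R) Q = 0"
    using Suc.IH[of F] Suc.prems by auto
  obtain S where S: "\<forall>i\<ge>m. coeff S i = 0"
    "\<And>Q. \<forall>i\<ge>m. coeff Q i = 0 \<Longrightarrow> ip (monom 1 m - S) Q = 0"
    using Suc.IH[of "monom 1 m"] Suc.prems by auto
  define e where "e = monom 1 m - S"
  have e: "coeff e m = 1" "\<forall>i>m. coeff e i = 0"
    using S(1) by (auto simp: e_def)
  then have "degree e \<le> n"
    using Suc.prems by (intro degree_le) auto
  then have ee: "ip e e \<noteq> 0"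
    using eq_0_if_ip_self_eq_0[OF assms(1)] e(1) by fastforce
  \<comment> \<open>The projection gains the component along the new monic orthogonal direction \<open>e\<close>.\<close>
  define R' where "R' = R + smult (ip (F - R) e / ip e e) e"
  have FR': "ip (F - R') Q = ip (F - R) Q - ip (F - R) e / ip e e * ip e Q" for Q
    by (simp add: R'_def diff_diff_eq[symmetric] ip_diff_left ip_smult_left)
  have "ip (F - R') Q = 0" if "\<forall>i\<ge>Suc m. coeff Q i = 0" for Q
  proof -
    define Q' where "Q' = Q - smult (coeff Q m) e"
    have "\<forall>i\<ge>m. coeff Q' i = 0"
      using e that unfolding Q'_def
      by (metis Suc_leI coeff_diff coeff_smult diff_self le_neq_implies_less mult.right_neutral mult_zero_right)
    then have "ip (F - R) Q' = 0" "ip e Q' = 0"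
      using R S by (auto simp: e_def)
    moreover have "Q = Q' + smult (coeff Q m) e"
      by (simp add: Q'_def)
    ultimately have "ip (F - R) Q = cnj (coeff Q m) * ip (F - R) e" "ip e Q = cnj (coeff Q m) * ip e e"
      by (metis add_0 ip_add_right ip_smult_right)+
    then show ?thesis
      using ee by (simp add: FR')
  qed
  moreover have "\<forall>i\<ge>Suc m. coeff R' i = 0"
    using R e by (auto simp: R'_def)
  ultimately show ?case by blast
qed

lemma ex1_monic_OP:
  assumes "less_card n (measure_support M)"
  shows "\<exists>!P. degree P = n \<and> lead_coeff P = 1 \<and> (\<forall>Q. degree Q < n \<longrightarrow> ip P Q = 0)"
proof (rule ex_ex1I)
  obtain R where R: "\<forall>i\<ge>n. coeff R i = 0"
    "\<And>Q. \<forall>i\<ge>n. coeff Q i = 0 \<Longrightarrow> ip (monom 1 n - R) Q = 0"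
    using ortho_projection[OF assms, of n "monom 1 n"] by auto
  have coeffs: "coeff (monom 1 n - R) n = 1" "\<forall>i>n. coeff (monom 1 n - R) i = 0"
    using R by auto
  then have "degree (monom 1 n - R) = n"
    by (metis degree_le le_antisym le_degree zero_neq_one)
  then show "\<exists>P. degree P = n \<and> lead_coeff P = 1 \<and> (\<forall>Q. degree Q < n \<longrightarrow> ip P Q = 0)"
    using coeffs R(2) by (intro exI[of _ "monom 1 n - R"]) (auto simp: coeff_eq_0)
next
  fix P P' assume P: "degree P = n \<and> lead_coeff P = 1 \<and> (\<forall>Q. degree Q < n \<longrightarrow> ip P Q = 0)"
    and P': "degree P' = n \<and> lead_coeff P' = 1 \<and> (\<forall>Q. degree Q < n \<longrightarrow> ip P' Q = 0)"
  show "P = P'"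
  proof (cases "P - P' = 0")
    case False
    have "coeff (P - P') i = 0" if "i \<ge> n" for i
      using that P P' by (cases "i = n") (auto simp: coeff_eq_0)
    then have "degree (P - P') < n"
      using False by (metis leading_coeff_0_iff not_le)
    moreover from this have "ip (P - P') (P - P') = 0"
      using P P' by (simp add: ip_diff_left)
    ultimately show ?thesis
      using eq_0_if_ip_self_eq_0[OF assms, of "P - P'"] by auto
  qed auto
qed

lemma monic_OP:
  assumes "less_card n (measure_support M)"
  shows "degree (monic_OP M n) = n" "lead_coeff (monic_OP M n) = 1"
    "\<And>Q. degree Q < n \<Longrightarrow> ip (monic_OP M n) Q = 0"
  using theI'[OF ex1_monic_OP[OF assms]] unfolding monic_OP_def ip_def by auto

lemma orthonormal_OP_eq:
  assumes "less_card n (measure_support M)"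
  obtains c where "c > 0" "orthonormal_OP M n = smult (complex_of_real c) (monic_OP M n)"
proof -
  define c where "c = 1 / sqrt (\<integral>z. (cmod (poly (monic_OP M n) z))\<^sup>2 \<partial>M)"
  have "monic_OP M n \<noteq> 0"
    using monic_OP[OF assms] by (metis leading_coeff_0_iff zero_neq_one)
  then have "ip (monic_OP M n) (monic_OP M n) \<noteq> 0"
    using eq_0_if_ip_self_eq_0[OF assms] monic_OP(1)[OF assms] by (metis order_refl)
  moreover have "(\<integral>z. (cmod (poly (monic_OP M n) z))\<^sup>2 \<partial>M) \<ge> 0"
    by (intro integral_nonneg_AE) auto
  ultimately have "c > 0"
    by (simp add: c_def ip_self less_le)
  then show ?thesis
    by (intro that[of c]) (auto simp: orthonormal_OP_def c_def)
qed

text \<open>On the circle \<open>P\<^sup>* = z\<^bsup>m\<^esup> cnj P\<close>, so the inner product of \<open>P\<^sup>*\<close> with \<open>z Q\<close> is that of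
  \<open>z\<^bsup>m-1\<^esup> cnj Q\<close>, a polynomial of degree less than \<open>m\<close>, with \<open>P\<close>.\<close>

lemma ip_conj_reversal:
  assumes "degree P = m" "degree Q < m" "\<And>R. degree R < m \<Longrightarrow> ip P R = 0"
  shows "ip (poly_star P) (pCons 0 Q) = 0"
proof -
  have "degree Q \<le> m - 1" using assms by simp
  then obtain R where R: "degree R \<le> m - 1" "\<And>z. cmod z = 1 \<Longrightarrow> poly R z = z ^ (m - 1) * cnj (poly Q z)"
    using conj_poly_on_circle by blast
  have "ip (poly_star P) (pCons 0 Q) = ip R P"
    unfolding ip_def
  proof (rule Bochner_Integration.integral_cong[OF refl])
    fix z assume "z \<in> space M"
    then have z: "cmod z = 1" by (simp add: space_M)
    then have zz: "z * cnj z = 1" "z \<noteq> 0"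
      using complex_norm_square[of z] by auto
    then have inv: "1 / cnj z = z" by (auto simp: field_simps)
    have "z ^ m = z * z ^ (m - 1)"
      using assms(2) by (cases m) auto
    then have "poly (poly_star P) z * cnj (poly (pCons 0 Q) z)
        = (z * cnj z) * (z ^ (m - 1) * cnj (poly Q z)) * cnj (poly P z)"
      using zz(2) by (simp add: poly_poly_star assms(1) inv mult_ac)
    then show "poly (poly_star P) z * cnj (poly (pCons 0 Q) z) = poly R z * cnj (poly P z)"
      by (simp add: zz(1) R(2) z)
  qed
  also have "\<dots> = 0"
    using assms(2,3) R(1) by (subst ip_commute) auto
  finally show ?thesis .
qed

text \<open>The coefficientwise conjugate of the monic orthogonal polynomial satisfies the same
  conditions when the measure is symmetric under conjugation, and these determine it.\<close>

lemma real_coeffs_orthonormal_OP: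
  assumes "less_card n (measure_support M)"
    and sym: "\<And>f :: complex \<Rightarrow> complex. continuous_on UNIV f \<Longrightarrow>
      (\<integral>z. f (cnj z) \<partial>M) = (\<integral>z. f z \<partial>M)"
  shows "map_poly cnj (orthonormal_OP M n) = orthonormal_OP M n"
proof -
  define P where "P = monic_OP M n"
  note P = monic_OP[OF assms(1), folded P_def]
  have "ip (map_poly cnj P) Q = 0" if "degree Q < n" for Q
  proof -
    have "ip (map_poly cnj P) Q = (\<integral>z. cnj (poly P (cnj z)) * cnj (poly Q z) \<partial>M)"
      by (simp add: ip_def poly_map_cnj)
    also have "\<dots> = (\<integral>z. cnj (poly P (cnj (cnj z))) * cnj (poly Q (cnj z)) \<partial>M)"
      by (rule sym[symmetric, of "\<lambda>z. cnj (poly P (cnj z)) * cnj (poly Q z)"])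
         (intro continuous_intros)
    also have "\<dots> = (\<integral>z. cnj (poly P z * cnj (poly (map_poly cnj Q) z)) \<partial>M)"
      by (simp add: poly_map_cnj)
    also have "\<dots> = cnj (ip P (map_poly cnj Q))"
      unfolding ip_def by (rule Bochner_Integration.integral_cnj)
    also have "\<dots> = 0"
      using that P(3) by (simp add: degree_map_poly)
    finally show ?thesis .
  qed
  moreover have "degree (map_poly cnj P) = n" "lead_coeff (map_poly cnj P) = 1"
    using P(1,2) by (simp_all add: degree_map_poly coeff_map_poly)
  ultimately have "map_poly cnj P = P"
    using ex1_monic_OP[OF assms(1)] P by blast
  moreover obtain c where "orthonormal_OP M n = smult (complex_of_real c) P"
    using orthonormal_OP_eq[OF assms(1)] P_def by blast
  ultimately show ?thesis
    by (simp add: map_poly_smult)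
qed

lemma coeff_star_real:
  assumes "map_poly cnj P = P"
  shows "coeff (poly_star P) k = (if degree P < k then 0 else coeff P (degree P - k))"
  by (simp add: poly_star_def assms coeff_reflect_poly)

lemma orthonormal_OP:
  assumes "less_card n (measure_support M)"
  shows "degree (orthonormal_OP M n) = n" "orthonormal_OP M n \<noteq> 0"
    "\<And>Q. degree Q < n \<Longrightarrow> ip (orthonormal_OP M n) Q = 0"
proof -
  obtain c where c: "c > 0" "orthonormal_OP M n = smult (complex_of_real c) (monic_OP M n)"
    using orthonormal_OP_eq[OF assms] by blast
  show "degree (orthonormal_OP M n) = n" "\<And>Q. degree Q < n \<Longrightarrow> ip (orthonormal_OP M n) Q = 0"
    using c monic_OP[OF assms] by (simp_all add: ip_smult_left)
  have "monic_OP M n \<noteq> 0"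
    using monic_OP(2)[OF assms] by (metis leading_coeff_0_iff zero_neq_one)
  then show "orthonormal_OP M n \<noteq> 0"
    using c by simp
qed

end

text \<open>The common properties of the two cases in the definition of \<open>A\<^sub>n\<close>, for \<open>n = N + 1\<close>. The
  orthogonality omits both ends \<open>1\<close> and \<open>z\<^bsup>N+1\<^esup>\<close> of the range of exponents, which is what the
  orthogonality relations of the two summands of \<open>A\<^sub>n\<close> have in common.\<close>

locale para_orthogonal = circle_finite_measure +
  fixes N :: nat and A :: "complex poly"
  assumes N: "N \<ge> 1" and supp: "less_card N (measure_support M)"
    and A_nonzero: "A \<noteq> 0" and degree_A_le: "degree A \<le> Suc N"
    and real_A: "map_poly cnj A = A"
    and palindromic_A: "\<And>k. k \<le> Suc N \<Longrightarrow> coeff A k = coeff A (Suc N - k)"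
    and ortho_A: "\<And>Q. degree Q < N \<Longrightarrow> ip A (pCons 0 Q) = 0"

lemma (in circle_finite_measure) para_orthogonalI:
  assumes "N \<ge> 1" "less_card N (measure_support M)"
    and "S \<noteq> 0" "degree S \<le> Suc N" and real: "map_poly cnj S = S"
    and pal: "\<And>k. k \<le> Suc N \<Longrightarrow> coeff S k = coeff S (Suc N - k)"
    and "\<And>Q. degree Q < N \<Longrightarrow> ip (smult (1/2) S) (pCons 0 Q) = 0"
  shows "para_orthogonal M N (smult (1/2) S)"
proof unfold_locales
  show "map_poly cnj (smult (1/2) S) = smult (1/2) S"
    using real by (subst map_poly_smult) auto
  show "coeff (smult (1/2) S) k = coeff (smult (1/2) S) (Suc N - k)" if "k \<le> Suc N" for k
    using pal[OF that] by simp
qed (use assms in auto)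

text \<open>If \<open>\<phi> + \<phi>\<^sup>*\<close> vanished for \<open>\<phi> = \<phi>\<^bsub>N+1\<^esub>\<close>, then \<open>\<phi>\<close> would inherit from \<open>\<phi>\<^sup>*\<close> the orthogonality to
  \<open>z\<^bsup>N+1\<^esup>\<close> and be orthogonal to itself. When the support has exactly \<open>N + 1\<close> points, only
  \<open>\<phi>\<^sub>N\<close> is available, and the leading coefficient of \<open>z \<phi>\<^sub>N\<close> cannot cancel.\<close>

lemma (in circle_finite_measure) para_orthogonal_circle_A:
  assumes N: "N \<ge> 1" and supp: "less_card N (measure_support M)"
    and sym: "\<And>f :: complex \<Rightarrow> complex. continuous_on UNIV f \<Longrightarrow>
      (\<integral>z. f (cnj z) \<partial>M) = (\<integral>z. f z \<partial>M)"
  shows "para_orthogonal M N (circle_A M (Suc N))"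
proof (cases "less_card (Suc N) (measure_support M)")
  case True
  define P where "P = orthonormal_OP M (Suc N)"
  note P = orthonormal_OP[OF True, folded P_def]
  have realP: "map_poly cnj P = P"
    using real_coeffs_orthonormal_OP[OF True sym] by (simp add: P_def)
  have A: "circle_A M (Suc N) = smult (1/2) (P + poly_star P)"
    using True by (simp add: circle_A_def P_def)
  have star: "coeff (poly_star P) k = coeff P (Suc N - k)" if "k \<le> Suc N" for k
    using that by (simp add: coeff_star_real[OF realP] P(1))
  have ortho_star: "ip (poly_star P) (pCons 0 Q) = 0" if "degree Q < Suc N" for Q
    using ip_conj_reversal[OF P(1) that] P(3) by blast
  have nz: "P + poly_star P \<noteq> 0"
  proof
    assume "P + poly_star P = 0"
    then have neg: "P = smult (-1) (poly_star P)"
      by (simp add: add_eq_0_iff)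
    obtain a Q where Q: "P = pCons a Q" by (cases P)
    then have "degree Q < Suc N"
      using P(1) by (auto split: if_splits)
    then have "ip P (pCons 0 Q) = 0"
      by (subst neg) (simp only: ip_smult_left ortho_star mult_zero_right)
    moreover have "ip P [:a:] = 0" by (rule P(3)) auto
    moreover have "P = pCons 0 Q + [:a:]" using Q by simp
    ultimately have "ip P P = 0"
      by (metis ip_add_right add_0)
    then show False
      using eq_0_if_ip_self_eq_0[OF True, of P] P by auto
  qed
  have "degree (poly_star P) \<le> Suc N"
    by (metis P(1) degree_map_poly degree_reflect_poly_le poly_star_def complex_cnj_zero_iff)
  then have deg: "degree (P + poly_star P) \<le> Suc N"
    using P(1) by (intro degree_add_le) auto
  have "map_poly cnj (poly_star P) = poly_star P"
    using realP by (intro poly_eqI) (auto simp: coeff_map_poly coeff_star_real, metis coeff_map_poly complex_cnj_zero)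
  moreover have "map_poly cnj (P + poly_star P) = map_poly cnj P + map_poly cnj (poly_star P)"
    by (intro poly_eqI) (simp add: coeff_map_poly)
  ultimately have re: "map_poly cnj (P + poly_star P) = P + poly_star P"
    by (simp add: realP)
  have orth: "ip (smult (1/2) (P + poly_star P)) (pCons 0 Q) = 0" if "degree Q < N" for Q
  proof -
    have "ip P (pCons 0 Q) = 0" using that by (intro P(3)) auto
    moreover have "ip (poly_star P) (pCons 0 Q) = 0" using that by (intro ortho_star) auto
    ultimately show ?thesis by (simp only: ip_smult_left ip_add_left add_0 mult_zero_right)
  qed
  have pal: "coeff (P + poly_star P) k = coeff (P + poly_star P) (Suc N - k)" if "k \<le> Suc N" for k
    using that by (simp add: star)
  show ?thesis
    unfolding A by (rule para_orthogonalI[OF N supp nz deg re pal orth])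
next
  case False
  define P where "P = orthonormal_OP M N"
  note P = orthonormal_OP[OF supp, folded P_def]
  have realP: "map_poly cnj P = P"
    using real_coeffs_orthonormal_OP[OF supp sym] by (simp add: P_def)
  have A: "circle_A M (Suc N) = smult (1/2) (pCons 0 P + poly_star P)"
    using False by (simp add: circle_A_def P_def)
  have "degree (poly_star P) \<le> N"
    by (metis P(1) degree_map_poly degree_reflect_poly_le poly_star_def complex_cnj_zero_iff)
  then have deg: "degree (pCons 0 P + poly_star P) \<le> Suc N"
    using P(1) by (intro degree_add_le) (auto intro: order_trans[OF degree_pCons_le])
  have "coeff (pCons 0 P + poly_star P) (Suc N) = coeff P N"
    by (simp add: coeff_star_real[OF realP] P(1))
  then have nz: "pCons 0 P + poly_star P \<noteq> 0"
    using P(1,2) by (metis coeff_0 leading_coeff_0_iff)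
  have pal: "coeff (pCons 0 P + poly_star P) k = coeff (pCons 0 P + poly_star P) (Suc N - k)"
    if "k \<le> Suc N" for k
    using that
    by (auto simp: coeff_star_real[OF realP] P(1) coeff_pCons Suc_diff_le split: nat.splits)
  have "map_poly cnj (poly_star P) = poly_star P"
    using realP by (intro poly_eqI) (auto simp: coeff_map_poly coeff_star_real, metis coeff_map_poly complex_cnj_zero)
  moreover have "map_poly cnj (pCons 0 P + poly_star P) = pCons 0 (map_poly cnj P) + map_poly cnj (poly_star P)"
    by (intro poly_eqI) (auto simp: coeff_map_poly coeff_pCons split: nat.splits)
  ultimately have re: "map_poly cnj (pCons 0 P + poly_star P) = pCons 0 P + poly_star P"
    by (simp add: realP)
  have orth: "ip (smult (1/2) (pCons 0 P + poly_star P)) (pCons 0 Q) = 0" if "degree Q < N" for Q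
  proof -
    have "ip (pCons 0 P) (pCons 0 Q) = ip P Q"
      unfolding ip_def
    proof (rule Bochner_Integration.integral_cong[OF refl])
      fix z assume "z \<in> space M"
      then have "z * cnj z = 1"
        using complex_norm_square[of z] by (simp add: space_M)
      moreover have "poly (pCons 0 P) z * cnj (poly (pCons 0 Q) z)
          = (z * cnj z) * (poly P z * cnj (poly Q z))"
        by (simp add: mult_ac)
      ultimately show "poly (pCons 0 P) z * cnj (poly (pCons 0 Q) z) = poly P z * cnj (poly Q z)"
        by simp
    qed
    moreover have "ip P Q = 0" using that by (rule P(3))
    moreover have "ip (poly_star P) (pCons 0 Q) = 0"
      using ip_conj_reversal[OF P(1) that] P(3) by blast
    ultimately show ?thesis by (simp only: ip_smult_left ip_add_left add_0 mult_zero_right)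
  qed
  show ?thesis
    unfolding A by (rule para_orthogonalI[OF N supp nz deg re pal orth])
qed

section \<open>Zeros of para-orthogonal polynomials and quadrature\<close>

context para_orthogonal
begin

text \<open>If the top coefficient vanished, so would the constant one by symmetry, and \<open>A\<close> would lie in the
  span of \<open>z, \<dots>, z\<^bsup>N\<^esup>\<close>, to which it is orthogonal.\<close>

lemma degree_A: "degree A = Suc N"
proof (rule ccontr)
  assume "degree A \<noteq> Suc N"
  then have "degree A \<le> N" using degree_A_le by simp
  moreover obtain a Q where Q: "A = pCons a Q" by (cases A)
  moreover have "coeff A 0 = 0"
    using palindromic_A[of 0] \<open>degree A \<le> N\<close> by (simp add: coeff_eq_0)
  ultimately have "A = pCons 0 Q" "degree Q < N"
    using N by (auto split: if_splits)
  then have "ip A A = 0"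
    using ortho_A by metis
  then show False
    using eq_0_if_ip_self_eq_0[OF supp \<open>degree A \<le> N\<close>] A_nonzero by simp
qed

lemma coeff_0_A: "coeff A 0 \<noteq> 0"
  using palindromic_A[of 0] degree_A A_nonzero by (metis diff_zero le0 leading_coeff_0_iff)

lemma poly_A_cnj: "poly A (cnj z) = cnj (poly A z)"
  by (metis poly_map_cnj real_A complex_cnj_cnj)

lemma poly_A_inverse: "z \<noteq> 0 \<Longrightarrow> poly A z = z ^ Suc N * poly A (1 / z)"
proof -
  assume z: "z \<noteq> 0"
  have "z ^ Suc N * poly A (1 / z) = (\<Sum>k\<le>Suc N. z ^ Suc N * (coeff A k * (1 / z) ^ k))"
    by (simp add: poly_sum_upto[OF degree_A_le] sum_distrib_left del: sum.atMost_Suc power_Suc)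
  also have "\<dots> = (\<Sum>k\<le>Suc N. coeff A (Suc N - k) * z ^ (Suc N - k))"
    using z by (intro sum.cong refl)
      (simp add: palindromic_A[symmetric] power_diff field_simps del: power_Suc)
  also have "\<dots> = (\<Sum>k\<le>Suc N. coeff A k * z ^ k)"
    by (rule sum.reindex_bij_witness[of _ "\<lambda>k. Suc N - k" "\<lambda>k. Suc N - k"]) auto
  finally show ?thesis
    by (simp add: poly_sum_upto[OF degree_A_le])
qed

text \<open>This excludes zeros off the circle and multiple zeros at once: a zero \<open>a\<close> off the circle comes with its
  reflection \<open>1 / cnj a\<close>, and a double zero on the circle is its own reflection. On the circle
  \<open>z - 1 / cnj a\<close> is a multiple of \<open>z cnj (z - a)\<close>, so testing \<open>A\<close> against \<open>z B\<close> yields the squared norm of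
  \<open>(z - a) B\<close>.\<close>

lemma no_reflected_pair:
  assumes "A = [:- a, 1:] * ([:- b, 1:] * B)" "b * cnj a = 1"
  shows False
proof -
  have a: "a \<noteq> 0"
    using assms(2) by auto
  then have b: "b = 1 / cnj a"
    using assms(2) by (simp add: nonzero_eq_divide_eq)
  have B: "B \<noteq> 0"
    using assms(1) A_nonzero by auto
  have "degree A = degree B + 2"
    unfolding assms(1) using B by (simp add: degree_mult_eq del: mult_pCons_left)
  then have degB: "degree B = N - 1"
    using degree_A by simp
  have "poly A z * cnj (poly (pCons 0 B) z)
      = - (1 / cnj a) * (poly ([:- a, 1:] * B) z * cnj (poly ([:- a, 1:] * B) z))" if "cmod z = 1" for z
  proof -
    have zz: "z * cnj z = 1"
      using complex_norm_square[of z] that by simp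
    have "(z - b) * cnj z = - (1 / cnj a) * cnj (z - a)"
      using a zz by (simp add: b field_simps)
    then have "(z - a) * poly B z * cnj (poly B z) * ((z - b) * cnj z)
        = (z - a) * poly B z * cnj (poly B z) * (- (1 / cnj a) * cnj (z - a))"
      by (simp only:)
    moreover have "poly A z = (z - a) * ((z - b) * poly B z)"
      unfolding assms(1) by (simp only: poly_mult) simp
    moreover have "poly ([:- a, 1:] * B) z = (z - a) * poly B z"
      by (simp only: poly_mult) simp
    moreover have "poly (pCons 0 B) z = z * poly B z"
      by simp
    ultimately show ?thesis
      by (simp only: complex_cnj_mult mult_ac)
  qed
  then have "ip A (pCons 0 B) = (\<integral>z. - (1 / cnj a) *
      (poly ([:- a, 1:] * B) z * cnj (poly ([:- a, 1:] * B) z)) \<partial>M)"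
    unfolding ip_def by (intro Bochner_Integration.integral_cong[OF refl]) (simp add: space_M)
  then have "ip A (pCons 0 B) = - (1 / cnj a) * ip ([:- a, 1:] * B) ([:- a, 1:] * B)"
    by (simp only: integral_mult_right_zero ip_def)
  moreover have "ip A (pCons 0 B) = 0"
    using degB N by (intro ortho_A) auto
  ultimately have "ip ([:- a, 1:] * B) ([:- a, 1:] * B) = 0"
    using a by (metis complex_cnj_zero_iff divide_eq_0_iff mult_eq_0_iff neg_equal_0_iff_equal zero_neq_one)
  moreover have "degree ([:- a, 1:] * B) \<le> N"
    using B degB N by (simp add: degree_mult_eq del: mult_pCons_left)
  ultimately have "[:- a, 1:] * B = 0"
    using eq_0_if_ip_self_eq_0[OF supp] by blast
  then show False
    using B by (simp only: mult_eq_0_iff) simp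
qed

lemma cmod_root:
  assumes "poly A a = 0"
  shows "cmod a = 1"
proof (rule ccontr)
  assume a: "cmod a \<noteq> 1"
  have "a \<noteq> 0"
    using assms coeff_0_A by (auto simp: poly_0_coeff_0)
  define b where "b = 1 / cnj a"
  have "b \<noteq> a"
    using a \<open>a \<noteq> 0\<close> complex_norm_square[of a]
    by (auto simp: b_def field_simps)
       (metis norm_ge_zero of_real_eq_1_iff power2_eq_1_iff of_real_power zero_le_one add.inverse_inverse neg_0_le_iff_le not_one_le_zero)
  have "poly A b = 0"
    using poly_A_inverse[of b] assms \<open>a \<noteq> 0\<close> poly_A_cnj[of a] by (simp add: b_def)
  obtain C where C: "A = [:- a, 1:] * C"
    using assms by (auto simp: poly_eq_0_iff_dvd)
  then have "poly C b = 0"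
    using \<open>poly A b = 0\<close> \<open>b \<noteq> a\<close> by simp
  then obtain B where "C = [:- b, 1:] * B"
    by (auto simp: poly_eq_0_iff_dvd)
  then show False
    using no_reflected_pair[of a b B] C \<open>a \<noteq> 0\<close> by (simp add: b_def)
qed

lemma simple_root:
  assumes "poly A a = 0"
  shows "poly (pderiv A) a \<noteq> 0"
proof
  assume d: "poly (pderiv A) a = 0"
  obtain C where C: "A = [:- a, 1:] * C"
    using assms by (auto simp: poly_eq_0_iff_dvd)
  then have "pderiv A = [:- a, 1:] * pderiv C + C * pderiv [:- a, 1:]"
    by (simp only: pderiv_mult)
  then have "poly C a = 0"
    using d by (simp add: pderiv_pCons)
  then obtain B where "C = [:- a, 1:] * B"
    by (auto simp: poly_eq_0_iff_dvd)
  moreover have "a * cnj a = 1"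
    using cmod_root[OF assms] complex_norm_square[of a] by simp
  ultimately show False
    using no_reflected_pair[of a a B] C by simp
qed

text \<open>A palindromic polynomial that vanishes at \<open>1\<close> vanishes there to even order: after division by
  \<open>z - 1\<close> the quotient is antipalindromic, hence vanishes at \<open>1\<close> as well. But the zeros of \<open>A\<close> are simple.\<close>

lemma poly_A_1: "poly A 1 \<noteq> 0"
proof
  assume root: "poly A 1 = 0"
  obtain C where C: "A = [:- 1, 1:] * C"
    using root by (auto simp: poly_eq_0_iff_dvd)
  have *: "poly C z = - (z ^ N * poly C (1 / z))" if "z \<noteq> 0" "z \<noteq> 1" for z
  proof -
    have "(z - 1) * poly C z = z ^ Suc N * ((1 / z - 1) * poly C (1 / z))"
      using poly_A_inverse[OF that(1)] by (simp add: C algebra_simps)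
    also have "\<dots> = (z - 1) * (- (z ^ N * poly C (1 / z)))"
      using that by (simp add: field_simps)
    finally show ?thesis using that(2) by (metis mult_cancel_left right_minus_eq)
  qed
  have "((\<lambda>z. poly C z) \<longlongrightarrow> poly C 1) (at 1)"
    by (intro tendsto_intros)
  moreover have "((\<lambda>z. - (z ^ N * poly C (1 / z))) \<longlongrightarrow> - (1 ^ N * poly C (1 / 1))) (at 1)"
    by (intro tendsto_intros) auto
  moreover have "\<forall>\<^sub>F z in at 1. poly C z = - (z ^ N * poly C (1 / z))"
    using eventually_neq_at_within[of 0 1 UNIV] eventually_neq_at_within[of 1 1 UNIV]
    by eventually_elim (rule *)
  ultimately have "((\<lambda>z. poly C z) \<longlongrightarrow> - (1 ^ N * poly C (1 / 1))) (at 1)"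
    by (subst tendsto_cong) auto
  with \<open>((\<lambda>z. poly C z) \<longlongrightarrow> poly C 1) (at 1)\<close> have "poly C 1 = - (1 ^ N * poly C (1 / 1))"
    by (rule tendsto_unique[OF trivial_limit_at])
  then have "poly C 1 = 0" by simp
  moreover have "pderiv A = [:- 1, 1:] * pderiv C + C * pderiv [:- 1, 1:]"
    unfolding C by (simp only: pderiv_mult)
  ultimately show False
    using simple_root[OF root] by (simp add: pderiv_pCons)
qed

definition zeros :: "complex set" where "zeros = {z. poly A z = 0}"

lemma finite_zeros: "finite zeros"
  using A_nonzero by (simp add: zeros_def poly_roots_finite)

lemma cmod_zeros: "z \<in> zeros \<Longrightarrow> cmod z = 1"
  by (simp add: zeros_def cmod_root)

lemma card_zeros: "card zeros = Suc N"
proof -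
  have "rsquarefree A"
    using simple_root by (auto simp: rsquarefree_roots)
  then have "smult (lead_coeff A) (\<Prod>z\<in>zeros. [:- z, 1:]) = A"
    unfolding zeros_def by (rule complex_poly_decompose_rsquarefree)
  then have "degree A = degree (\<Prod>z\<in>zeros. [:- z, 1:])"
    using A_nonzero by (metis degree_smult_eq leading_coeff_0_iff)
  also have "\<dots> = card zeros"
    by (subst degree_prod_eq_sum_degree) auto
  finally show ?thesis by (simp add: degree_A)
qed

lemma A_dvd:
  assumes "\<And>z. z \<in> zeros \<Longrightarrow> poly p z = 0"
  shows "A dvd p"
proof -
  have "p mod A = 0"
  proof (cases "degree (p mod A) < Suc N")
    case True
    have "poly (p mod A) z = 0" if "z \<in> zeros" for z
    proof -
      have "poly (p mod A) z = poly p z - poly (p div A) z * poly A z"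
        unfolding minus_div_mult_eq_mod[symmetric] by (simp only: poly_diff poly_mult)
      with that assms[OF that] show ?thesis by (simp add: zeros_def)
    qed
    then show ?thesis
      using True by (intro poly_eqI_degree[of zeros]) (auto simp: card_zeros)
  next
    case False
    then show ?thesis
      using degree_mod_less[OF A_nonzero, of p] degree_A by auto
  qed
  then show ?thesis by auto
qed

definition lagrange :: "complex \<Rightarrow> complex poly" where
  "lagrange w = smult (1 / (\<Prod>u\<in>zeros - {w}. w - u)) (\<Prod>u\<in>zeros - {w}. [:- u, 1:])"

lemma degree_lagrange: "w \<in> zeros \<Longrightarrow> degree (lagrange w) \<le> N"
  unfolding lagrange_def
  by (rule order_trans[OF degree_smult_le], subst degree_prod_eq_sum_degree)
     (use card_zeros finite_zeros in auto)

lemma poly_lagrange: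
  assumes "w \<in> zeros" "z \<in> zeros"
  shows "poly (lagrange w) z = (if z = w then 1 else 0)"
proof -
  have "(\<Prod>u\<in>zeros - {w}. w - u) \<noteq> 0"
    using finite_zeros by auto
  moreover have "z \<noteq> w \<Longrightarrow> (\<Prod>u\<in>zeros - {w}. z - u) = 0"
    using assms finite_zeros by (intro prod_zero) auto
  ultimately show ?thesis
    by (simp add: lagrange_def poly_prod)
qed

definition weight :: "complex \<Rightarrow> real" where
  "weight w = (\<integral>z. (cmod (poly (lagrange w) z))\<^sup>2 \<partial>M)"

lemma weight_pos:
  assumes "w \<in> zeros"
  shows "weight w > 0"
proof -
  have "lagrange w \<noteq> 0"
    using poly_lagrange[OF assms assms] by auto
  then have "weight w \<noteq> 0"
    using eq_0_if_ip_self_eq_0[OF supp degree_lagrange[OF assms]] by (auto simp: weight_def ip_self)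
  moreover have "weight w \<ge> 0"
    unfolding weight_def by (intro integral_nonneg_AE) auto
  ultimately show ?thesis by simp
qed

text \<open>Such a \<open>p\<close> is a multiple of \<open>A\<close>, and after the shift by \<open>z\<^bsup>-N\<^esup>\<close> the cofactor is the conjugate of an
  element of the span of \<open>z, \<dots>, z\<^bsup>N\<^esup>\<close>.\<close>

lemma integral_eq_0_if_zero_on_zeros:
  assumes p: "degree p \<le> 2 * N" and zero: "\<And>z. z \<in> zeros \<Longrightarrow> poly p z = 0"
  shows "(\<integral>z. cnj z ^ N * poly p z \<partial>M) = 0"
proof (cases "p = 0")
  case False
  obtain h where h: "p = A * h"
    using A_dvd[OF zero] by (auto simp: dvd_def)
  then have "degree h \<le> N - 1"
    using p False by (auto simp: degree_mult_eq degree_A)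
  then obtain R where R: "degree R \<le> N - 1" "\<And>z. cmod z = 1 \<Longrightarrow> poly R z = z ^ (N - 1) * cnj (poly h z)"
    using conj_poly_on_circle by blast
  have "(\<integral>z. cnj z ^ N * poly p z \<partial>M) = ip A (pCons 0 R)"
    unfolding ip_def
  proof (rule Bochner_Integration.integral_cong[OF refl])
    fix z assume "z \<in> space M"
    moreover have "z ^ N = z * z ^ (N - 1)" using N by (cases N) auto
    ultimately show "cnj z ^ N * poly p z = poly A z * cnj (poly (pCons 0 R) z)"
      by (simp add: R(2) space_M h mult_ac flip: complex_cnj_power)
  qed
  also have "\<dots> = 0"
    using R(1) N by (intro ortho_A) auto
  finally show ?thesis .
qed auto

text \<open>The squared moduli of the Lagrange polynomials are trigonometric polynomials of degree at most \<open>N\<close>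
  that interpolate at the zeros of \<open>A\<close>. So every trigonometric polynomial of that degree differs from a
  combination of them by one that vanishes at all nodes.\<close>

lemma quadrature:
  assumes p: "degree p \<le> 2 * N"
  shows "(\<integral>z. cnj z ^ N * poly p z \<partial>M) = (\<Sum>w\<in>zeros. cnj w ^ N * poly p w * weight w)"
proof -
  have "\<exists>q. degree q \<le> N \<and> (\<forall>z. cmod z = 1 \<longrightarrow> poly q z = z ^ N * cnj (poly (lagrange w) z))"
    if "w \<in> zeros" for w
    using conj_poly_on_circle[OF degree_lagrange[OF that]] by metis
  then obtain q where q: "\<And>w. w \<in> zeros \<Longrightarrow> degree (q w) \<le> N"
    "\<And>w z. w \<in> zeros \<Longrightarrow> cmod z = 1 \<Longrightarrow> poly (q w) z = z ^ N * cnj (poly (lagrange w) z)"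
    by metis
  define s where "s = (\<Sum>w\<in>zeros. smult (cnj w ^ N * poly p w) (lagrange w * q w))"
  have inv: "cnj z ^ N * z ^ N = 1" if "cmod z = 1" for z
    using that complex_norm_square[of z] by (simp add: mult.commute flip: power_mult_distrib)
  have s_circle: "cnj z ^ N * poly s z
      = (\<Sum>w\<in>zeros. cnj w ^ N * poly p w * complex_of_real ((cmod (poly (lagrange w) z))\<^sup>2))"
    if "cmod z = 1" for z
  proof -
    have "cnj z ^ N * (cnj w ^ N * poly p w * (poly (lagrange w) z * poly (q w) z))
      = cnj w ^ N * poly p w * complex_of_real ((cmod (poly (lagrange w) z))\<^sup>2)" if "w \<in> zeros" for w
    proof -
      have "cnj z ^ N * (cnj w ^ N * poly p w * (poly (lagrange w) z * poly (q w) z))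
        = (cnj z ^ N * z ^ N) * (cnj w ^ N * poly p w * (poly (lagrange w) z * cnj (poly (lagrange w) z)))"
        using that q(2)[OF that \<open>cmod z = 1\<close>] by (simp add: mult_ac)
      then show ?thesis
        using inv[OF \<open>cmod z = 1\<close>] by (simp add: complex_norm_square flip: of_real_power)
    qed
    then show ?thesis
      unfolding s_def poly_sum poly_smult poly_mult sum_distrib_left by (intro sum.cong refl)
  qed
  have s_Z: "poly (p - s) z = 0" if "z \<in> zeros" for z
  proof -
    have "cnj z ^ N * poly s z = (\<Sum>w\<in>zeros. if z = w then cnj w ^ N * poly p w else 0)"
      unfolding s_circle[OF cmod_zeros[OF that]]
      using that by (intro sum.cong refl) (simp add: poly_lagrange)
    also have "\<dots> = cnj z ^ N * poly p z"
      using that finite_zeros by simp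
    finally show ?thesis
      using cmod_zeros[OF that] by auto
  qed
  have "degree (lagrange w * q w) \<le> 2 * N" if "w \<in> zeros" for w
    using degree_mult_le[of "lagrange w" "q w"] degree_lagrange[OF that] q(1)[OF that] by simp
  then have "degree s \<le> 2 * N"
    unfolding s_def using finite_zeros
    by (intro degree_sum_le) (auto intro: order_trans[OF degree_smult_le])
  then have "(\<integral>z. cnj z ^ N * poly (p - s) z \<partial>M) = 0"
    using p s_Z by (intro integral_eq_0_if_zero_on_zeros degree_diff_le) auto
  moreover have int: "integrable M (\<lambda>z. cnj z ^ N * poly r z)" for r
    by (intro integrable_continuous continuous_intros)
  ultimately have "(\<integral>z. cnj z ^ N * poly p z \<partial>M) = (\<integral>z. cnj z ^ N * poly s z \<partial>M)"
    using Bochner_Integration.integral_diff[OF int[of p] int[of s]] by (simp add: ring_distribs)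
  also have "\<dots> = (\<integral>z. (\<Sum>w\<in>zeros. cnj w ^ N * poly p w * complex_of_real ((cmod (poly (lagrange w) z))\<^sup>2)) \<partial>M)"
    by (rule Bochner_Integration.integral_cong[OF refl]) (rule s_circle, simp add: space_M)
  also have "\<dots> = (\<Sum>w\<in>zeros. cnj w ^ N * poly p w * (\<integral>z. complex_of_real ((cmod (poly (lagrange w) z))\<^sup>2) \<partial>M))"
    by (subst Bochner_Integration.integral_sum)
       (auto simp del: of_real_power intro!: integrable_continuous continuous_intros)
  finally show ?thesis
    unfolding weight_def integral_complex_of_real .
qed

end

section \<open>The extremal problem for a measure on the circle\<close>

lemma torus_norm_round: "torus_norm x = \<bar>x - of_int (round x)\<bar>"
proof (rule antisym)
  show "torus_norm x \<le> \<bar>x - of_int (round x)\<bar>"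
    using infdist_le[of "of_int (round x)" \<int> x] by (simp add: dist_real_def)
  show "\<bar>x - of_int (round x)\<bar> \<le> torus_norm x"
    unfolding infdist_def
    using Ints_0 by (auto intro!: cINF_greatest elim!: Ints_cases simp: dist_real_def round_diff_minimal)
qed

lemma torus_norm_nonneg: "0 \<le> torus_norm x"
  by (rule infdist_nonneg)

lemma torus_norm_le_half: "torus_norm x \<le> 1 / 2"
  using of_int_round_abs_le[of x] by (simp add: torus_norm_round abs_minus_commute)

lemma torus_norm_cases:
  obtains n :: int where "x = of_int n + torus_norm x" | n :: int where "x = of_int n - torus_norm x"
  unfolding torus_norm_round by (cases "x - of_int (round x) \<ge> 0") force+

lemma torus_exp_torus_norm:
  "torus_exp x = torus_exp (torus_norm x) \<or> torus_exp x = cnj (torus_exp (torus_norm x))"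
proof (cases x rule: torus_norm_cases)
  case (1 n)
  then have "torus_exp x = torus_exp (of_int n + torus_norm x)" by simp
  then show ?thesis by (simp add: torus_exp_add)
next
  case (2 n)
  then have "torus_exp x = torus_exp (of_int n + - torus_norm x)" by simp
  then show ?thesis by (simp only: torus_exp_add torus_exp_minus) simp
qed

lemma Re_torus_exp: "Re (torus_exp x) = cos (2 * pi * x)"
  by (simp add: torus_exp_def)

lemma cos_torus_norm: "cos (2 * pi * torus_norm x) = cos (2 * pi * x)"
  unfolding Re_torus_exp[symmetric] using torus_exp_torus_norm[of x] by auto

lemma torus_norm_eq_arccos: "torus_norm x = arccos (cos (2 * pi * x)) / (2 * pi)"
proof -
  have "arccos (cos (2 * pi * torus_norm x)) = 2 * pi * torus_norm x"
    using torus_norm_nonneg[of x] torus_norm_le_half[of x]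
    by (intro arccos_cos) (auto simp: field_simps)
  then show ?thesis
    by (simp add: cos_torus_norm)
qed

text \<open>The cosine is a decreasing function of the distance to \<open>0\<close>, which makes the sign of the
  denominator in the extremal quotient explicit.\<close>

lemma torus_norm_le_iff_cos:
  assumes "0 \<le> t" "t \<le> 1 / 2"
  shows "t \<le> torus_norm x \<longleftrightarrow> cos (2 * pi * x) \<le> cos (2 * pi * t)"
proof -
  have "cos (2 * pi * torus_norm x) \<le> cos (2 * pi * t) \<longleftrightarrow> 2 * pi * t \<le> 2 * pi * torus_norm x"
    using torus_norm_nonneg[of x] torus_norm_le_half[of x] assms
    by (intro cos_mono_le_eq) (auto simp: field_simps)
  then show ?thesis
    by (simp add: cos_torus_norm)
qed

lemma torus_norm_id: "0 \<le> t \<Longrightarrow> t \<le> 1 / 2 \<Longrightarrow> torus_norm t = t"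
  unfolding torus_norm_eq_arccos by (subst arccos_cos) (auto simp: field_simps)

lemma surj_torus_exp:
  assumes "cmod z = 1"
  obtains x where "z = torus_exp x"
proof -
  have "z = cis (Arg z)"
    using rcis_cmod_Arg[of z] assms by (simp add: rcis_def)
  then have "z = torus_exp (Arg z / (2 * pi))"
    by (simp add: torus_exp_def)
  then show ?thesis ..
qed

text \<open>A nonnegative \<open>g\<close> has a minimum at a zero, so \<open>g\<close> and its derivative vanish there, and with them
  the derivative of \<open>z\<^bsup>N\<^esup> g\<close>.\<close>

lemma double_zero_of_nonneg:
  fixes g :: "real \<Rightarrow> real"
  assumes p: "\<And>x. torus_exp x ^ N * complex_of_real (g x) = poly p (torus_exp x)"
    and zero: "g x = 0" and nonneg: "\<forall>\<^sub>F y in nhds x. 0 \<le> g y"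
  shows "poly (pderiv p) (torus_exp x) = 0"
proof -
  define E where "E z = exp (2 * of_real pi * \<i> * z)" for z
  have E: "torus_exp y = E (of_real y)" for y
    by (simp add: torus_exp_def E_def cis_conv_exp mult_ac)
  have dE: "(E has_field_derivative 2 * of_real pi * \<i> * E z) (at z)" for z
    unfolding E_def by (auto intro!: derivative_eq_intros)
  \<comment> \<open>The extension of \<open>g\<close> to complex arguments; \<open>D\<close> is its derivative at \<open>x\<close>, where \<open>poly p (E x) = 0\<close>.\<close>
  define H where "H z = inverse (E z) ^ N * poly p (E z)" for z
  define D where "D = inverse (E (of_real x)) ^ N * (2 * of_real pi * \<i> * E (of_real x) * poly (pderiv p) (E (of_real x)))"
  have px: "poly p (E (of_real x)) = 0"
    using p[of x] zero by (simp add: E)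
  have E0: "E z \<noteq> 0" for z by (simp add: E_def)
  have dinv: "((\<lambda>z. inverse (E z) ^ N) has_field_derivative
      - of_nat N * 2 * of_real pi * \<i> * inverse (E z) ^ N) (at z)" for z
  proof -
    have "inverse (E z) ^ N = exp (- (of_nat N * (2 * of_real pi * \<i> * z)))" for z
      by (simp only: E_def exp_minus exp_of_nat_mult power_inverse)
    then show ?thesis
      by (auto intro!: derivative_eq_intros)
  qed
  have dp: "((\<lambda>z. poly p (E z)) has_field_derivative
      poly (pderiv p) (E z) * (2 * of_real pi * \<i> * E z)) (at z)" for z
    by (rule DERIV_chain2[OF poly_DERIV dE])
  have "(H has_field_derivative D) (at (of_real x))"
    unfolding H_def using DERIV_mult[OF dinv dp, of "of_real x"] px
    by (simp add: D_def mult_ac)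
  then have "((\<lambda>y. H (of_real y)) has_vector_derivative D) (at x)"
    by (rule has_vector_derivative_real_field)
  moreover have "H (of_real y) = complex_of_real (g y)" for y
    using E0 by (simp add: H_def p[symmetric] E[symmetric] field_simps)
  ultimately have dg: "((\<lambda>y. complex_of_real (g y)) has_vector_derivative D) (at x)"
    by simp
  have "(g has_vector_derivative Re D) (at x)"
    using bounded_linear.has_vector_derivative[OF bounded_linear_Re dg] by simp
  then have "(g has_real_derivative Re D) (at x)"
    by (simp add: has_real_derivative_iff_has_vector_derivative)
  moreover obtain d where "d > 0" "\<And>y. \<bar>x - y\<bar> < d \<Longrightarrow> g x \<le> g y"
    using nonneg zero unfolding eventually_nhds_metric
    by (auto simp: dist_real_def abs_minus_commute)
  ultimately have "Re D = 0"
    using DERIV_local_min by blast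
  moreover have "((\<lambda>y. 0) has_vector_derivative Im D) (at x)"
    using bounded_linear.has_vector_derivative[OF bounded_linear_Im dg] by simp
  then have "Im D = 0"
    using vector_derivative_unique_at has_vector_derivative_const by blast
  ultimately have "D = 0"
    by (simp add: complex_eq_iff)
  then show ?thesis
    using E0 by (simp add: D_def E)
qed

context para_orthogonal
begin

definition theta1 :: real where
  "theta1 = Min {torus_norm \<theta> | \<theta>. poly A (torus_exp \<theta>) = 0}"

lemma finite_root_norms: "finite {torus_norm \<theta> | \<theta>. poly A (torus_exp \<theta>) = 0}"
proof -
  have "{torus_norm \<theta> | \<theta>. poly A (torus_exp \<theta>) = 0} \<subseteq> (\<lambda>z. arccos (Re z) / (2 * pi)) ` zeros"
    by (auto simp: zeros_def torus_norm_eq_arccos Re_torus_exp[symmetric])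
  then show ?thesis
    using finite_zeros finite_subset by blast
qed

lemma theta1_le: "poly A (torus_exp \<theta>) = 0 \<Longrightarrow> theta1 \<le> torus_norm \<theta>"
  unfolding theta1_def by (intro Min_le finite_root_norms) auto

text \<open>The minimum is attained at some \<open>\<theta>\<close>, and \<open>torus_exp \<theta>\<close> is \<open>torus_exp \<theta>\<^sub>1\<close> or its conjugate; the
  coefficients of \<open>A\<close> are real.\<close>

lemma poly_A_theta1: "poly A (torus_exp theta1) = 0"
proof -
  obtain z where "z \<in> zeros"
    using card_zeros by (metis Suc_not_Zero card.empty all_not_in_conv)
  then obtain x where "poly A (torus_exp x) = 0"
    using surj_torus_exp[OF cmod_zeros] by (metis zeros_def mem_Collect_eq)
  then have "{torus_norm \<theta> | \<theta>. poly A (torus_exp \<theta>) = 0} \<noteq> {}" by blast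
  then have "theta1 \<in> {torus_norm \<theta> | \<theta>. poly A (torus_exp \<theta>) = 0}"
    unfolding theta1_def using finite_root_norms by (rule Min_in[rotated])
  then obtain \<theta> where \<theta>: "theta1 = torus_norm \<theta>" "poly A (torus_exp \<theta>) = 0" by auto
  then show ?thesis
    using torus_exp_torus_norm[of \<theta>] poly_A_cnj by auto
qed

lemma theta1_pos: "0 < theta1"
proof -
  have "theta1 \<noteq> 0"
    using poly_A_theta1 poly_A_1 by (auto simp: torus_exp_def)
  moreover have "0 \<le> theta1"
    unfolding theta1_def using poly_A_theta1 finite_root_norms
    by (subst Min_ge_iff) (auto simp: torus_norm_nonneg)
  ultimately show ?thesis by simp
qed

text \<open>Since \<open>N \<ge> 1\<close>, there are at least two zeros, and only one of them can be \<open>-1\<close>.\<close>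

lemma theta1_less_half: "theta1 < 1 / 2"
proof -
  have "\<not> zeros \<subseteq> {-1}"
    using card_mono[of "{-1}" zeros] card_zeros N by auto
  then obtain z where z: "z \<in> zeros" "z \<noteq> -1" by auto
  then obtain x where x: "z = torus_exp x"
    using surj_torus_exp[OF cmod_zeros] by metis
  have "torus_norm x \<noteq> 1 / 2"
  proof
    assume "torus_norm x = 1 / 2"
    moreover have "torus_exp (1 / 2) = -1" by (simp add: torus_exp_def)
    ultimately have "torus_exp (torus_norm x) = -1" by metis
    then show False
      using torus_exp_torus_norm[of x] x z by auto
  qed
  moreover have "theta1 \<le> torus_norm x"
    using theta1_le z x by (simp add: zeros_def)
  ultimately show ?thesis
    using torus_norm_le_half[of x] by simp
qed

text \<open>All nodes lie where \<open>g\<close> is nonnegative, so the quadrature forces \<open>g\<close> to vanish at each node. The nodes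
  are interior points of that region, hence double zeros, and \<open>z\<^bsup>N\<^esup> g\<close> has degree at most \<open>2 N\<close> but
  is divisible by \<open>A\<^sup>2\<close>.\<close>

lemma sign_change_lower_bound:
  fixes g :: "real \<Rightarrow> real"
  assumes g: "trig_poly N (\<lambda>x. complex_of_real (g x))"
    and r: "r < theta1" and nonneg: "\<And>x. r \<le> torus_norm x \<Longrightarrow> 0 \<le> g x"
    and G: "\<And>x. G (torus_exp x) = g x" and int: "(\<integral>z. G z \<partial>M) \<le> 0"
  shows "g x = 0"
proof -
  obtain p where p: "degree p \<le> 2 * N" "\<And>x. torus_exp x ^ N * complex_of_real (g x) = poly p (torus_exp x)"
    using g by (auto simp: trig_poly_def)
  have Gp: "complex_of_real (G z) = cnj z ^ N * poly p z" if z: "cmod z = 1" for z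
  proof -
    obtain x where "z = torus_exp x" using surj_torus_exp[OF z] .
    then show ?thesis
      by (simp add: G p(2)[symmetric] cnj_torus_exp field_simps)
  qed
  have "complex_of_real (\<integral>z. G z \<partial>M) = (\<integral>z. cnj z ^ N * poly p z \<partial>M)"
    unfolding integral_complex_of_real[symmetric]
    by (rule Bochner_Integration.integral_cong[OF refl]) (simp add: Gp space_M)
  also have "\<dots> = (\<Sum>w\<in>zeros. cnj w ^ N * poly p w * weight w)"
    by (rule quadrature[OF p(1)])
  also have "\<dots> = complex_of_real (\<Sum>w\<in>zeros. G w * weight w)"
    unfolding of_real_sum by (intro sum.cong refl) (simp add: Gp[symmetric] cmod_zeros)
  finally have sum_le: "(\<Sum>w\<in>zeros. G w * weight w) \<le> 0"
    using int by (simp only: of_real_eq_iff)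
  have G_nonneg: "G (torus_exp x) \<ge> 0" if "torus_exp x \<in> zeros" for x
    using nonneg[of x] theta1_le[of x] that r by (simp add: G zeros_def)
  then have nonneg_Z: "G w \<ge> 0" if "w \<in> zeros" for w
    using surj_torus_exp[OF cmod_zeros[OF that]] that by metis
  then have "(\<Sum>w\<in>zeros. G w * weight w) = 0"
    using sum_le weight_pos by (intro antisym sum_nonneg) (auto simp: less_imp_le)
  then have G_zero: "G w = 0" if "w \<in> zeros" for w
    using that nonneg_Z weight_pos finite_zeros
    by (subst (asm) sum_nonneg_eq_0_iff) (force simp: less_imp_le)+
  have "poly p w = 0" if "w \<in> zeros" for w
    using Gp[OF cmod_zeros[OF that]] G_zero[OF that] cmod_zeros[OF that] by auto
  then obtain h where h: "p = A * h"
    using A_dvd by (auto simp: dvd_def)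
  have "poly h w = 0" if w: "w \<in> zeros" for w
  proof -
    obtain x where x: "w = torus_exp x" using surj_torus_exp[OF cmod_zeros[OF w]] .
    have "r < torus_norm x"
      using theta1_le[of x] w r x by (simp add: zeros_def)
    moreover have "(torus_norm \<longlongrightarrow> torus_norm x) (nhds x)"
      by (rule tendsto_infdist[OF filterlim_ident])
    ultimately have "\<forall>\<^sub>F y in nhds x. r < torus_norm y"
      by (rule order_tendstoD(1)[rotated])
    then have "\<forall>\<^sub>F y in nhds x. 0 \<le> g y"
      by eventually_elim (simp add: nonneg)
    moreover have "g x = 0"
      using G_zero[OF w] by (simp add: x G)
    ultimately have "poly (pderiv p) w = 0"
      using double_zero_of_nonneg[OF p(2)] by (simp add: x)
    moreover have "poly A w = 0"
      using w by (simp add: zeros_def)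
    ultimately show ?thesis
      using simple_root[of w] by (simp add: h pderiv_mult)
  qed
  then obtain k where "h = A * k"
    using A_dvd by (auto simp: dvd_def)
  then have "p = A * (A * k)" using h by simp
  then have "p = 0"
    using p(1) A_nonzero by (cases "k = 0") (auto simp: degree_mult_eq degree_A)
  then show ?thesis
    using p(2)[of x] by simp
qed

text \<open>Writing \<open>A = (z - a) (z - cnj a) B\<close> with \<open>a = torus_exp \<theta>\<^sub>1\<close>, one has
  \<open>A = 2 z (Re z - cos (2 \<pi> \<theta>\<^sub>1)) B\<close> on the circle. The last claim is the orthogonality of \<open>A\<close> to \<open>z B\<close>.\<close>

lemma extremal_factorization:
  obtains B where "B \<noteq> 0" "degree B = N - 1" "\<And>z. cmod (poly B (cnj z)) = cmod (poly B z)"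
    "\<And>z. cmod z = 1 \<Longrightarrow> (cmod (poly A z))\<^sup>2 = 4 * (Re z - cos (2 * pi * theta1))\<^sup>2 * (cmod (poly B z))\<^sup>2"
    "(\<integral>z. (cos (2 * pi * theta1) - Re z) * (cmod (poly B z))\<^sup>2 \<partial>M) = 0"
proof -
  define a where "a = torus_exp theta1"
  define c where "c = cos (2 * pi * theta1)"
  have "Im a > 0"
    using theta1_pos theta1_less_half by (auto simp: a_def torus_exp_def intro!: sin_gt_zero)
  then have neq: "cnj a \<noteq> a"
    by (metis Im_complex_of_real Reals_cases Reals_cnj_iff less_irrefl)
  obtain C where C: "A = [:- a, 1:] * C"
    using poly_A_theta1 by (auto simp: poly_eq_0_iff_dvd a_def)
  have "poly A (cnj a) = 0"
    using poly_A_theta1 by (simp add: poly_A_cnj a_def)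
  then have "poly C (cnj a) = 0"
    using neq by (simp add: C)
  then obtain B where B: "C = [:- cnj a, 1:] * B"
    by (auto simp: poly_eq_0_iff_dvd)
  have poly_A: "poly A z = (z - a) * ((z - cnj a) * poly B z)" for z
    unfolding C B by (simp only: poly_mult) simp
  have quad: "(z - a) * (z - cnj a) = z\<^sup>2 - 2 * of_real c * z + 1" for z
  proof -
    have "a + cnj a = 2 * of_real c"
      by (simp add: a_def c_def cos_torus)
    moreover have "a * cnj a = 1"
      by (simp add: a_def torus_exp_times_cnj)
    moreover have "(z - a) * (z - cnj a) = z\<^sup>2 - (a + cnj a) * z + a * cnj a"
      by (simp add: algebra_simps power2_eq_square)
    ultimately show ?thesis by simp
  qed
  have A_circle: "poly A z = z * of_real (2 * (Re z - c)) * poly B z" if "cmod z = 1" for z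
  proof -
    have zz: "z * cnj z = 1"
      using complex_norm_square[of z] that by simp
    have "of_real (2 * Re z) = z + cnj z"
      by (simp add: complex_add_cnj)
    then have "z * of_real (2 * (Re z - c)) = z\<^sup>2 - 2 * of_real c * z + z * cnj z"
      by (simp add: algebra_simps power2_eq_square)
    then show ?thesis
      by (simp add: poly_A mult.assoc[symmetric] quad zz)
  qed
  show ?thesis
  proof
    show B0: "B \<noteq> 0"
      using A_nonzero C B by auto
    have "degree A = degree B + 2"
      unfolding C B using B0 by (simp add: degree_mult_eq del: mult_pCons_left)
    then show degB: "degree B = N - 1"
      using degree_A by simp
    show "cmod (poly B (cnj z)) = cmod (poly B z)" for z
    proof -
      have "poly ([:- a, 1:] * [:- cnj a, 1:] * map_poly cnj B) z = poly ([:- a, 1:] * [:- cnj a, 1:] * B) z" for z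
        using poly_A_cnj[of "cnj z"]
        by (simp only: poly_A poly_mult poly_map_cnj) auto
      then have "[:- a, 1:] * [:- cnj a, 1:] * map_poly cnj B = [:- a, 1:] * [:- cnj a, 1:] * B"
        using poly_eq_poly_eq_iff by blast
      then have "[:- a, 1:] * [:- cnj a, 1:] = 0 \<or> map_poly cnj B = B"
        by (rule mult_cancel_left[THEN iffD1])
      then have "map_poly cnj B = B"
        by (simp only: mult_eq_0_iff) simp
      then show ?thesis
        using poly_map_cnj[of B z] by (metis complex_mod_cnj)
    qed
    show "(cmod (poly A z))\<^sup>2 = 4 * (Re z - cos (2 * pi * theta1))\<^sup>2 * (cmod (poly B z))\<^sup>2"
      if "cmod z = 1" for z
      unfolding A_circle[OF that] norm_mult norm_of_real that
      by (simp add: c_def power2_eq_square algebra_simps)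
    have "complex_of_real (\<integral>z. 2 * (Re z - c) * (cmod (poly B z))\<^sup>2 \<partial>M) = ip A (pCons 0 B)"
      unfolding integral_complex_of_real[symmetric] ip_def
    proof (rule Bochner_Integration.integral_cong[OF refl])
      fix z assume "z \<in> space M"
      then have z: "cmod z = 1" by (simp add: space_M)
      then have zz: "z * cnj z = 1"
        using complex_norm_square[of z] by simp
      have "poly A z * cnj (poly (pCons 0 B) z)
          = (z * cnj z) * (of_real (2 * (Re z - c)) * (poly B z * cnj (poly B z)))"
        by (simp add: A_circle[OF z] mult_ac)
      then show "complex_of_real (2 * (Re z - c) * (cmod (poly B z))\<^sup>2) = poly A z * cnj (poly (pCons 0 B) z)"
        by (simp add: z flip: complex_norm_square)
    qed
    also have "\<dots> = 0"
      using degB N by (intro ortho_A) auto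
    finally have "(\<integral>z. 2 * (Re z - c) * (cmod (poly B z))\<^sup>2 \<partial>M) = 0" by simp
    moreover have "(\<integral>z. (c - Re z) * (cmod (poly B z))\<^sup>2 \<partial>M)
        = (\<integral>z. (- 1 / 2) * (2 * (Re z - c) * (cmod (poly B z))\<^sup>2) \<partial>M)"
      by (intro Bochner_Integration.integral_cong refl) (simp add: algebra_simps)
    ultimately show "(\<integral>z. (cos (2 * pi * theta1) - Re z) * (cmod (poly B z))\<^sup>2 \<partial>M) = 0"
      unfolding c_def by (simp only: integral_mult_right_zero)
  qed
qed

end

section \<open>The extremal problem for an even measure on the torus\<close>

lemma sign_radius_le:
  assumes "0 < r" "nonneg_outside_ball X \<delta> f r"
  shows "sign_radius X \<delta> f \<le> r"
  unfolding sign_radius_def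
  by (rule cInf_lower) (use assms in \<open>auto intro!: bdd_belowI[of _ 0]\<close>)

lemma isCont_torus_exp: "isCont torus_exp x"
  unfolding torus_exp_def cis_conv_exp by (intro continuous_intros)

lemma measurable_torus_exp: "torus_exp \<in> torus_borel \<rightarrow>\<^sub>M restrict_space borel (sphere 0 1)"
proof (rule measurable_restrict_space2)
  show "torus_exp \<in> torus_borel \<rightarrow>\<^sub>M borel"
    unfolding torus_borel_def by (rule measurable_vimage_algebra1) auto
qed (auto simp: torus_borel_def)

lemma scale_measure_density:
  "scale_measure (ennreal r) M = density M (\<lambda>_. ennreal r)"
  by (rule measure_eqI) (auto simp: emeasure_density_const)

text \<open>Evenness is tested on functions of \<open>torus_exp x\<close>, whose conjugate is \<open>torus_exp (- x)\<close>.\<close>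

locale even_torus_measure = finite_measure \<nu> for \<nu> :: "real measure" +
  assumes sets_nu: "sets \<nu> = sets torus_borel"
    and even_nu: "\<And>f :: complex \<Rightarrow> complex. continuous_on UNIV f \<Longrightarrow>
      (\<integral>x. f (cnj (torus_exp x)) \<partial>\<nu>) = (\<integral>x. f (torus_exp x) \<partial>\<nu>)"
begin

definition normalized_circle :: "complex measure" where
  "normalized_circle = circle_measure (scale_measure (1 / emeasure \<nu> (space \<nu>)) \<nu>)"

lemma measurable_exp: "torus_exp \<in> \<nu> \<rightarrow>\<^sub>M restrict_space borel (sphere 0 1)"
  using measurable_torus_exp measurable_cong_sets[OF sets_nu refl] by blast

lemma measurable_exp_scaled: "torus_exp \<in> scale_measure r \<nu> \<rightarrow>\<^sub>M restrict_space borel (sphere 0 1)"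
  using measurable_exp measurable_cong_sets[OF sets_scale_measure refl] by blast

lemma emeasure_circle_measure:
  assumes "U \<in> sets (restrict_space borel (sphere 0 1))"
  shows "emeasure (circle_measure (scale_measure r \<nu>)) U = r * emeasure (circle_measure \<nu>) U"
  unfolding circle_measure_def
  by (simp add: emeasure_distr[OF measurable_exp_scaled assms] emeasure_distr[OF measurable_exp assms]
      space_scale_measure)

context
  assumes nonzero: "emeasure \<nu> (space \<nu>) \<noteq> 0"
begin

lemma scale_factor: "1 / emeasure \<nu> (space \<nu>) = ennreal (1 / measure \<nu> (space \<nu>))"
  "measure \<nu> (space \<nu>) > 0"
proof -
  show "measure \<nu> (space \<nu>) > 0"
    using nonzero by (simp add: emeasure_eq_measure zero_less_measure_iff)
  then show "1 / emeasure \<nu> (space \<nu>) = ennreal (1 / measure \<nu> (space \<nu>))"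
    by (simp add: emeasure_eq_measure divide_ennreal flip: ennreal_1)
qed

lemma circle_finite_measure_normalized_circle: "circle_finite_measure normalized_circle"
proof (intro circle_finite_measure.intro circle_finite_measure_axioms.intro finite_measureI)
  show "sets normalized_circle = sets (restrict_space borel (sphere 0 1))"
    by (simp add: normalized_circle_def circle_measure_def)
  have "space normalized_circle \<in> sets (restrict_space borel (sphere 0 1))"
    unfolding normalized_circle_def circle_measure_def space_distr by (rule sets.top)
  then show "emeasure normalized_circle (space normalized_circle) \<noteq> \<infinity>"
    unfolding normalized_circle_def using measurable_exp
    by (simp add: emeasure_circle_measure scale_factor circle_measure_def emeasure_distr
        ennreal_mult_eq_top_iff)
qed

lemma measure_support_normalized_circle: "measure_support normalized_circle = measure_support (circle_measure \<nu>)"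
proof -
  have "emeasure normalized_circle (U \<inter> space normalized_circle) > 0 \<longleftrightarrow> emeasure (circle_measure \<nu>) (U \<inter> space normalized_circle) > 0" if "open U" for U
  proof -
    have "U \<inter> space normalized_circle \<in> sets (restrict_space borel (sphere 0 1))"
      unfolding normalized_circle_def circle_measure_def space_distr space_restrict_space
      using open_Int_in_restrict_space[OF that] by simp
    then show ?thesis
      using scale_factor(2) unfolding normalized_circle_def emeasure_circle_measure scale_factor(1)
      by (simp add: emeasure_circle_measure ennreal_zero_less_mult_iff)
  qed
  moreover have "space normalized_circle = space (circle_measure \<nu>)"
    by (simp add: normalized_circle_def circle_measure_def)
  ultimately show ?thesis
    unfolding measure_support_def by auto
qed

lemma integral_normalized_circle:
  fixes G :: "complex \<Rightarrow> 'b::{second_countable_topology, banach}"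
  assumes "continuous_on UNIV G"
  shows "(\<integral>z. G z \<partial>normalized_circle) = (1 / measure \<nu> (space \<nu>)) *\<^sub>R (\<integral>x. G (torus_exp x) \<partial>\<nu>)"
proof -
  have G: "G \<in> borel_measurable (restrict_space borel (sphere 0 1))"
    using assms by (intro borel_measurable_continuous_on_restrict) (rule continuous_on_subset, auto)
  then have "(\<integral>z. G z \<partial>normalized_circle)
      = (\<integral>x. G (torus_exp x) \<partial>scale_measure (ennreal (1 / measure \<nu> (space \<nu>))) \<nu>)"
    unfolding normalized_circle_def circle_measure_def scale_factor by (intro integral_distr measurable_exp_scaled)
  also have "\<dots> = (\<integral>x. (1 / measure \<nu> (space \<nu>)) *\<^sub>R G (torus_exp x) \<partial>\<nu>)"
    unfolding scale_measure_density
    by (subst integral_density) (use measurable_compose[OF measurable_exp G] in auto)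
  finally show ?thesis
    by simp
qed

end

context
  fixes N :: nat
  assumes N: "N \<ge> 1" and supp: "less_card N (measure_support (circle_measure \<nu>))"
begin

lemma nu_nonzero: "emeasure \<nu> (space \<nu>) \<noteq> 0"
proof
  assume "emeasure \<nu> (space \<nu>) = 0"
  then have "emeasure (circle_measure \<nu>) U = 0" if "U \<in> sets (restrict_space borel (sphere 0 1))" for U
    unfolding circle_measure_def emeasure_distr[OF measurable_exp that]
    by (metis emeasure_space le_zero_eq)
  from this[OF sets.top] have null: "emeasure (circle_measure \<nu>) (UNIV \<inter> space (circle_measure \<nu>)) = 0"
    by (simp add: circle_measure_def)
  have "z \<notin> measure_support (circle_measure \<nu>)" for z
  proof
    assume "z \<in> measure_support (circle_measure \<nu>)"
    then have "0 < emeasure (circle_measure \<nu>) (UNIV \<inter> space (circle_measure \<nu>))"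
      unfolding measure_support_def using open_UNIV by blast
    with null show False by simp
  qed
  then have "measure_support (circle_measure \<nu>) = {}" by blast
  then show False
    using supp by (simp add: less_card_def)
qed

lemma para_orthogonal_torus_A: "para_orthogonal normalized_circle N (torus_A \<nu> (N + 1))"
proof -
  interpret circle_finite_measure normalized_circle
    by (rule circle_finite_measure_normalized_circle[OF nu_nonzero])
  have "para_orthogonal normalized_circle N (circle_A normalized_circle (Suc N))"
  proof (rule para_orthogonal_circle_A[OF N])
    show "less_card N (measure_support normalized_circle)"
      using supp by (simp add: measure_support_normalized_circle[OF nu_nonzero])
    show "(\<integral>z. f (cnj z) \<partial>normalized_circle) = (\<integral>z. f z \<partial>normalized_circle)" if "continuous_on UNIV f" for f :: "complex \<Rightarrow> complex"
    proof -
      have "continuous_on UNIV (\<lambda>z. f (cnj z))"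
        using that by (intro continuous_on_compose2[OF that] continuous_intros) auto
      then show ?thesis
        using that by (simp add: integral_normalized_circle[OF nu_nonzero] even_nu)
    qed
  qed
  then show ?thesis
    by (simp add: torus_A_def normalized_circle_def)
qed

interpretation para_orthogonal normalized_circle N "torus_A \<nu> (N + 1)"
  by (rule para_orthogonal_torus_A)

lemma first_zero_eq: "first_zero \<nu> (N + 1) = theta1"
  unfolding first_zero_def theta1_def ..

lemma first_zero_bounds: "0 < first_zero \<nu> (N + 1)" "first_zero \<nu> (N + 1) < 1 / 2"
  unfolding first_zero_eq by (rule theta1_pos theta1_less_half)+

text \<open>A competitor with a smaller radius would be nonnegative from some radius below \<open>\<theta>\<^sub>1\<close> on, and
  \<open>sign_change_lower_bound\<close> shows that it vanishes identically.\<close>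

lemma first_zero_le_sign_radius:
  assumes f: "f \<in> torus_class \<nu> N" and nz: "f x \<noteq> 0"
  shows "first_zero \<nu> (N + 1) \<le> sign_radius UNIV torus_norm f"
proof (rule ccontr)
  assume "\<not> ?thesis"
  then have "Inf {r. 0 < r \<and> nonneg_outside_ball UNIV torus_norm f r} < theta1"
    unfolding first_zero_eq sign_radius_def by (simp only: not_le)
  moreover have "{r. 0 < r \<and> nonneg_outside_ball UNIV torus_norm f r} \<noteq> {}"
    using f by (auto simp: torus_class_def eventually_nonneg_def)
  ultimately obtain r where r: "r < theta1" "nonneg_outside_ball UNIV torus_norm f r"
    using cInf_lessD[of "{r. 0 < r \<and> nonneg_outside_ball UNIV torus_norm f r}" theta1] by blast
  have trig: "trig_poly N (\<lambda>x. complex_of_real (f x))"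
    using f by (auto simp: torus_class_def trig_poly_iff)
  then obtain G :: "complex \<Rightarrow> real" where contG: "continuous_on UNIV G" and G: "\<And>x. G (torus_exp x) = f x"
    using trig_poly_continuous_on_circle[OF trig] by blast
  have "(\<integral>z. G z \<partial>normalized_circle) = (1 / measure \<nu> (space \<nu>)) *\<^sub>R (\<integral>x. f x \<partial>\<nu>)"
    unfolding G[symmetric] by (intro integral_normalized_circle nu_nonzero contG)
  moreover have "(\<integral>x. f x \<partial>\<nu>) \<le> 0"
    using f by (simp add: torus_class_def)
  ultimately have "(\<integral>z. G z \<partial>normalized_circle) \<le> 0"
    by (simp add: divide_nonpos_nonneg)
  then have "f x = 0"
    using r by (intro sign_change_lower_bound[OF trig r(1) _ G]) (auto simp: nonneg_outside_ball_def)
  with nz show False ..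
qed

text \<open>Identifies the quotient with a trigonometric polynomial, which is continuous and hence also gives
  its values at the zeros of the denominator. These zeros are isolated because
  \<open>0 < \<theta>\<^sub>1 < 1/2\<close> makes the derivative of the cosine nonzero there.\<close>

lemma extremal_fun_formula:
  obtains B where "B \<noteq> 0" "degree B = N - 1" "\<And>z. cmod (poly B (cnj z)) = cmod (poly B z)"
    "(\<integral>z. (cos (2 * pi * first_zero \<nu> (N + 1)) - Re z) * (cmod (poly B z))\<^sup>2 \<partial>normalized_circle) = 0"
    "\<And>x. extremal_fun \<nu> N x
      = 4 * (cos (2 * pi * first_zero \<nu> (N + 1)) - cos (2 * pi * x)) * (cmod (poly B (torus_exp x)))\<^sup>2"
proof -
  obtain B where B: "B \<noteq> 0" "degree B = N - 1" "\<And>z. cmod (poly B (cnj z)) = cmod (poly B z)"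
    "\<And>z. cmod z = 1 \<Longrightarrow> (cmod (poly (torus_A \<nu> (N + 1)) z))\<^sup>2 = 4 * (Re z - cos (2 * pi * theta1))\<^sup>2 * (cmod (poly B z))\<^sup>2"
    "(\<integral>z. (cos (2 * pi * theta1) - Re z) * (cmod (poly B z))\<^sup>2 \<partial>normalized_circle) = 0"
    using extremal_factorization by blast
  define c where "c = cos (2 * pi * theta1)"
  define f where "f x = 4 * (c - cos (2 * pi * x)) * (cmod (poly B (torus_exp x)))\<^sup>2" for x
  have quot: "extremal_quotient \<nu> N x = f x" if "cos (2 * pi * x) \<noteq> c" for x
  proof -
    have "extremal_quotient \<nu> N x
        = 4 * (cos (2 * pi * x) - c)\<^sup>2 * (cmod (poly B (torus_exp x)))\<^sup>2 / (c - cos (2 * pi * x))"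
      unfolding extremal_quotient_def first_zero_eq B(4)[OF norm_torus_exp] c_def Re_torus_exp ..
    also have "\<dots> = f x"
      using that by (simp add: f_def field_simps power2_eq_square)
    finally show ?thesis .
  qed
  have cont: "isCont f x" for x
    unfolding f_def by (intro continuous_intros isCont_o2[OF isCont_torus_exp])
  have F: "extremal_fun \<nu> N x = f x" for x
  proof (cases "cos (2 * pi * x) = c")
    case True
    have "(sin (2 * pi * x))\<^sup>2 = (sin (2 * pi * theta1))\<^sup>2"
      using True by (simp add: sin_squared_eq c_def)
    moreover have "sin (2 * pi * theta1) > 0"
      using theta1_pos theta1_less_half by (intro sin_gt_zero) auto
    ultimately have sin: "sin (2 * pi * x) \<noteq> 0" by auto
    have "((\<lambda>y. cos (2 * pi * y)) has_real_derivative - sin (2 * pi * x) * (2 * pi)) (at x)"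
      by (auto intro!: derivative_eq_intros)
    then have "((\<lambda>y. (cos (2 * pi * y) - cos (2 * pi * x)) / (y - x)) \<longlongrightarrow> - sin (2 * pi * x) * (2 * pi)) (at x)"
      by (simp add: has_field_derivative_iff)
    then have "\<forall>\<^sub>F y in at x. (cos (2 * pi * y) - cos (2 * pi * x)) / (y - x) \<noteq> 0"
      by (rule tendsto_imp_eventually_ne) (use sin in simp)
    then have "\<forall>\<^sub>F y in at x. f y = extremal_quotient \<nu> N y"
      by eventually_elim (use True quot in auto)
    moreover have "(f \<longlongrightarrow> f x) (at x)"
      using cont[of x] by (simp add: isCont_def)
    ultimately have "(extremal_quotient \<nu> N \<longlongrightarrow> f x) (at x)"
      by (subst (asm) tendsto_cong)
    then have "Lim (at x) (extremal_quotient \<nu> N) = f x"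
      by (intro tendsto_Lim) auto
    then show ?thesis
      using True unfolding extremal_fun_def first_zero_eq c_def by simp
  next
    case False
    then show ?thesis
      using quot unfolding extremal_fun_def first_zero_eq c_def by simp
  qed
  have "(\<integral>z. (cos (2 * pi * first_zero \<nu> (N + 1)) - Re z) * (cmod (poly B z))\<^sup>2 \<partial>normalized_circle) = 0"
    using B(5) unfolding first_zero_eq .
  moreover have "extremal_fun \<nu> N x
      = 4 * (cos (2 * pi * first_zero \<nu> (N + 1)) - cos (2 * pi * x)) * (cmod (poly B (torus_exp x)))\<^sup>2" for x
    unfolding F f_def c_def first_zero_eq ..
  ultimately show ?thesis
    by (rule that[OF B(1-3)])
qed

lemma
  shows trig_poly_extremal_fun: "trig_poly N (\<lambda>x. complex_of_real (extremal_fun \<nu> N x))"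
    and extremal_fun_minus: "extremal_fun \<nu> N (- x) = extremal_fun \<nu> N x"
    and integral_extremal_fun: "(\<integral>x. extremal_fun \<nu> N x \<partial>\<nu>) = 0"
    and extremal_fun_nonzero: "\<exists>x. extremal_fun \<nu> N x \<noteq> 0"
    and extremal_fun_nonneg: "first_zero \<nu> (N + 1) \<le> torus_norm x \<Longrightarrow> 0 \<le> extremal_fun \<nu> N x"
proof -
  define c where "c = cos (2 * pi * first_zero \<nu> (N + 1))"
  obtain B where B: "B \<noteq> 0" "degree B = N - 1" "\<And>z. cmod (poly B (cnj z)) = cmod (poly B z)"
    "(\<integral>z. (c - Re z) * (cmod (poly B z))\<^sup>2 \<partial>normalized_circle) = 0"
    and f: "\<And>x. extremal_fun \<nu> N x = 4 * (c - cos (2 * pi * x)) * (cmod (poly B (torus_exp x)))\<^sup>2"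
    unfolding c_def by (rule extremal_fun_formula) blast
  have "trig_poly (1 + (N - 1)) (\<lambda>x. (complex_of_real (4 * c) + (- 4) * complex_of_real (cos (2 * pi * x)))
      * complex_of_real ((cmod (poly B (torus_exp x)))\<^sup>2))"
    by (intro trig_poly_mult trig_poly_add trig_poly_const trig_poly_cmult trig_poly_cos
        trig_poly_norm_square) (simp add: B)
  moreover have "1 + (N - 1) = N" using N by simp
  moreover have "(\<lambda>x. (complex_of_real (4 * c) + (- 4) * complex_of_real (cos (2 * pi * x)))
      * complex_of_real ((cmod (poly B (torus_exp x)))\<^sup>2)) = (\<lambda>x. complex_of_real (extremal_fun \<nu> N x))"
    by (simp add: f algebra_simps)
  ultimately show "trig_poly N (\<lambda>x. complex_of_real (extremal_fun \<nu> N x))"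
    by (simp only:)
  show "extremal_fun \<nu> N (- x) = extremal_fun \<nu> N x"
    by (simp add: f torus_exp_minus B(3))
  have "(\<integral>z. 4 * ((c - Re z) * (cmod (poly B z))\<^sup>2) \<partial>normalized_circle)
      = (1 / measure \<nu> (space \<nu>)) *\<^sub>R (\<integral>x. 4 * ((c - Re (torus_exp x)) * (cmod (poly B (torus_exp x)))\<^sup>2) \<partial>\<nu>)"
    by (intro integral_normalized_circle nu_nonzero continuous_intros)
  moreover have "(\<integral>z. 4 * ((c - Re z) * (cmod (poly B z))\<^sup>2) \<partial>normalized_circle) = 0"
    using B(4) by simp
  moreover have "(\<lambda>x. 4 * ((c - Re (torus_exp x)) * (cmod (poly B (torus_exp x)))\<^sup>2)) = extremal_fun \<nu> N"
    by (simp add: fun_eq_iff f Re_torus_exp)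
  ultimately show "(\<integral>x. extremal_fun \<nu> N x \<partial>\<nu>) = 0"
    using scale_factor(2)[OF nu_nonzero] by simp
  show "0 \<le> extremal_fun \<nu> N x" if "first_zero \<nu> (N + 1) \<le> torus_norm x"
  proof -
    have "cos (2 * pi * x) \<le> c"
      using that first_zero_bounds torus_norm_le_iff_cos[of "first_zero \<nu> (N + 1)" x] by (simp add: c_def)
    then show ?thesis by (simp add: f)
  qed
  show "\<exists>x. extremal_fun \<nu> N x \<noteq> 0"
  proof (rule ccontr)
    assume "\<nexists>x. extremal_fun \<nu> N x \<noteq> 0"
    then have zero: "(c - cos (2 * pi * x)) * (cmod (poly B (torus_exp x)))\<^sup>2 = 0" for x
      by (simp add: f)
    have *: "poly B (torus_exp x) = 0" if "x \<in> {first_zero \<nu> (N + 1)<..<1/2}" for x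
    proof -
      have "cos (2 * pi * x) < c"
        unfolding c_def using that first_zero_bounds by (intro cos_monotone_0_pi) (auto simp: field_simps)
      then show ?thesis using zero[of x] by auto
    qed
    have trig: "trig_poly (degree B) (\<lambda>x. complex_of_real ((cmod (poly B (torus_exp x)))\<^sup>2))"
      by (rule trig_poly_norm_square) simp
    obtain a b where ab: "first_zero \<nu> (N + 1) < a" "a < b" "b < 1/2"
      using first_zero_bounds by (meson dense)
    have "complex_of_real ((cmod (poly B (torus_exp x)))\<^sup>2) = 0" for x
      by (rule trig_poly_eq_0_interval[OF trig, of a b]) (use * ab first_zero_bounds in auto)
    then have "poly B z = 0" if "cmod z = 1" for z
      using surj_torus_exp[OF that] by (metis norm_eq_zero of_real_eq_0_iff zero_eq_power2)
    then have "torus_exp ` {0..1/2} \<subseteq> {z. poly B z = 0}" by auto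
    moreover have "infinite (torus_exp ` {0..1/2})"
      by (rule infinite_torus_exp_interval) auto
    ultimately show False
      using B(1) poly_roots_finite finite_subset by blast
  qed
qed

lemma extremal_fun_in_torus_class: "extremal_fun \<nu> N \<in> torus_class \<nu> N"
proof -
  have "eventually_nonneg UNIV torus_norm (extremal_fun \<nu> N)"
    unfolding eventually_nonneg_def nonneg_outside_ball_def
    using first_zero_bounds extremal_fun_nonneg by (intro exI[of _ "first_zero \<nu> (N + 1)"]) auto
  then show ?thesis
    using trig_poly_extremal_fun integral_extremal_fun by (simp add: torus_class_def trig_poly_iff)
qed

lemma torus_rho_eq: "torus_rho \<nu> N = first_zero \<nu> (N + 1)"
proof (rule antisym)
  have "torus_rho \<nu> N \<le> sign_radius UNIV torus_norm (extremal_fun \<nu> N)"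
    unfolding torus_rho_def
    by (intro cINF_lower bdd_belowI2[of _ "first_zero \<nu> (N + 1)"])
       (use extremal_fun_in_torus_class extremal_fun_nonzero first_zero_le_sign_radius in auto)
  also have "\<dots> \<le> first_zero \<nu> (N + 1)"
    using first_zero_bounds extremal_fun_nonneg
    by (intro sign_radius_le) (auto simp: nonneg_outside_ball_def)
  finally show "torus_rho \<nu> N \<le> first_zero \<nu> (N + 1)" .
  show "first_zero \<nu> (N + 1) \<le> torus_rho \<nu> N"
    unfolding torus_rho_def
    by (rule cINF_greatest)
       (use extremal_fun_in_torus_class extremal_fun_nonzero first_zero_le_sign_radius in auto)
qed

end

end

section \<open>The polar part as an image measure\<close>

text \<open>The polar angle divided by \<open>2 \<pi>\<close>, with values in \<open>[0, 1/2]\<close>.\<close>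

definition latitude :: "real ^ 'd::finite option \<Rightarrow> real" where
  "latitude x = arccos (x \<bullet> pole) / (2 * pi)"

lemma norm_pole [simp]: "norm (pole :: real ^ 'd::finite option) = 1"
  by (simp add: pole_def)

lemma inner_pole_pole [simp]: "(pole :: real ^ 'd::finite option) \<bullet> pole = 1"
  using norm_eq_1[of "pole :: real ^ 'd option"] by simp

lemma inner_pole: "x \<bullet> pole = x $ None"
  by (simp add: pole_def inner_axis)

lemma norm_option_vec:
  "(norm (x :: real ^ 'd::finite option))\<^sup>2 = (x $ None)\<^sup>2 + (\<Sum>j\<in>UNIV. (x $ Some j)\<^sup>2)"
  unfolding power2_norm_eq_inner inner_vec_def UNIV_option_conv
  by (simp add: sum.reindex power2_eq_square)

lemma abs_inner_pole_le: "norm x = 1 \<Longrightarrow> \<bar>x \<bullet> (pole :: real ^ 'd::finite option)\<bar> \<le> 1"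
  using Cauchy_Schwarz_ineq2[of x pole] by simp

lemma latitude_bounds:
  assumes "norm x = 1"
  shows "0 \<le> latitude x" "latitude x \<le> 1 / 2"
  using arccos_bounded[of "x \<bullet> pole"] abs_inner_pole_le[OF assms]
  by (auto simp: latitude_def field_simps abs_le_iff)

lemma cos_latitude: "norm x = 1 \<Longrightarrow> cos (2 * pi * latitude x) = x \<bullet> pole"
  using abs_inner_pole_le[of x] by (simp add: latitude_def abs_le_iff)

lemma latitude_eq:
  assumes "0 \<le> t" "t \<le> 1 / 2" "x \<bullet> pole = cos (2 * pi * t)"
  shows "latitude x = t"
  unfolding latitude_def assms(3) using assms(1,2) by (subst arccos_cos) (auto simp: field_simps)

lemma inner_pole_eq_1:
  assumes "norm x = 1"
  shows "x \<bullet> pole = 1 \<longleftrightarrow> x = pole" "x \<bullet> pole = -1 \<longleftrightarrow> x = - pole"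
proof -
  have "x = pole \<longleftrightarrow> (x - pole) \<bullet> (x - pole) = 0" by simp
  also have "(x - pole) \<bullet> (x - pole) = 2 - 2 * (x \<bullet> pole)"
    using assms by (simp add: inner_diff inner_commute[of pole x] norm_eq_1)
  finally show "x \<bullet> pole = 1 \<longleftrightarrow> x = pole" by auto
  have "x = - pole \<longleftrightarrow> (x + pole) \<bullet> (x + pole) = 0" by (simp add: add_eq_0_iff2)
  also have "(x + pole) \<bullet> (x + pole) = 2 + 2 * (x \<bullet> pole)"
    using assms by (simp add: inner_add inner_commute[of pole x] norm_eq_1)
  finally show "x \<bullet> pole = -1 \<longleftrightarrow> x = - pole" by auto
qed

lemma latitude_poles [simp]: "latitude pole = 0" "latitude (- pole) = 1 / 2"
  by (rule latitude_eq; simp)+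

lemma latitude_interior:
  assumes "norm x = 1"
  shows "latitude x \<in> {0<..<1/2} \<longleftrightarrow> x \<notin> {pole, - pole}"
proof -
  have "latitude x = 0 \<longleftrightarrow> x = pole"
    using cos_latitude[OF assms] inner_pole_eq_1(1)[OF assms] latitude_poles(1) by fastforce
  moreover have "latitude x = 1 / 2 \<longleftrightarrow> x = - pole"
  proof
    assume "latitude x = 1 / 2"
    then have "2 * pi * latitude x = pi" by simp
    then have "cos (2 * pi * latitude x) = -1" by (simp only: cos_pi)
    then show "x = - pole"
      using cos_latitude[OF assms] inner_pole_eq_1(2)[OF assms] by simp
  qed simp
  ultimately show ?thesis
    using latitude_bounds[OF assms] by (auto simp: less_le)
qed

lemma inner_pole_polar_point: "polar_point x' \<theta> \<bullet> pole = cos (2 * pi * \<theta>)"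
  by (simp add: inner_pole polar_point_def)

lemma norm_polar_point:
  assumes "norm x' = 1"
  shows "norm (polar_point x' \<theta>) = 1"
proof -
  have "(\<Sum>j\<in>UNIV. (x' $ j)\<^sup>2) = 1"
    using assms by (simp add: norm_eq_1 inner_vec_def power2_eq_square)
  then have "(norm (polar_point x' \<theta>))\<^sup>2 = 1"
    by (simp add: norm_option_vec polar_point_def power_mult_distrib flip: sum_distrib_right)
  then show ?thesis
    by (simp add: power2_eq_1_iff) (metis norm_ge_zero neg_0_le_iff_le not_one_le_zero)
qed

lemma polar_point_surj:
  fixes x :: "real ^ 'd::finite option"
  assumes x: "norm x = 1" "x \<notin> {pole, - pole}"
  obtains x' :: "real ^ 'd" where "norm x' = 1" "x = polar_point x' (latitude x)"
proof
  define s where "s = sin (2 * pi * latitude x)"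
  define x' :: "real ^ 'd" where "x' = (\<chi> j. x $ Some j / s)"
  have "latitude x \<in> {0<..<1/2}"
    using latitude_interior x by blast
  then have s: "s > 0"
    unfolding s_def by (intro sin_gt_zero) auto
  have c: "x $ None = cos (2 * pi * latitude x)"
    using cos_latitude[OF x(1)] by (simp add: inner_pole)
  have "(\<Sum>j\<in>UNIV. (x $ Some j)\<^sup>2) = s\<^sup>2"
    using norm_option_vec[of x] x(1) by (simp add: c s_def sin_squared_eq)
  then have "x' \<bullet> x' = 1"
    using s by (simp add: inner_vec_def x'_def power2_eq_square flip: sum_divide_distrib)
  then show "norm x' = 1"
    by (simp add: norm_eq_1)
  show "x = polar_point x' (latitude x)"
    using s by (auto simp: vec_eq_iff polar_point_def c x'_def s_def[symmetric] split: option.split)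
qed

lemma polar_lift_pos_eq:
  "polar_lift_pos A = {x :: real ^ 'd::finite option. x \<in> sphere 0 1 \<and> x \<notin> {pole, - pole} \<and> latitude x \<in> A}"
  (is "_ = ?R")
proof
  show "polar_lift_pos A \<subseteq> ?R"
  proof
    fix x :: "real ^ 'd option" assume "x \<in> polar_lift_pos A"
    then obtain x' \<theta> where x: "x = polar_point x' \<theta>" "\<theta> \<in> {0<..<1/2}" "\<theta> \<in> A" "norm x' = 1"
      by (auto simp: polar_lift_pos_def)
    then have "latitude x = \<theta>" "norm x = 1"
      by (auto intro!: latitude_eq simp: inner_pole_polar_point norm_polar_point)
    with x latitude_interior[of x] show "x \<in> ?R" by auto
  qed
  show "?R \<subseteq> polar_lift_pos A"
  proof
    fix x :: "real ^ 'd option" assume x: "x \<in> ?R"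
    then obtain x' :: "real ^ 'd" where "norm x' = 1" "x = polar_point x' (latitude x)"
      using polar_point_surj[of x] by auto
    with x latitude_interior[of x] show "x \<in> polar_lift_pos A"
      unfolding polar_lift_pos_def by auto
  qed
qed

lemma polar_lift_neg_eq:
  "polar_lift_neg A = {x :: real ^ 'd::finite option. x \<in> sphere 0 1 \<and> x \<notin> {pole, - pole} \<and> - latitude x \<in> A}"
proof -
  have "polar_lift_neg A = (polar_lift_pos {t. - t \<in> A} :: (real ^ 'd option) set)"
    unfolding polar_lift_neg_def polar_lift_pos_def by simp
  then show ?thesis
    by (simp add: polar_lift_pos_eq)
qed

lemma torus_exp_0 [simp]: "torus_exp 0 = 1"
  by (simp add: torus_exp_def)

lemma torus_exp_half: "torus_exp (1 / 2) = -1"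
  by (simp add: torus_exp_def)

text \<open>The liftings of the two poles do not depend on the chosen representative \<open>\<theta>\<close>, since the sets
  involved are 1-periodic.\<close>

lemma polar_lift_poles:
  "polar_lift (torus_exp -` B) \<inter> {pole, - pole :: real ^ 'd::finite option}
    = {x \<in> {pole, - pole}. torus_exp (latitude x) \<in> B}"
proof -
  obtain x' :: "real ^ 'd" where x': "norm x' = 1"
    using vector_choose_size[of 1] by auto
  have eq: "torus_exp \<theta> = torus_exp (latitude x)"
    if "x = polar_point y' \<theta>" "x \<in> {pole, - pole}" for x :: "real ^ 'd option" and y' \<theta>
  proof -
    have cos: "cos (2 * pi * \<theta>) = cos (2 * pi * latitude x)"
      using that inner_pole_polar_point[of y' \<theta>] by auto
    moreover have "(cos (2 * pi * latitude x))\<^sup>2 = 1" "sin (2 * pi * latitude x) = 0"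
      using that by auto
    moreover have "(sin (2 * pi * \<theta>))\<^sup>2 = 0"
      using calculation by (simp add: sin_squared_eq)
    ultimately show ?thesis
      by (simp add: torus_exp_def complex_eq_iff)
  qed
  have "x = polar_point x' (latitude x)" if "x \<in> {pole, - pole}" for x :: "real ^ 'd option"
  proof -
    have "pole = polar_point x' 0" "- pole = polar_point x' (1 / 2)"
      by (auto simp: vec_eq_iff polar_point_def pole_def axis_def split: option.split)
    with that show ?thesis by (metis insertE singletonD latitude_poles)
  qed
  then have lift: "x \<in> polar_lift (torus_exp -` B)"
    if "x \<in> {pole, - pole}" "torus_exp (latitude x) \<in> B" for x :: "real ^ 'd option"
    using that x' unfolding polar_lift_def by fastforce
  show ?thesis
  proof (intro set_eqI iffI)
    fix x :: "real ^ 'd option"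
    assume x: "x \<in> polar_lift (torus_exp -` B) \<inter> {pole, - pole}"
    then obtain y' \<theta> where "x = polar_point y' \<theta>" "torus_exp \<theta> \<in> B"
      unfolding polar_lift_def by blast
    with x eq[of x y' \<theta>] show "x \<in> {x \<in> {pole, - pole}. torus_exp (latitude x) \<in> B}"
      by simp
  next
    fix x :: "real ^ 'd option"
    assume "x \<in> {x \<in> {pole, - pole}. torus_exp (latitude x) \<in> B}"
    with lift[of x] show "x \<in> polar_lift (torus_exp -` B) \<inter> {pole, - pole}"
      by blast
  qed
qed

locale polar_sphere_measure =
  fixes \<mu> :: "(real ^ 'd::finite option) measure"
  assumes polar: "polar_measure \<mu>"
begin

sublocale finite_measure \<mu>
  using polar by (simp add: polar_measure_def)

lemma sets_mu: "sets \<mu> = sets (restrict_space borel (sphere 0 1))"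
  using polar by (simp add: polar_measure_def)

lemma space_mu: "space \<mu> = sphere 0 1"
  using sets_eq_imp_space_eq[OF sets_mu] by (simp add: space_restrict_space)

lemma borel_measurable_mu:
  assumes "continuous_on (sphere 0 1) f"
  shows "f \<in> borel_measurable \<mu>"
  using borel_measurable_continuous_on_restrict[OF assms] measurable_cong_sets[OF sets_mu refl] by blast

lemma integrable_mu:
  fixes f :: "real ^ 'd option \<Rightarrow> 'b::{second_countable_topology, banach}"
  assumes "continuous_on (sphere 0 1) f"
  shows "integrable \<mu> f"
proof -
  obtain K where "\<And>z. z \<in> sphere 0 1 \<Longrightarrow> norm (f z) \<le> K"
    using compact_bounded_image[OF assms compact_sphere] by blast
  then show ?thesis
    using borel_measurable_mu[OF assms]
    by (intro integrable_const_bound[where B = K]) (auto simp: space_mu AE_I2)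
qed

lemma continuous_latitude: "continuous_on (sphere 0 1) (latitude :: real ^ 'd option \<Rightarrow> real)"
proof -
  have "- 1 \<le> x \<bullet> pole \<and> x \<bullet> pole \<le> 1" if "x \<in> sphere 0 1" for x :: "real ^ 'd option"
    using abs_inner_pole_le[of x] that by (auto simp: abs_le_iff)
  then show ?thesis
    unfolding latitude_def by (intro continuous_intros) auto
qed

lemma measurable_torus_borel:
  assumes "continuous_on (sphere 0 1) f"
  shows "f \<in> \<mu> \<rightarrow>\<^sub>M torus_borel"
  unfolding torus_borel_def
proof (rule measurable_vimage_algebra2)
  have "continuous_on UNIV torus_exp"
    using isCont_torus_exp by (simp add: continuous_at_imp_continuous_on)
  then have "continuous_on (sphere 0 1) (\<lambda>x. torus_exp (f x))"
    using assms by (rule continuous_on_compose2) simp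
  then show "(\<lambda>x. torus_exp (f x)) \<in> \<mu> \<rightarrow>\<^sub>M borel"
    by (rule borel_measurable_mu)
qed simp

text \<open>The sum of the images of \<open>\<mu>\<close> under \<open>latitude\<close> and its negative is encoded as a single image
  of the product of \<open>\<mu>\<close> with the counting measure on the two signs.\<close>

definition signed_latitude :: "(real ^ 'd option) \<times> bool \<Rightarrow> real" where
  "signed_latitude = (\<lambda>(x, b). if b then latitude x else - latitude x)"

lemma measurable_signed_latitude: "signed_latitude \<in> \<mu> \<Otimes>\<^sub>M count_space UNIV \<rightarrow>\<^sub>M torus_borel"
proof -
  have [measurable]: "latitude \<in> \<mu> \<rightarrow>\<^sub>M torus_borel" "(\<lambda>x. - latitude x) \<in> \<mu> \<rightarrow>\<^sub>M torus_borel"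
    by (intro measurable_torus_borel continuous_latitude continuous_intros)+
  show ?thesis
    unfolding signed_latitude_def split_beta by measurable
qed

text \<open>Away from the poles, the two signs produce the lifts to \<open>(0, 1/2)\<close> and to \<open>(-1/2, 0)\<close>. At a
  pole the two signed latitudes represent the same point of the torus, which accounts for the factor \<open>2\<close>.\<close>

lemma polar_part_eq: "polar_part \<mu> = distr (\<mu> \<Otimes>\<^sub>M count_space UNIV) torus_borel signed_latitude" (is "_ = ?D")
proof -
  interpret B: finite_measure "count_space (UNIV :: bool set)"
    by (rule finite_measure_count_space) simp
  have "emeasure ?D A = emeasure \<mu> (polar_lift_pos A) + emeasure \<mu> (polar_lift_neg A)
        + 2 * emeasure \<mu> (polar_lift A \<inter> {pole, - pole})" if A: "A \<in> sets torus_borel" for A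
  proof -
    obtain U where U: "A = torus_exp -` U"
      using A unfolding torus_borel_def by (subst (asm) sets_vimage_algebra2) auto
    define S where "S b = {x. x \<in> sphere 0 1 \<and> signed_latitude (x, b) \<in> A}" for b
    define P where "P = polar_lift A \<inter> {pole, - pole :: real ^ 'd option}"
    have meas: "S b \<in> sets \<mu>" for b
    proof -
      have "(\<lambda>x. signed_latitude (x, b)) \<in> \<mu> \<rightarrow>\<^sub>M torus_borel"
        using measurable_signed_latitude by measurable
      from measurable_sets[OF this A] show ?thesis
        by (simp add: S_def space_mu vimage_def Int_def conj_commute)
    qed
    have poles: "{pole, - pole :: real ^ 'd option} \<in> sets \<mu>"
      unfolding sets_mu by (auto simp: sets_restrict_space intro!: image_eqI[of _ _ "{pole, - pole}"])
    have P: "P = {x \<in> {pole, - pole}. torus_exp (latitude x) \<in> U}"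
      unfolding P_def U by (rule polar_lift_poles)
    then have P_sub: "P = S True \<inter> {pole, - pole}" "P = S False \<inter> {pole, - pole}"
      by (auto simp: S_def signed_latitude_def U torus_exp_minus torus_exp_half)
    then have P_meas: "P \<in> sets \<mu>"
      using meas poles by simp
    have L: "polar_lift_pos A = S True - {pole, - pole}" "polar_lift_neg A = S False - {pole, - pole}"
      unfolding polar_lift_pos_eq polar_lift_neg_eq by (auto simp: S_def signed_latitude_def)
    have "emeasure \<mu> (S b) = emeasure \<mu> (S b - {pole, - pole}) + emeasure \<mu> P" for b
    proof -
      have "S b = (S b - {pole, - pole}) \<union> P" "(S b - {pole, - pole}) \<inter> P = {}"
        using P_sub by (cases b; auto)+
      then show ?thesis
        using plus_emeasure[of "S b - {pole, - pole}" \<mu> P] meas poles P_meas by auto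
    qed
    moreover have "emeasure ?D A = emeasure \<mu> (S True) + emeasure \<mu> (S False)"
    proof -
      have "signed_latitude -` A \<inter> space (\<mu> \<Otimes>\<^sub>M count_space UNIV) = S True \<times> {True} \<union> S False \<times> {False}"
      proof (intro set_eqI)
        fix y :: "(real ^ 'd option) \<times> bool"
        obtain x b where "y = (x, b)" by (cases y)
        then show "y \<in> signed_latitude -` A \<inter> space (\<mu> \<Otimes>\<^sub>M count_space UNIV)
            \<longleftrightarrow> y \<in> S True \<times> {True} \<union> S False \<times> {False}"
          by (cases b) (auto simp: S_def space_pair_measure space_mu)
      qed
      moreover have "emeasure (\<mu> \<Otimes>\<^sub>M count_space UNIV) (S True \<times> {True} \<union> S False \<times> {False})
          = emeasure (\<mu> \<Otimes>\<^sub>M count_space UNIV) (S True \<times> {True})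
            + emeasure (\<mu> \<Otimes>\<^sub>M count_space UNIV) (S False \<times> {False})"
        by (rule plus_emeasure[symmetric]) (use meas in auto)
      ultimately show ?thesis
        using meas by (simp add: emeasure_distr[OF measurable_signed_latitude A] B.emeasure_pair_measure_Times)
    qed
    ultimately show ?thesis
      unfolding L P_def by (simp add: algebra_simps mult_2)
  qed
  moreover have "?D = measure_of UNIV (sets torus_borel) (emeasure ?D)"
    using measure_of_of_measure[of ?D] by (simp add: torus_borel_def)
  moreover have "sigma_sets UNIV (sets torus_borel) = sets torus_borel"
    using sets.sigma_sets_eq[of torus_borel] by (simp add: torus_borel_def)
  ultimately show ?thesis
    unfolding polar_part_def by (subst measure_of_eq[where \<mu>' = "emeasure ?D"]) simp_all
qed

lemma finite_measure_polar_part: "finite_measure (polar_part \<mu>)"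
proof -
  have "finite_measure (\<mu> \<Otimes>\<^sub>M count_space (UNIV :: bool set))"
    by (intro finite_measure_pair_measure finite_measure_axioms finite_measure_count_space) simp
  then show ?thesis
    unfolding polar_part_eq by (rule finite_measure.finite_measure_distr) (rule measurable_signed_latitude)
qed

lemma integral_polar_part:
  fixes G :: "complex \<Rightarrow> 'b::{second_countable_topology, banach}"
  assumes G: "continuous_on UNIV G"
  shows "(\<integral>t. G (torus_exp t) \<partial>polar_part \<mu>)
    = (\<integral>x. G (torus_exp (latitude x)) + G (torus_exp (- latitude x)) \<partial>\<mu>)"
proof -
  interpret B: finite_measure "count_space (UNIV :: bool set)"
    by (rule finite_measure_count_space) simp
  interpret P: pair_sigma_finite \<mu> "count_space (UNIV :: bool set)" ..
  interpret F: finite_measure "\<mu> \<Otimes>\<^sub>M count_space (UNIV :: bool set)"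
    by (intro finite_measure_pair_measure finite_measure_axioms B.finite_measure_axioms)
  have GT: "(\<lambda>t. G (torus_exp t)) \<in> borel_measurable torus_borel"
    using measurable_compose[OF measurable_torus_exp borel_measurable_continuous_on_restrict]
      continuous_on_subset[OF G] by blast
  have "continuous_on (sphere 0 1) G"
    using G by (rule continuous_on_subset) simp
  then obtain K where "\<And>z. z \<in> sphere 0 1 \<Longrightarrow> norm (G z) \<le> K"
    using compact_bounded_image[OF _ compact_sphere] by blast
  then have K: "norm (G (torus_exp t)) \<le> K" for t
    by simp
  have "(\<integral>t. G (torus_exp t) \<partial>polar_part \<mu>)
      = (\<integral>y. G (torus_exp (signed_latitude y)) \<partial>(\<mu> \<Otimes>\<^sub>M count_space UNIV))"
    unfolding polar_part_eq by (rule integral_distr[OF measurable_signed_latitude GT])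
  also have "\<dots> = (\<integral>x. (\<integral>b. G (torus_exp (signed_latitude (x, b))) \<partial>count_space UNIV) \<partial>\<mu>)"
  proof (rule P.integral_fst'[symmetric])
    show "integrable (\<mu> \<Otimes>\<^sub>M count_space UNIV) (\<lambda>y. G (torus_exp (signed_latitude y)))"
      using measurable_compose[OF measurable_signed_latitude GT] K
      by (intro F.integrable_const_bound[where B = K]) auto
  qed
  also have "\<dots> = (\<integral>x. G (torus_exp (latitude x)) + G (torus_exp (- latitude x)) \<partial>\<mu>)"
    by (simp add: lebesgue_integral_count_space_finite UNIV_bool signed_latitude_def add.commute)
  finally show ?thesis .
qed

sublocale torus: even_torus_measure "polar_part \<mu>"
proof (intro even_torus_measure.intro even_torus_measure_axioms.intro finite_measure_polar_part)
  show "sets (polar_part \<mu>) = sets torus_borel"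
    by (simp add: polar_part_eq)
  show "(\<integral>x. f (cnj (torus_exp x)) \<partial>polar_part \<mu>) = (\<integral>x. f (torus_exp x) \<partial>polar_part \<mu>)"
    if "continuous_on UNIV f" for f :: "complex \<Rightarrow> complex"
  proof -
    have "continuous_on UNIV (\<lambda>z. f (cnj z))"
      using that by (intro continuous_on_compose2[OF that] continuous_intros) auto
    then show ?thesis
      using integral_polar_part[of "\<lambda>z. f (cnj z)"] integral_polar_part[OF that]
      by (simp add: torus_exp_minus add.commute)
  qed
qed

end

section \<open>Zonal spherical harmonics\<close>

lemma second_deriv_eq:
  fixes h :: "real \<Rightarrow> real"
  assumes "\<And>t. (h has_real_derivative h' t) (at t)" "(h' has_real_derivative d) (at 0)"
  shows "(deriv ^^ 2) h 0 = d"
proof -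
  have "deriv h = h'"
    using assms(1) by (auto intro!: DERIV_imp_deriv)
  then show ?thesis
    using assms(2) by (simp add: numeral_2_eq_2 DERIV_imp_deriv)
qed

text \<open>The second derivatives along the basis vectors combine through
  \<open>\<Sum>(v \<bullet> b)\<^sup>2 = 1\<close>, \<open>\<Sum>(x \<bullet> b)(v \<bullet> b) = x \<bullet> v\<close> and \<open>\<Sum>(x \<bullet> b)\<^sup>2 = x \<bullet> x\<close>. Exponents are truncated
  at \<open>0\<close>, where the coefficient in front vanishes.\<close>

lemma laplacian_zonal_sum:
  fixes v x :: "'a::euclidean_space" and n j :: "'i \<Rightarrow> nat"
  assumes v: "norm v = 1" and fin: "finite I"
  shows "laplacian (\<lambda>x. \<Sum>i\<in>I. c i * ((x \<bullet> v) ^ n i * (x \<bullet> x) ^ j i)) x =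
    (\<Sum>i\<in>I. c i * (real (n i) * real (n i - 1) * (x \<bullet> v) ^ (n i - 2) * (x \<bullet> x) ^ j i
      + real (j i) * (4 * real (n i) + 4 * real (j i - 1) + 2 * real DIM('a)) *
        ((x \<bullet> v) ^ n i * (x \<bullet> x) ^ (j i - 1))))"
proof -
  define t where "t = x \<bullet> v"
  define q where "q = x \<bullet> x"
  define d where "d b i = real (n i) * real (n i - 1) * t ^ (n i - 2) * (v \<bullet> b)\<^sup>2 * q ^ j i
      + 4 * real (n i) * real (j i) * t ^ (n i - 1) * q ^ (j i - 1) * ((x \<bullet> b) * (v \<bullet> b))
      + t ^ n i * (4 * real (j i) * real (j i - 1) * q ^ (j i - 2) * (x \<bullet> b)\<^sup>2
        + 2 * real (j i) * q ^ (j i - 1))" for b i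
  have "(deriv ^^ 2) (\<lambda>s. \<Sum>i\<in>I. c i * (((x + s *\<^sub>R b) \<bullet> v) ^ n i * ((x + s *\<^sub>R b) \<bullet> (x + s *\<^sub>R b)) ^ j i)) 0
      = (\<Sum>i\<in>I. c i * d b i)" if b: "b \<in> Basis" for b
  proof -
    define T where "T s = t + s * (v \<bullet> b)" for s
    define Q where "Q s = q + 2 * s * (x \<bullet> b) + s\<^sup>2" for s
    have TQ: "(x + s *\<^sub>R b) \<bullet> v = T s" "(x + s *\<^sub>R b) \<bullet> (x + s *\<^sub>R b) = Q s" for s
      using b by (auto simp: T_def Q_def t_def q_def inner_add inner_commute[of b x] inner_commute[of b v] power2_eq_square distrib_left)
    have dT: "(T has_real_derivative (v \<bullet> b)) (at s)" for s
      unfolding T_def by (auto intro!: derivative_eq_intros)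
    have dQ: "(Q has_real_derivative (2 * (x \<bullet> b) + 2 * s)) (at s)" for s
      unfolding Q_def by (auto intro!: derivative_eq_intros)
    have dTn: "((\<lambda>s. T s ^ k) has_real_derivative real k * T s ^ (k - 1) * (v \<bullet> b)) (at s)" for k s
      using DERIV_power[OF dT, of k s] by (simp add: mult_ac)
    have dQn: "((\<lambda>s. Q s ^ k) has_real_derivative real k * Q s ^ (k - 1) * (2 * (x \<bullet> b) + 2 * s)) (at s)" for k s
      using DERIV_power[OF dQ, of k s] by (simp add: mult_ac)
    define h' where "h' i s = real (n i) * (v \<bullet> b) * (T s ^ (n i - 1) * Q s ^ j i)
        + real (j i) * (T s ^ n i * (Q s ^ (j i - 1) * (2 * (x \<bullet> b) + 2 * s)))" for i s
    have d1: "((\<lambda>s. T s ^ n i * Q s ^ j i) has_real_derivative h' i s) (at s)" for i s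
      unfolding h'_def by (rule DERIV_cong[OF DERIV_mult[OF dTn dQn]]) (simp add: algebra_simps)
    have lin: "((\<lambda>s. 2 * (x \<bullet> b) + 2 * s) has_real_derivative 2) (at s)" for s
      by (auto intro!: derivative_eq_intros)
    have T0: "T 0 = t" and Q0: "Q 0 = q" by (simp_all add: T_def Q_def)
    have sub2: "k - Suc (Suc 0) = k - 2" for k :: nat by simp
    have d2: "(h' i has_real_derivative d b i) (at 0)" for i
      unfolding h'_def
      by (rule DERIV_cong[OF DERIV_add[OF DERIV_cmult[OF DERIV_mult[OF dTn dQn]]
            DERIV_cmult[OF DERIV_mult[OF dTn DERIV_mult[OF dQn lin]]]]])
        (simp add: d_def T0 Q0 sub2 algebra_simps power2_eq_square)
    show ?thesis
      unfolding TQ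
      by (rule second_deriv_eq[where h' = "\<lambda>s. \<Sum>i\<in>I. c i * h' i s"])
        (intro DERIV_sum DERIV_cmult d1 d2)+
  qed
  then have "laplacian (\<lambda>x. \<Sum>i\<in>I. c i * ((x \<bullet> v) ^ n i * (x \<bullet> x) ^ j i)) x
      = (\<Sum>b\<in>Basis. \<Sum>i\<in>I. c i * d b i)"
    unfolding laplacian_def by (intro sum.cong refl)
  also have "\<dots> = (\<Sum>i\<in>I. c i * (\<Sum>b\<in>Basis. d b i))"
    by (subst sum.swap) (simp add: sum_distrib_left)
  also have "\<dots> = (\<Sum>i\<in>I. c i * (real (n i) * real (n i - 1) * t ^ (n i - 2) * q ^ j i
      + real (j i) * (4 * real (n i) + 4 * real (j i - 1) + 2 * real DIM('a)) * (t ^ n i * q ^ (j i - 1))))"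
  proof (intro sum.cong refl arg_cong2[where f = "(*)"])
    fix i
    have v1: "(\<Sum>b\<in>Basis. (v \<bullet> b)\<^sup>2) = 1" "(\<Sum>b\<in>Basis. (x \<bullet> b)\<^sup>2) = q"
      "(\<Sum>b\<in>Basis. (x \<bullet> b) * (v \<bullet> b)) = t"
      using v by (simp_all add: power2_eq_square q_def t_def norm_eq_1 flip: euclidean_inner)
    have "(\<Sum>b\<in>Basis. d b i) = real (n i) * real (n i - 1) * t ^ (n i - 2) * q ^ j i
      + 4 * real (j i) * (real (n i) * (t ^ (n i - 1) * t)) * q ^ (j i - 1)
      + t ^ n i * (4 * (real (j i) * real (j i - 1) * (q ^ (j i - 2) * q))
        + 2 * real (j i) * q ^ (j i - 1) * real DIM('a))"
    proof -
      define \<alpha> where "\<alpha> = real (n i) * real (n i - 1) * t ^ (n i - 2) * q ^ j i"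
      define \<beta> where "\<beta> = 4 * real (n i) * real (j i) * t ^ (n i - 1) * q ^ (j i - 1)"
      define \<gamma> where "\<gamma> = t ^ n i * (4 * real (j i) * real (j i - 1) * q ^ (j i - 2))"
      define \<delta> where "\<delta> = t ^ n i * (2 * real (j i) * q ^ (j i - 1))"
      have "d b i = \<alpha> * (v \<bullet> b)\<^sup>2 + \<beta> * ((x \<bullet> b) * (v \<bullet> b)) + \<gamma> * (x \<bullet> b)\<^sup>2 + \<delta>" for b
        by (simp add: d_def \<alpha>_def \<beta>_def \<gamma>_def \<delta>_def algebra_simps)
      then have "(\<Sum>b\<in>Basis. d b i) = \<alpha> + \<beta> * t + \<gamma> * q + real DIM('a) * \<delta>"
        by (simp add: sum.distrib v1 flip: sum_distrib_left)
      then show ?thesis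
        by (simp add: \<alpha>_def \<beta>_def \<gamma>_def \<delta>_def algebra_simps)
    qed
    moreover have "real (n i) * (t ^ (n i - 1) * t) = real (n i) * t ^ n i"
      by (cases "n i") (auto simp: mult_ac)
    moreover have "real (j i) * real (j i - 1) * (q ^ (j i - 2) * q) = real (j i) * real (j i - 1) * q ^ (j i - 1)"
      by (cases "j i"; cases "j i - 1") (auto simp: mult_ac numeral_2_eq_2)
    ultimately show "(\<Sum>b\<in>Basis. d b i) = real (n i) * real (n i - 1) * t ^ (n i - 2) * q ^ j i
      + real (j i) * (4 * real (n i) + 4 * real (j i - 1) + 2 * real DIM('a)) * (t ^ n i * q ^ (j i - 1))"
      by (simp only:) (simp add: algebra_simps)
  qed
  finally show ?thesis
    by (simp add: t_def q_def)
qed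

text \<open>The recursion makes consecutive terms cancel in the Laplacian of the sum below; up to
  normalization the sum is a Gegenbauer polynomial, homogenized by powers of \<open>x \<bullet> x\<close>.\<close>

primrec zonal_coeff :: "nat \<Rightarrow> nat \<Rightarrow> nat \<Rightarrow> real" where
  "zonal_coeff D k 0 = 1"
| "zonal_coeff D k (Suc j) = - zonal_coeff D k j * (real (k - 2 * j) * real (k - 2 * j - 1)) /
     (real (Suc j) * (4 * real (k - 2 * j - 2) + 4 * real j + 2 * real D))"

definition zonal_harmonic :: "'a::euclidean_space \<Rightarrow> nat \<Rightarrow> 'a \<Rightarrow> real" where
  "zonal_harmonic v k x =
     (\<Sum>j\<le>k div 2. zonal_coeff DIM('a) k j * ((x \<bullet> v) ^ (k - 2 * j) * (x \<bullet> x) ^ j))"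

definition zonal_poly :: "nat \<Rightarrow> nat \<Rightarrow> real poly" where
  "zonal_poly D k = (\<Sum>j\<le>k div 2. monom (zonal_coeff D k j) (k - 2 * j))"

text \<open>The contribution of \<open>(x \<bullet> v)\<^bsup>k-2j-2\<^esup> (x \<bullet> x)\<^sup>j\<close> comes from the terms \<open>j\<close> and \<open>j + 1\<close>, and the
  recursion cancels it. The last term contributes nothing further, because its exponent
  \<open>k - 2 (k div 2)\<close> is \<open>0\<close> or \<open>1\<close>.\<close>

lemma laplacian_zonal_harmonic:
  fixes v :: "'a::euclidean_space"
  assumes "norm v = 1"
  shows "laplacian (zonal_harmonic v k) x = 0"
proof -
  define D where "D = DIM('a)"
  define c where "c = zonal_coeff D k"
  define t where "t = x \<bullet> v"
  define q where "q = x \<bullet> x"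
  define u where "u j = c j * (real (k - 2 * j) * real (k - 2 * j - 1)) * (t ^ (k - 2 * j - 2) * q ^ j)" for j
  define w where "w j = c j * (real j * (4 * real (k - 2 * j) + 4 * real (j - 1) + 2 * real D)) *
      (t ^ (k - 2 * j) * q ^ (j - 1))" for j
  have "laplacian (zonal_harmonic v k) x = (\<Sum>j\<le>k div 2. u j + w j)"
    unfolding zonal_harmonic_def laplacian_zonal_sum[OF assms finite_atMost]
    by (intro sum.cong refl) (simp add: u_def w_def c_def t_def q_def D_def algebra_simps)
  also have "\<dots> = (\<Sum>j\<le>k div 2. u j) + (\<Sum>j\<le>k div 2. w j)"
    by (rule sum.distrib)
  also have "(\<Sum>j\<le>k div 2. w j) = (\<Sum>j<k div 2. w (Suc j))"
    by (simp add: sum.atMost_shift w_def)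
  also have "\<dots> = (\<Sum>j<k div 2. - u j)"
  proof (intro sum.cong refl)
    fix j assume j: "j \<in> {..<k div 2}"
    have e: "k - 2 * Suc j = k - 2 * j - 2" by simp
    have "D > 0" by (simp add: D_def)
    then have pos: "real (Suc j) * (4 * real (k - 2 * j - 2) + 4 * real j + 2 * real D) > 0"
      by (intro mult_pos_pos) auto
    have "w (Suc j) = c (Suc j) * (real (Suc j) * (4 * real (k - 2 * j - 2) + 4 * real j + 2 * real D)) *
        (t ^ (k - 2 * j - 2) * q ^ j)"
      unfolding w_def e by simp
    also have "c (Suc j) * (real (Suc j) * (4 * real (k - 2 * j - 2) + 4 * real j + 2 * real D))
        = - c j * (real (k - 2 * j) * real (k - 2 * j - 1))"
      unfolding c_def zonal_coeff.simps using pos by (metis less_irrefl nonzero_eq_divide_eq)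
    finally show "w (Suc j) = - u j"
      by (simp add: u_def)
  qed
  also have "(\<Sum>j\<le>k div 2. u j) = (\<Sum>j<k div 2. u j) + u (k div 2)"
    by (simp add: lessThan_Suc_atMost[symmetric])
  also have "u (k div 2) = 0"
  proof -
    have "k - 2 * (k div 2) = 0 \<or> k - 2 * (k div 2) - 1 = 0" by presburger
    then show ?thesis by (auto simp: u_def)
  qed
  finally show ?thesis
    by (simp add: sum_negf)
qed

lemma zonal_harmonic_in_spherical_harmonics:
  fixes v :: "'a::euclidean_space"
  assumes "norm v = 1"
  shows "(\<lambda>x. a * zonal_harmonic v k x) \<in> spherical_harmonics k"
proof -
  have poly_v: "real_polynomial_function (\<lambda>x. x \<bullet> v)"
    by (intro real_polynomial_function.intros(1) bounded_linear_inner_left)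
  have "real_polynomial_function (\<lambda>x::'a. x \<bullet> x)"
    unfolding euclidean_inner[of x x for x]
    by (intro real_polynomial_function_sum real_polynomial_function.intros(4)
        real_polynomial_function.intros(1) bounded_linear_inner_left) auto
  then have "real_polynomial_function (\<lambda>x. a * zonal_harmonic v k x)"
    unfolding zonal_harmonic_def using poly_v
    by (intro real_polynomial_function.intros(4) real_polynomial_function_sum
        real_polynomial_function_power real_polynomial_function.intros(2)) auto
  moreover have "a * zonal_harmonic v k (s *\<^sub>R x) = s ^ k * (a * zonal_harmonic v k x)" for s x
  proof -
    have "(s * (x \<bullet> v)) ^ (k - 2 * j) * (s * (s * (x \<bullet> x))) ^ j
        = s ^ k * ((x \<bullet> v) ^ (k - 2 * j) * (x \<bullet> x) ^ j)" if "j \<le> k div 2" for j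
    proof -
      have "s ^ k = s ^ (k - 2 * j) * (s * s) ^ j"
        using that by (simp add: power_mult_distrib flip: power_add mult_2)
      then show ?thesis
        by (simp add: power_mult_distrib)
    qed
    then show ?thesis
      by (simp add: zonal_harmonic_def sum_distrib_left mult_ac)
  qed
  moreover have "laplacian (\<lambda>x. a * zonal_harmonic v k x) x = 0" for x
  proof -
    have "(\<lambda>x. a * zonal_harmonic v k x)
        = (\<lambda>x. \<Sum>j\<le>k div 2. (a * zonal_coeff DIM('a) k j) * ((x \<bullet> v) ^ (k - 2 * j) * (x \<bullet> x) ^ j))"
      and "zonal_harmonic v k
        = (\<lambda>x. \<Sum>j\<le>k div 2. zonal_coeff DIM('a) k j * ((x \<bullet> v) ^ (k - 2 * j) * (x \<bullet> x) ^ j))"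
      by (simp_all add: fun_eq_iff zonal_harmonic_def sum_distrib_left mult_ac)
    then have "laplacian (\<lambda>x. a * zonal_harmonic v k x) x = a * laplacian (zonal_harmonic v k) x"
      by (simp only: laplacian_zonal_sum[OF assms finite_atMost]) (simp add: sum_distrib_left mult.assoc)
    then show ?thesis
      by (simp add: laplacian_zonal_harmonic[OF assms])
  qed
  ultimately show ?thesis
    unfolding spherical_harmonics_def by blast
qed

lemma zonal_harmonic_sphere:
  fixes v :: "'a::euclidean_space"
  shows "x \<in> sphere 0 1 \<Longrightarrow> zonal_harmonic v k x = poly (zonal_poly DIM('a) k) (x \<bullet> v)"
  by (simp add: zonal_harmonic_def zonal_poly_def poly_sum poly_monom norm_eq_1)

lemma coeff_zonal_poly: "coeff (zonal_poly D k) k = 1" "i > k \<Longrightarrow> coeff (zonal_poly D k) i = 0"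
proof -
  have "coeff (zonal_poly D k) k = (\<Sum>j\<le>k div 2. if j = 0 then 1 else 0)"
    unfolding zonal_poly_def coeff_sum by (intro sum.cong refl) (auto simp: coeff_monom)
  then show "coeff (zonal_poly D k) k = 1" by simp
  show "i > k \<Longrightarrow> coeff (zonal_poly D k) i = 0"
    unfolding zonal_poly_def coeff_sum by (intro sum.neutral) (auto simp: coeff_monom)
qed

text \<open>On the sphere a zonal harmonic of degree \<open>k\<close> is a monic polynomial of degree \<open>k\<close> in \<open>x \<bullet> v\<close>, so these
  polynomials span all polynomials of bounded degree.\<close>

lemma poly_inner_eq_sum_spherical_harmonics:
  fixes v :: "'a::euclidean_space"
  assumes v: "norm v = 1" and q: "degree q \<le> N"
  shows "\<exists>Y. (\<forall>k\<le>N. Y k \<in> spherical_harmonics k) \<and>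
    (\<forall>x\<in>sphere 0 1. poly q (x \<bullet> v) = (\<Sum>k\<le>N. Y k x))"
proof -
  have "\<exists>a. \<forall>x\<in>sphere 0 1. poly q (x \<bullet> v) = (\<Sum>k<n. a k * zonal_harmonic v k x)"
    if "\<forall>i\<ge>n. coeff q i = 0" for n q
    using that
  proof (induction n arbitrary: q)
    case 0
    then have "q = 0" by (intro poly_eqI) auto
    then show ?case by simp
  next
    case (Suc n)
    define p where "p = q - smult (coeff q n) (zonal_poly DIM('a) n)"
    have "\<forall>i\<ge>n. coeff p i = 0"
    proof (intro allI impI)
      fix i assume "i \<ge> n"
      with Suc.prems show "coeff p i = 0"
        by (cases "i = n") (auto simp: p_def coeff_zonal_poly)
    qed
    from Suc.IH[OF this] obtain a
      where a: "\<forall>x\<in>sphere 0 1. poly p (x \<bullet> v) = (\<Sum>k<n. a k * zonal_harmonic v k x)" by blast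
    define a' where "a' = a(n := coeff q n)"
    have "poly q (x \<bullet> v) = (\<Sum>k<Suc n. a' k * zonal_harmonic v k x)" if "x \<in> sphere 0 1" for x
    proof -
      have "poly q (x \<bullet> v) = poly p (x \<bullet> v) + coeff q n * zonal_harmonic v n x"
        by (simp add: p_def zonal_harmonic_sphere[OF that])
      also have "poly p (x \<bullet> v) = (\<Sum>k<n. a' k * zonal_harmonic v k x)"
        using a that by (auto simp: a'_def intro!: sum.cong)
      finally show ?thesis by (simp add: a'_def)
    qed
    then show ?case by blast
  qed
  from this[of "Suc N" q] obtain a where
    "\<forall>x\<in>sphere 0 1. poly q (x \<bullet> v) = (\<Sum>k<Suc N. a k * zonal_harmonic v k x)"
    using q by (auto simp: coeff_eq_0)
  then show ?thesis
    using zonal_harmonic_in_spherical_harmonics[OF v]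
    by (intro exI[of _ "\<lambda>k x. a k * zonal_harmonic v k x"]) (auto simp: lessThan_Suc_atMost)
qed

section \<open>Rotations that fix the pole\<close>

definition reflect :: "'a::real_inner \<Rightarrow> 'a \<Rightarrow> 'a" where
  "reflect p x = x - (2 * (x \<bullet> p) / (p \<bullet> p)) *\<^sub>R p"

lemma orthogonal_transformation_reflect:
  assumes "p \<noteq> 0"
  shows "orthogonal_transformation (reflect p :: 'a::euclidean_space \<Rightarrow> 'a)"
  unfolding orthogonal_transformation_def
proof
  show "linear (reflect p)"
    by (rule linearI) (auto simp: reflect_def inner_add algebra_simps add_divide_distrib)
  have *: "(x - a *\<^sub>R p) \<bullet> (y - b *\<^sub>R p) = x \<bullet> y - b * (x \<bullet> p) - a * (y \<bullet> p) + a * b * (p \<bullet> p)" for x y a b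
    by (simp add: inner_diff inner_commute[of p y] algebra_simps)
  show "\<forall>x y. reflect p x \<bullet> reflect p y = x \<bullet> y"
    unfolding reflect_def * using assms by (simp add: field_simps)
qed

lemma reflect_scale: "c \<noteq> 0 \<Longrightarrow> reflect (c *\<^sub>R p) = reflect p"
  by (auto simp: reflect_def fun_eq_iff)

text \<open>All reflections are conjugate by orthogonal maps, so they have equal determinants. A product
  of two reflections then has determinant \<open>1\<close>, whatever the common value is.\<close>

lemma det_reflect_eq:
  fixes p q :: "real ^ 'n::finite"
  assumes "p \<noteq> 0" "q \<noteq> 0"
  shows "det (matrix (reflect p)) = det (matrix (reflect q))"
proof -
  \<comment> \<open>A reflection depends only on the line of its vector, and equal norms give an orthogonal \<open>g\<close> with \<open>g q = p'\<close>.\<close>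
  define p' where "p' = (norm q / norm p) *\<^sub>R p"
  have "norm q = norm p'"
    using assms by (simp add: p'_def)
  then obtain g where g: "orthogonal_transformation g" "g q = p'"
    by (rule orthogonal_transformation_exists)
  have lin: "linear g" and inner: "\<And>x y. g x \<bullet> g y = x \<bullet> y"
    using g(1) by (auto simp: orthogonal_transformation_def)
  have lin_r: "linear (reflect p)" "linear (reflect q)"
    using orthogonal_transformation_reflect assms orthogonal_transformation_linear by blast+
  have "reflect p' (g x) = g (reflect q x)" for x
    by (simp add: reflect_def linear_diff[OF lin] linear_scale[OF lin] inner flip: g(2))
  then have "reflect p \<circ> g = g \<circ> reflect q"
    using assms reflect_scale[of "norm q / norm p" p] by (auto simp: p'_def fun_eq_iff)
  then have "matrix (reflect p) ** matrix g = matrix g ** matrix (reflect q)"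
    using matrix_compose[OF lin lin_r(1)] matrix_compose[OF lin_r(2) lin] by simp
  then have "det (matrix (reflect p)) * det (matrix g) = det (matrix g) * det (matrix (reflect q))"
    by (metis det_mul)
  moreover have "det (matrix g) \<noteq> 0"
    using g(1) by (metis det_orthogonal_matrix orthogonal_transformation_matrix zero_neq_neg_one zero_neq_one)
  ultimately show ?thesis by simp
qed

text \<open>The reflection along \<open>u - w\<close> maps \<open>u\<close> to \<open>w\<close> and fixes the pole. It is corrected to a rotation by a
  reflection along some \<open>q\<close> orthogonal to the pole and to \<open>u\<close>; this direction exists because the space
  has dimension at least \<open>3\<close>.\<close>

lemma polar_rotation_exists:
  fixes u w :: "real ^ 'd::finite option"
  assumes d: "CARD('d) \<ge> 2" and u: "u \<bullet> pole = 0" and w: "w \<bullet> pole = 0" and eq: "norm u = norm w"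
  obtains R where "rotation_matrix R" "R *v pole = pole" "R *v u = w"
proof (cases "u = w")
  case True
  then show ?thesis
    by (intro that[of "mat 1"]) (auto simp: rotation_matrix_def orthogonal_matrix_id)
next
  case False
  have "card {pole, u} \<le> 2"
    by (simp add: card_insert_if)
  then have "dim (span {pole, u}) \<le> 2"
    using dim_le_card'[of "{pole, u}"] by (simp add: dim_span)
  also have "2 < DIM(real ^ 'd option)"
    using d by simp
  finally obtain q where q: "q \<noteq> 0" "\<And>y. y \<in> span {pole, u} \<Longrightarrow> orthogonal q y"
    using orthogonal_to_subspace_exists[of "{pole, u}"] by (auto simp: dim_span)
  then have "q \<bullet> pole = 0" "q \<bullet> u = 0"
    using span_base[of pole "{pole, u}"] span_base[of u "{pole, u}"] by (auto simp: orthogonal_def)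
  define p where "p = u - w"
  have p: "p \<noteq> 0" using False by (simp add: p_def)
  define R where "R = matrix (reflect p \<circ> reflect q)"
  have ortho: "orthogonal_transformation (reflect p \<circ> reflect q)"
    by (intro orthogonal_transformation_compose orthogonal_transformation_reflect p q)
  then have R: "R *v x = reflect p (reflect q x)" for x
    by (simp add: R_def orthogonal_transformation_linear[OF ortho])
  have "det R = det (matrix (reflect p)) * det (matrix (reflect q))"
    unfolding R_def
    using matrix_compose[of "reflect q" "reflect p"] orthogonal_transformation_reflect p q(1)
      orthogonal_transformation_linear by (metis det_mul)
  also have "\<dots> = (det (matrix (reflect q)))\<^sup>2"
    using det_reflect_eq[OF p q(1)] by (simp add: power2_eq_square)
  also have "\<dots> = 1"
    using orthogonal_transformation_reflect[OF q(1)]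
    by (metis det_orthogonal_matrix orthogonal_transformation_matrix power2_eq_1_iff)
  finally have "rotation_matrix R"
    using ortho by (auto simp: rotation_matrix_def R_def orthogonal_transformation_matrix)
  moreover have "R *v pole = pole"
    using u w \<open>q \<bullet> pole = 0\<close>
    by (simp add: R reflect_def p_def inner_diff inner_commute[of pole])
  moreover have "R *v u = w"
  proof -
    have "p \<bullet> p = 2 * (u \<bullet> p)"
      using eq by (simp add: p_def inner_diff inner_commute[of w u] norm_eq)
    then have "2 * (u \<bullet> p) / (p \<bullet> p) = 1"
      using p by (metis divide_self inner_eq_zero_iff)
    then have "reflect p u = u - p"
      by (simp only: reflect_def scaleR_one)
    then have "reflect p u = w"
      by (simp add: p_def)
    moreover have "reflect q u = u"
      using \<open>q \<bullet> u = 0\<close> by (simp add: reflect_def inner_commute)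
    ultimately show ?thesis by (simp add: R)
  qed
  ultimately show ?thesis by (rule that)
qed

context polar_sphere_measure
begin

lemma integral_rotation:
  fixes h :: "real ^ 'd option \<Rightarrow> 'b::{second_countable_topology, banach}"
  assumes R: "rotation_matrix R" "R *v pole = pole" and h: "h \<in> borel_measurable \<mu>"
  shows "(\<integral>x. h (R *v x) \<partial>\<mu>) = (\<integral>x. h x \<partial>\<mu>)"
proof -
  have lin: "linear ((*v) R)" by (rule matrix_vector_mul_linear)
  have "orthogonal_transformation ((*v) R)"
    using R(1) by (auto simp: rotation_matrix_def orthogonal_transformation_matrix lin)
  then have norm: "norm (R *v x) = norm x" and surj: "surj ((*v) R)" for x
    by (auto simp: orthogonal_transformation_norm orthogonal_transformation_surj)
  have cont: "continuous_on UNIV ((*v) R)"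
    using linear_continuous_on[OF linear_conv_bounded_linear[THEN iffD1, OF lin]] .
  have meas: "(*v) R \<in> \<mu> \<rightarrow>\<^sub>M \<mu>"
  proof -
    have "(*v) R \<in> \<mu> \<rightarrow>\<^sub>M restrict_space borel (sphere 0 1)"
      by (intro measurable_restrict_space2 borel_measurable_mu continuous_on_subset[OF cont])
        (auto simp: norm space_mu)
    then show ?thesis
      using measurable_cong_sets[OF refl sets_mu] by blast
  qed
  have "distr \<mu> \<mu> ((*v) R) = \<mu>"
  proof (rule measure_eqI)
    fix A assume A: "A \<in> sets (distr \<mu> \<mu> ((*v) R))"
    then have A: "A \<in> sets \<mu>" by simp
    define A' where "A' = (*v) R -` A \<inter> space \<mu>"
    have A': "A' \<in> sets \<mu>"
      unfolding A'_def using measurable_sets[OF meas A] .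
    have "(*v) R ` A' = A"
    proof
      show "A \<subseteq> (*v) R ` A'"
      proof
        fix y assume y: "y \<in> A"
        obtain x where x: "y = R *v x" using surj by (metis surjD)
        moreover have "norm y = 1"
          using sets.sets_into_space[OF A] y by (auto simp: space_mu)
        ultimately have "x \<in> A'" using y norm[of x] by (simp add: A'_def space_mu)
        with x show "y \<in> (*v) R ` A'" by blast
      qed
    qed (auto simp: A'_def)
    moreover have "emeasure \<mu> ((*v) R ` A') = emeasure \<mu> A'"
      using polar R A' by (simp add: polar_measure_def)
    ultimately show "emeasure (distr \<mu> \<mu> ((*v) R)) A = emeasure \<mu> A"
      using emeasure_distr[OF meas A] by (simp add: A'_def)
  qed simp
  then show ?thesis
    using integral_distr[OF meas h] by simp
qed

end

section \<open>Averaging over the meridians\<close>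

lemma (in finite_measure) abs_integral_le:
  fixes h :: "'a \<Rightarrow> real"
  assumes "h \<in> borel_measurable M" "\<And>x. x \<in> space M \<Longrightarrow> \<bar>h x\<bar> \<le> e"
  shows "\<bar>\<integral>x. h x \<partial>M\<bar> \<le> e * measure M (space M)"
proof -
  have int: "integrable M h"
    using assms by (intro integrable_const_bound[where B = e]) auto
  have "\<bar>\<integral>x. h x \<partial>M\<bar> \<le> (\<integral>x. \<bar>h x\<bar> \<partial>M)"
    by (rule integral_abs_bound)
  also have "\<dots> \<le> (\<integral>x. e \<partial>M)"
    using int assms(2) by (intro integral_mono) auto
  finally show ?thesis by (simp add: mult.commute)
qed

text \<open>The span of the exponentials \<open>exp (x \<bullet> w)\<close>. It is an algebra, as Stone-Weierstrass requires, and
  on its generators invariance under rotations about the pole can be seen directly.\<close>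

inductive exp_span :: "('a::real_inner \<Rightarrow> real) \<Rightarrow> bool" where
  exp: "exp_span (\<lambda>x. c * exp (x \<bullet> w))"
| add: "exp_span f \<Longrightarrow> exp_span g \<Longrightarrow> exp_span (\<lambda>x. f x + g x)"

lemma exp_span_mult:
  assumes "exp_span f" "exp_span g"
  shows "exp_span (\<lambda>x. f x * g x)"
  using assms
proof (induction rule: exp_span.induct)
  case (exp c w)
  from exp.prems show ?case
  proof (induction rule: exp_span.induct)
    case (exp c' w')
    have "(\<lambda>x. c * exp (x \<bullet> w) * (c' * exp (x \<bullet> w'))) = (\<lambda>x. (c * c') * exp (x \<bullet> (w + w')))"
      by (simp add: inner_add exp_add mult_ac)
    then show ?case
      using exp_span.exp by metis
  next
    case (add f g)
    then show ?case
      using exp_span.add by (simp add: distrib_left)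
  qed
next
  case (add f f')
  then show ?case
    using exp_span.add by (simp add: distrib_right)
qed

lemma continuous_exp_span: "exp_span f \<Longrightarrow> continuous_on S f"
  by (induction rule: exp_span.induct) (auto intro!: continuous_intros)

lemma exp_span_dense:
  fixes F :: "'a::euclidean_space \<Rightarrow> real"
  assumes "continuous_on (sphere 0 1) F" "0 < e"
  obtains g where "exp_span g" "\<And>x. x \<in> sphere 0 1 \<Longrightarrow> \<bar>F x - g x\<bar> < e"
proof -
  have "\<exists>g. exp_span g \<and> (\<forall>x\<in>sphere 0 1. \<bar>F x - g x\<bar> < e)"
  proof (rule Stone_Weierstrass_HOL)
    show "exp_span (\<lambda>x. c)" for c
      using exp_span.exp[of c 0] by simp
    show "\<exists>f. exp_span f \<and> f x \<noteq> f y" if "x \<in> sphere 0 1 \<and> y \<in> sphere 0 1 \<and> x \<noteq> y" for x y :: 'a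
    proof -
      have "(x - y) \<bullet> (x - y) \<noteq> 0" using that by simp
      then have "x \<bullet> (x - y) \<noteq> y \<bullet> (x - y)"
        by (simp add: inner_diff_left)
      then show ?thesis
        using exp_span.exp[of 1 "x - y"] by (intro exI[of _ "\<lambda>z. exp (z \<bullet> (x - y))"]) auto
    qed
  qed (use assms in \<open>auto intro: exp_span.add exp_span_mult continuous_exp_span\<close>)
  then show ?thesis
    using that by blast
qed

definition equatorial_part :: "real ^ 'd::finite option \<Rightarrow> real ^ 'd option" where
  "equatorial_part x = x - (x \<bullet> pole) *\<^sub>R pole"

text \<open>The point where the meridian through \<open>x\<close> meets the equator. At the poles it is \<open>0\<close>, so that \<open>norm (meridian x)\<close>
  is the indicator function of the complement of the poles.\<close>

definition meridian :: "real ^ 'd::finite option \<Rightarrow> real ^ 'd option" where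
  "meridian x = sgn (equatorial_part x)"

text \<open>Moves \<open>x\<close> along its parallel to the meridian of \<open>u\<close>, or to the opposite one if \<open>\<epsilon> = -1\<close>.\<close>

definition transport :: "real \<Rightarrow> real ^ 'd::finite option \<Rightarrow> real ^ 'd option \<Rightarrow> real ^ 'd option" where
  "transport \<epsilon> x u = (x \<bullet> pole) *\<^sub>R pole + (\<epsilon> * norm (equatorial_part x)) *\<^sub>R u"

lemma equatorial_part_pole [simp]: "equatorial_part x \<bullet> pole = 0"
  by (simp add: equatorial_part_def inner_diff)

lemma meridian_pole [simp]: "meridian x \<bullet> pole = 0"
  by (simp add: meridian_def sgn_div_norm)

lemma inner_equatorial_part: "u \<bullet> pole = 0 \<Longrightarrow> u \<bullet> equatorial_part x = u \<bullet> x"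
  by (simp add: equatorial_part_def inner_diff)

lemma norm_meridian: "norm (meridian x) = (if equatorial_part x = 0 then 0 else 1)"
  by (simp add: meridian_def norm_sgn)

lemma norm_equatorial_part:
  assumes "norm x = 1"
  shows "(norm (equatorial_part x))\<^sup>2 = 1 - (x \<bullet> pole)\<^sup>2"
proof -
  have "equatorial_part x \<bullet> equatorial_part x = equatorial_part x \<bullet> x"
    by (rule inner_equatorial_part) simp
  also have "\<dots> = x \<bullet> x - (x \<bullet> pole)\<^sup>2"
    by (simp add: equatorial_part_def inner_diff inner_commute[of pole x] power2_eq_square)
  finally show ?thesis
    using assms by (simp add: power2_norm_eq_inner norm_eq_1)
qed

lemma norm_transport:
  assumes "norm x = 1" "norm u = 1" "u \<bullet> pole = 0" "\<epsilon>\<^sup>2 = 1"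
  shows "norm (transport \<epsilon> x u) = 1"
proof -
  have "transport \<epsilon> x u \<bullet> transport \<epsilon> x u
      = (x \<bullet> pole)\<^sup>2 + \<epsilon>\<^sup>2 * (norm (equatorial_part x))\<^sup>2 * (u \<bullet> u)"
    using assms(3) by (simp add: transport_def inner_add inner_commute[of pole u] power2_eq_square)
  also have "\<dots> = 1"
    using assms by (simp add: norm_equatorial_part norm_eq_1)
  finally show ?thesis
    by (simp add: norm_eq_1)
qed

context polar_sphere_measure
begin

interpretation P: pair_sigma_finite \<mu> \<mu> ..

interpretation PF: finite_measure "\<mu> \<Otimes>\<^sub>M \<mu>"
  by (intro finite_measure_pair_measure finite_measure_axioms)

lemma measurable_polar_maps [measurable]:
  "(\<lambda>x. x) \<in> \<mu> \<rightarrow>\<^sub>M borel" "equatorial_part \<in> \<mu> \<rightarrow>\<^sub>M borel" "meridian \<in> \<mu> \<rightarrow>\<^sub>M borel"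
proof -
  show [measurable]: "(\<lambda>x. x) \<in> \<mu> \<rightarrow>\<^sub>M borel"
    by (intro borel_measurable_mu continuous_intros)
  show [measurable]: "equatorial_part \<in> \<mu> \<rightarrow>\<^sub>M borel"
    unfolding equatorial_part_def by (intro borel_measurable_mu continuous_intros)
  show "meridian \<in> \<mu> \<rightarrow>\<^sub>M borel"
    unfolding meridian_def sgn_div_norm by measurable
qed

text \<open>The integral of \<open>F\<close> after the meridian of \<open>x\<close> has been replaced by that of an independent
  copy \<open>y\<close> of \<open>x\<close>, restricted to the event that \<open>y\<close> is not a pole.\<close>

definition average :: "real \<Rightarrow> (real ^ 'd option \<Rightarrow> real) \<Rightarrow> real" where
  "average \<epsilon> F = (\<integral>(y, x). norm (meridian y) * F (transport \<epsilon> x (meridian y)) \<partial>(\<mu> \<Otimes>\<^sub>M \<mu>))"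

definition off_pole_mass :: real where
  "off_pole_mass = (\<integral>y. norm (meridian y) \<partial>\<mu>)"

lemma measurable_average:
  assumes "continuous_on UNIV F"
  shows "(\<lambda>(y, x). norm (meridian y) * F (transport \<epsilon> x (meridian y))) \<in> borel_measurable (\<mu> \<Otimes>\<^sub>M \<mu>)"
proof -
  have [measurable]: "F \<in> borel_measurable borel"
    using assms by (rule borel_measurable_continuous_onI)
  show ?thesis
    unfolding transport_def by measurable
qed

lemma bound_average:
  assumes "\<And>x. x \<in> sphere 0 1 \<Longrightarrow> \<bar>F x\<bar> \<le> K" "norm x = 1" "\<epsilon>\<^sup>2 = 1"
  shows "\<bar>norm (meridian y) * F (transport \<epsilon> x (meridian y))\<bar> \<le> K"
proof (cases "equatorial_part y = 0")
  case True
  have "\<bar>F x\<bar> \<le> K" using assms by simp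
  then have "K \<ge> 0" by linarith
  with True show ?thesis by (simp add: norm_meridian)
next
  case False
  then have "norm (transport \<epsilon> x (meridian y)) = 1"
    using assms by (intro norm_transport) (auto simp: norm_meridian)
  then show ?thesis
    using assms(1) False by (simp add: norm_meridian)
qed

lemma integrable_average:
  assumes F: "continuous_on UNIV F" and \<epsilon>: "\<epsilon>\<^sup>2 = 1"
  shows "integrable (\<mu> \<Otimes>\<^sub>M \<mu>) (\<lambda>(y, x). norm (meridian y) * F (transport \<epsilon> x (meridian y)))"
proof -
  have "continuous_on (sphere 0 1) F"
    using F by (rule continuous_on_subset) simp
  then obtain K where "\<And>x. x \<in> sphere 0 1 \<Longrightarrow> norm (F x) \<le> K"
    using compact_bounded_image[OF _ compact_sphere] by blast
  then have K: "\<bar>F x\<bar> \<le> K" if "x \<in> sphere 0 1" for x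
    using that by simp
  show ?thesis
    using measurable_average[OF F] bound_average[OF K _ \<epsilon>]
    by (intro PF.integrable_const_bound[where B = K])
      (auto simp: space_pair_measure space_mu intro!: AE_I2)
qed

lemma average_add:
  assumes "continuous_on UNIV F" "continuous_on UNIV G" "\<epsilon>\<^sup>2 = 1"
  shows "average \<epsilon> (\<lambda>x. F x + G x) = average \<epsilon> F + average \<epsilon> G"
  using Bochner_Integration.integral_add[OF integrable_average[OF assms(1,3)] integrable_average[OF assms(2,3)]]
  by (simp add: average_def case_prod_beta' distrib_left)

lemma average_cmult: "average \<epsilon> (\<lambda>x. c * F x) = c * average \<epsilon> F"
  unfolding average_def integral_mult_right_zero[symmetric]
  by (intro Bochner_Integration.integral_cong) (auto simp: mult_ac)

context
  assumes d: "CARD('d) \<ge> 2"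
begin

lemma rotation_invariance:
  assumes "rotation_matrix R" "R *v pole = pole"
  shows "(R *v x) \<bullet> (R *v y) = x \<bullet> y" "(R *v x) \<bullet> pole = x \<bullet> pole"
    "equatorial_part (R *v x) = R *v equatorial_part x" "meridian (R *v x) = R *v meridian x"
proof -
  have "orthogonal_transformation ((*v) R)"
    using assms(1) by (auto simp: rotation_matrix_def orthogonal_transformation_matrix)
  then have inner: "(R *v x) \<bullet> (R *v y) = x \<bullet> y" and norm: "norm (R *v x) = norm x" for x y
    by (auto simp: orthogonal_transformation_def orthogonal_transformation_norm)
  show "(R *v x) \<bullet> (R *v y) = x \<bullet> y" by (rule inner)
  show pole: "(R *v x) \<bullet> pole = x \<bullet> pole"
    using inner[of x pole] assms(2) by simp
  show eq: "equatorial_part (R *v x) = R *v equatorial_part x"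
    by (simp add: equatorial_part_def pole matrix_vector_mult_diff_distrib matrix_vector_mult_scaleR assms(2))
  show "meridian (R *v x) = R *v meridian x"
    by (simp add: meridian_def sgn_div_norm eq norm matrix_vector_mult_scaleR)
qed

text \<open>A rotation about the pole that maps \<open>u\<close> to \<open>u'\<close> changes neither \<open>\<mu>\<close> nor the products with the pole.\<close>

lemma integral_exp_equatorial:
  assumes "u \<bullet> pole = 0" "u' \<bullet> pole = 0" "norm u = norm u'"
  shows "(\<integral>x. exp (c * (x \<bullet> pole) + x \<bullet> u) \<partial>\<mu>) = (\<integral>x. exp (c * (x \<bullet> pole) + x \<bullet> u') \<partial>\<mu>)"
    and "(\<integral>y. norm (meridian y) * exp (meridian y \<bullet> u) \<partial>\<mu>) = (\<integral>y. norm (meridian y) * exp (meridian y \<bullet> u') \<partial>\<mu>)"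
proof -
  obtain R where R: "rotation_matrix R" "R *v pole = pole" "R *v u = u'"
    using polar_rotation_exists[OF d assms] .
  note inv = rotation_invariance[OF R(1,2)]
  have "(\<integral>x. exp (c * (x \<bullet> pole) + x \<bullet> u) \<partial>\<mu>) = (\<integral>x. exp (c * ((R *v x) \<bullet> pole) + (R *v x) \<bullet> u') \<partial>\<mu>)"
    by (simp add: inv flip: R(3))
  also have "\<dots> = (\<integral>x. exp (c * (x \<bullet> pole) + x \<bullet> u') \<partial>\<mu>)"
    by (rule integral_rotation[OF R(1,2)]) measurable
  finally show "(\<integral>x. exp (c * (x \<bullet> pole) + x \<bullet> u) \<partial>\<mu>) = (\<integral>x. exp (c * (x \<bullet> pole) + x \<bullet> u') \<partial>\<mu>)" .
  have "norm (meridian (R *v y)) = norm (meridian y)" for y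
    by (simp add: norm_eq_sqrt_inner inv)
  then have "(\<integral>y. norm (meridian y) * exp (meridian y \<bullet> u) \<partial>\<mu>)
      = (\<integral>y. norm (meridian (R *v y)) * exp (meridian (R *v y) \<bullet> u') \<partial>\<mu>)"
    by (simp add: inv flip: R(3))
  also have "\<dots> = (\<integral>y. norm (meridian y) * exp (meridian y \<bullet> u') \<partial>\<mu>)"
    by (rule integral_rotation[OF R(1,2)]) measurable
  finally show "(\<integral>y. norm (meridian y) * exp (meridian y \<bullet> u) \<partial>\<mu>)
    = (\<integral>y. norm (meridian y) * exp (meridian y \<bullet> u') \<partial>\<mu>)" .
qed

text \<open>Integrating over \<open>y\<close> first gives, up to a factor that does not involve \<open>y\<close>, a function of \<open>norm (equatorial_part x) * norm p\<close> by
  rotation invariance, where \<open>p\<close> is the equatorial part of \<open>w\<close>. It is symmetric in \<open>x\<close> and \<open>w\<close>, so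
  the exponent \<open>p \<bullet> meridian y\<close> may be traded for \<open>x \<bullet> meridian y\<close> with the norms exchanged. Then the integral
  over \<open>x\<close> no longer depends on \<open>y\<close>, again by rotation invariance.\<close>

lemma average_exp:
  assumes \<epsilon>: "\<epsilon>\<^sup>2 = 1"
  shows "average \<epsilon> (\<lambda>x. exp (x \<bullet> w)) = off_pole_mass * (\<integral>x. exp (x \<bullet> w) \<partial>\<mu>)"
proof -
  define c where "c = w \<bullet> pole"
  define p where "p = equatorial_part w"
  have w: "x \<bullet> w = c * (x \<bullet> pole) + x \<bullet> p" for x
    by (simp add: c_def p_def equatorial_part_def inner_diff inner_commute[of pole w])
  have abs_\<epsilon>: "\<bar>\<epsilon>\<bar> = 1"
    using \<epsilon> by (auto simp: power2_eq_1_iff)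
  have "average \<epsilon> (\<lambda>x. exp (x \<bullet> w))
      = (\<integral>x. (\<integral>y. norm (meridian y) * exp (transport \<epsilon> x (meridian y) \<bullet> w) \<partial>\<mu>) \<partial>\<mu>)"
    unfolding average_def
    by (rule P.integral_snd[symmetric]) (intro integrable_average[OF _ \<epsilon>] continuous_intros)
  also have "\<dots> = (\<integral>x. (\<integral>y. norm (meridian y) * exp (c * (x \<bullet> pole) + \<epsilon> * norm p * (x \<bullet> meridian y)) \<partial>\<mu>) \<partial>\<mu>)"
  proof (rule Bochner_Integration.integral_cong[OF refl])
    fix x
    have "transport \<epsilon> x (meridian y) \<bullet> w
        = c * (x \<bullet> pole) + meridian y \<bullet> ((\<epsilon> * norm (equatorial_part x)) *\<^sub>R p)" for y
      unfolding transport_def inner_add_left inner_scaleR_left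
      by (simp add: w[of "meridian y"] c_def inner_commute[of pole w])
    then have "(\<integral>y. norm (meridian y) * exp (transport \<epsilon> x (meridian y) \<bullet> w) \<partial>\<mu>)
        = (\<integral>y. exp (c * (x \<bullet> pole)) * (norm (meridian y) * exp (meridian y \<bullet> ((\<epsilon> * norm (equatorial_part x)) *\<^sub>R p))) \<partial>\<mu>)"
      by (simp add: exp_add mult_ac)
    also have "\<dots> = exp (c * (x \<bullet> pole)) * (\<integral>y. norm (meridian y) * exp (meridian y \<bullet> ((\<epsilon> * norm (equatorial_part x)) *\<^sub>R p)) \<partial>\<mu>)"
      by (rule integral_mult_right_zero)
    also have "(\<integral>y. norm (meridian y) * exp (meridian y \<bullet> ((\<epsilon> * norm (equatorial_part x)) *\<^sub>R p)) \<partial>\<mu>)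
        = (\<integral>y. norm (meridian y) * exp (meridian y \<bullet> ((\<epsilon> * norm p) *\<^sub>R equatorial_part x)) \<partial>\<mu>)"
      by (rule integral_exp_equatorial) (simp_all add: p_def abs_mult mult_ac)
    also have "exp (c * (x \<bullet> pole)) * \<dots>
        = (\<integral>y. exp (c * (x \<bullet> pole)) * (norm (meridian y) * exp (meridian y \<bullet> ((\<epsilon> * norm p) *\<^sub>R equatorial_part x))) \<partial>\<mu>)"
      by (rule integral_mult_right_zero[symmetric])
    also have "\<dots> = (\<integral>y. norm (meridian y) * exp (c * (x \<bullet> pole) + \<epsilon> * norm p * (x \<bullet> meridian y)) \<partial>\<mu>)"
      by (simp add: exp_add mult_ac inner_equatorial_part inner_commute[of _ x])
    finally show "(\<integral>y. norm (meridian y) * exp (transport \<epsilon> x (meridian y) \<bullet> w) \<partial>\<mu>)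
      = (\<integral>y. norm (meridian y) * exp (c * (x \<bullet> pole) + \<epsilon> * norm p * (x \<bullet> meridian y)) \<partial>\<mu>)" .
  qed
  also have "\<dots> = (\<integral>y. (\<integral>x. norm (meridian y) * exp (c * (x \<bullet> pole) + \<epsilon> * norm p * (x \<bullet> meridian y)) \<partial>\<mu>) \<partial>\<mu>)"
  proof (rule P.Fubini_integral)
    have "norm (meridian y) * exp (c * (x \<bullet> pole) + \<epsilon> * norm p * (x \<bullet> meridian y)) \<le> exp (\<bar>c\<bar> + norm p)"
      if "norm x = 1" for x y :: "real ^ 'd option"
    proof -
      have "\<bar>x \<bullet> meridian y\<bar> \<le> 1"
        using Cauchy_Schwarz_ineq2[of x "meridian y"] that by (auto simp: norm_meridian split: if_splits)
      then have "\<bar>\<epsilon> * norm p * (x \<bullet> meridian y)\<bar> \<le> norm p"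
        using abs_\<epsilon> by (simp add: abs_mult mult_left_le)
      moreover have "\<bar>c * (x \<bullet> pole)\<bar> \<le> \<bar>c\<bar>"
        using abs_inner_pole_le[OF that] by (simp add: abs_mult mult_left_le)
      ultimately have "exp (c * (x \<bullet> pole) + \<epsilon> * norm p * (x \<bullet> meridian y)) \<le> exp (\<bar>c\<bar> + norm p)"
        by simp
      then show ?thesis
        by (auto simp: norm_meridian)
    qed
    then show "integrable (\<mu> \<Otimes>\<^sub>M \<mu>) (\<lambda>(y, x). norm (meridian y) * exp (c * (x \<bullet> pole) + \<epsilon> * norm p * (x \<bullet> meridian y)))"
      by (intro PF.integrable_const_bound[where B = "exp (\<bar>c\<bar> + norm p)"])
        (auto simp: space_pair_measure space_mu intro!: AE_I2)
  qed
  also have "\<dots> = (\<integral>y. norm (meridian y) * (\<integral>x. exp (x \<bullet> w) \<partial>\<mu>) \<partial>\<mu>)"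
  proof (rule Bochner_Integration.integral_cong[OF refl])
    fix y
    have "(\<integral>x. norm (meridian y) * exp (c * (x \<bullet> pole) + \<epsilon> * norm p * (x \<bullet> meridian y)) \<partial>\<mu>)
        = norm (meridian y) * (\<integral>x. exp (c * (x \<bullet> pole) + x \<bullet> ((\<epsilon> * norm p) *\<^sub>R meridian y)) \<partial>\<mu>)"
      by simp
    also have "\<dots> = norm (meridian y) * (\<integral>x. exp (c * (x \<bullet> pole) + x \<bullet> p) \<partial>\<mu>)"
    proof (cases "equatorial_part y = 0")
      case False
      then have "(\<integral>x. exp (c * (x \<bullet> pole) + x \<bullet> ((\<epsilon> * norm p) *\<^sub>R meridian y)) \<partial>\<mu>)
          = (\<integral>x. exp (c * (x \<bullet> pole) + x \<bullet> p) \<partial>\<mu>)"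
        by (intro integral_exp_equatorial) (simp_all add: p_def abs_mult abs_\<epsilon> norm_meridian)
      then show ?thesis by simp
    qed (simp add: norm_meridian)
    finally show "(\<integral>x. norm (meridian y) * exp (c * (x \<bullet> pole) + \<epsilon> * norm p * (x \<bullet> meridian y)) \<partial>\<mu>)
      = norm (meridian y) * (\<integral>x. exp (x \<bullet> w) \<partial>\<mu>)"
      by (simp add: w)
  qed
  finally show ?thesis
    by (simp add: off_pole_mass_def)
qed

text \<open>Both sides are linear in \<open>F\<close> and bounded by a multiple of the supremum of \<open>\<bar>F\<bar>\<close> on the sphere, so it suffices to
  check exponentials.\<close>

lemma average_eq:
  assumes F: "continuous_on UNIV F" and \<epsilon>: "\<epsilon>\<^sup>2 = 1"
  shows "average \<epsilon> F = off_pole_mass * (\<integral>x. F x \<partial>\<mu>)"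
proof -
  have span: "average \<epsilon> g = off_pole_mass * (\<integral>x. g x \<partial>\<mu>)" if "exp_span g" for g
    using that
  proof (induction rule: exp_span.induct)
    case (exp c w)
    then show ?case
      by (simp add: average_cmult average_exp[OF \<epsilon>])
  next
    case (add f g)
    then show ?case
      using continuous_exp_span[OF add(1)] continuous_exp_span[OF add(2)]
      by (simp add: average_add \<epsilon> integrable_mu ring_distribs)
  qed
  \<comment> \<open>Bounds the operator norm of the difference of the two sides.\<close>
  define K where "K = measure (\<mu> \<Otimes>\<^sub>M \<mu>) (space (\<mu> \<Otimes>\<^sub>M \<mu>)) + \<bar>off_pole_mass\<bar> * measure \<mu> (space \<mu>)"
  have bound: "\<bar>average \<epsilon> F - off_pole_mass * (\<integral>x. F x \<partial>\<mu>)\<bar> \<le> e * K" if e: "e > 0" for e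
  proof -
    obtain g where g: "exp_span g" "\<And>x. x \<in> sphere 0 1 \<Longrightarrow> \<bar>F x - g x\<bar> < e"
      using exp_span_dense[OF continuous_on_subset[OF F] e] by blast
    have cg: "continuous_on S g" for S by (rule continuous_exp_span[OF g(1)])
    have cFg: "continuous_on UNIV (\<lambda>x. F x - g x)"
      by (intro continuous_intros F cg)
    have "average \<epsilon> F - average \<epsilon> g = average \<epsilon> (\<lambda>x. F x - g x)"
      using average_add[OF cFg cg \<epsilon>] by simp
    also have "\<bar>\<dots>\<bar> \<le> e * measure (\<mu> \<Otimes>\<^sub>M \<mu>) (space (\<mu> \<Otimes>\<^sub>M \<mu>))"
      unfolding average_def
    proof (rule PF.abs_integral_le[OF measurable_average[OF cFg]])
      fix z assume z: "z \<in> space (\<mu> \<Otimes>\<^sub>M \<mu>)"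
      obtain y x where "z = (y, x)" by (cases z)
      then show "\<bar>case z of (y, x) \<Rightarrow> norm (meridian y) *
          (F (transport \<epsilon> x (meridian y)) - g (transport \<epsilon> x (meridian y)))\<bar> \<le> e"
        using bound_average[of "\<lambda>x. F x - g x" e x \<epsilon> y] g(2) \<epsilon> z
        by (simp add: space_pair_measure space_mu less_imp_le)
    qed
    finally have 1: "\<bar>average \<epsilon> F - average \<epsilon> g\<bar> \<le> e * measure (\<mu> \<Otimes>\<^sub>M \<mu>) (space (\<mu> \<Otimes>\<^sub>M \<mu>))" .
    have "(\<integral>x. F x \<partial>\<mu>) - (\<integral>x. g x \<partial>\<mu>) = (\<integral>x. F x - g x \<partial>\<mu>)"
      using F cg by (intro Bochner_Integration.integral_diff[symmetric] integrable_mu)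
        (auto intro: continuous_on_subset)
    also have "\<bar>\<dots>\<bar> \<le> e * measure \<mu> (space \<mu>)"
      using g(2) by (intro abs_integral_le borel_measurable_mu continuous_on_subset[OF cFg])
        (auto simp: space_mu less_imp_le)
    finally have "\<bar>off_pole_mass\<bar> * \<bar>(\<integral>x. F x \<partial>\<mu>) - (\<integral>x. g x \<partial>\<mu>)\<bar>
        \<le> \<bar>off_pole_mass\<bar> * (e * measure \<mu> (space \<mu>))"
      by (intro mult_left_mono) auto
    then have 2: "\<bar>off_pole_mass * (\<integral>x. F x \<partial>\<mu>) - off_pole_mass * (\<integral>x. g x \<partial>\<mu>)\<bar>
        \<le> e * (\<bar>off_pole_mass\<bar> * measure \<mu> (space \<mu>))"
      by (simp only: abs_mult[symmetric] right_diff_distrib mult_ac)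
    show ?thesis
      using 1 2 span[OF g(1)] unfolding K_def distrib_left by linarith
  qed
  have "\<bar>average \<epsilon> F - off_pole_mass * (\<integral>x. F x \<partial>\<mu>)\<bar> \<le> 0"
  proof (rule field_le_epsilon)
    fix e :: real assume "e > 0"
    have K: "K \<ge> 0" by (simp add: K_def)
    then have "\<bar>average \<epsilon> F - off_pole_mass * (\<integral>x. F x \<partial>\<mu>)\<bar> \<le> e / (K + 1) * K"
      using \<open>e > 0\<close> by (intro bound) auto
    also have "\<dots> \<le> e"
      using K \<open>e > 0\<close> by (simp add: field_simps)
    finally show "\<bar>average \<epsilon> F - off_pole_mass * (\<integral>x. F x \<partial>\<mu>)\<bar> \<le> 0 + e" by simp
  qed
  then show ?thesis by simp
qed

end

end

section \<open>Restriction to great circles through the pole\<close>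

definition great_circle :: "real ^ 'd::finite option \<Rightarrow> real \<Rightarrow> real ^ 'd option" where
  "great_circle u t = cos (2 * pi * t) *\<^sub>R pole + sin (2 * pi * t) *\<^sub>R u"

text \<open>Along \<open>c *\<^sub>R great_circle u t\<close> a polynomial function is a polynomial in \<open>c\<close> whose \<open>n\<close>-th coefficient is
  a trigonometric polynomial of degree at most \<open>n\<close> in \<open>t\<close>: this passes through sums and products.
  Homogeneity leaves the \<open>k\<close>-th coefficient only.\<close>

lemma trig_poly_homogeneous:
  fixes p :: "real ^ 'd::finite option \<Rightarrow> real"
  assumes p: "real_polynomial_function p" and hom: "\<And>c x. p (c *\<^sub>R x) = c ^ k * p x"
  shows "trig_poly k (\<lambda>t. complex_of_real (p (great_circle u t)))"
proof -
  have "\<exists>Q. (\<forall>c t. p (c *\<^sub>R great_circle u t) = poly (Q t) c) \<and>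
      (\<forall>n. trig_poly n (\<lambda>t. complex_of_real (coeff (Q t) n)))"
    using p
  proof (induction rule: real_polynomial_function.induct)
    case (linear f)
    then interpret bounded_linear f .
    have "trig_poly n (\<lambda>t. complex_of_real (coeff [:0, f (great_circle u t):] n))" for n
    proof (cases n)
      case 0
      then show ?thesis by (simp add: trig_poly_const)
    next
      case (Suc m)
      have "trig_poly 1 (\<lambda>t. complex_of_real (f pole) * complex_of_real (cos (2 * pi * t))
          + complex_of_real (f u) * complex_of_real (sin (2 * pi * t)))"
        by (intro trig_poly_add trig_poly_cmult trig_poly_cos trig_poly_sin)
      then have "trig_poly 1 (\<lambda>t. complex_of_real (f (great_circle u t)))"
        by (simp add: great_circle_def add scaleR mult.commute)
      then show ?thesis
        using Suc by (cases m) (auto simp: trig_poly_const)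
    qed
    then show ?case
      by (intro exI[of _ "\<lambda>t. [:0, f (great_circle u t):]"]) (simp add: scaleR mult.commute)
  next
    case (const c)
    have "trig_poly n (\<lambda>t. complex_of_real (coeff [:c:] n))" for n
      by (rule trig_poly_const)
    then show ?case
      by (intro exI[of _ "\<lambda>t. [:c:]"]) auto
  next
    case (add f g)
    then obtain Q Q' where
      "\<And>c t. f (c *\<^sub>R great_circle u t) = poly (Q t) c" "\<And>n. trig_poly n (\<lambda>t. complex_of_real (coeff (Q t) n))"
      "\<And>c t. g (c *\<^sub>R great_circle u t) = poly (Q' t) c" "\<And>n. trig_poly n (\<lambda>t. complex_of_real (coeff (Q' t) n))"
      by blast
    then show ?case
      by (intro exI[of _ "\<lambda>t. Q t + Q' t"]) (auto intro: trig_poly_add)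
  next
    case (mult f g)
    then obtain Q Q' where
      Q: "\<And>c t. f (c *\<^sub>R great_circle u t) = poly (Q t) c" "\<And>n. trig_poly n (\<lambda>t. complex_of_real (coeff (Q t) n))"
      "\<And>c t. g (c *\<^sub>R great_circle u t) = poly (Q' t) c" "\<And>n. trig_poly n (\<lambda>t. complex_of_real (coeff (Q' t) n))"
      by blast
    have "trig_poly n (\<lambda>t. complex_of_real (coeff (Q t * Q' t) n))" for n
    proof -
      have "trig_poly n (\<lambda>t. complex_of_real (coeff (Q t) i) * complex_of_real (coeff (Q' t) (n - i)))"
        if "i \<le> n" for i
        using trig_poly_mult[OF Q(2)[of i] Q(4)[of "n - i"]] that by simp
      then have "trig_poly n (\<lambda>t. \<Sum>i\<le>n. complex_of_real (coeff (Q t) i) * complex_of_real (coeff (Q' t) (n - i)))"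
        by (intro trig_poly_sum) auto
      then show ?thesis by (simp add: coeff_mult)
    qed
    then show ?case
      using Q by (intro exI[of _ "\<lambda>t. Q t * Q' t"]) auto
  qed
  then obtain Q where Q: "\<And>c t. p (c *\<^sub>R great_circle u t) = poly (Q t) c"
    "\<And>n. trig_poly n (\<lambda>t. complex_of_real (coeff (Q t) n))" by blast
  have "Q t = monom (p (great_circle u t)) k" for t
    using Q(1)[of _ t] hom by (intro poly_eq_poly_eq_iff[THEN iffD1] ext) (simp add: poly_monom mult.commute)
  then have "coeff (Q t) k = p (great_circle u t)" for t by simp
  with Q(2)[of k] show ?thesis by simp
qed

context polar_sphere_measure
begin

text \<open>The integral of \<open>F\<close> over the great circle through the pole and \<open>u\<close> against the polar part.\<close>

definition meridian_sum :: "(real ^ 'd option \<Rightarrow> real) \<Rightarrow> real ^ 'd option \<Rightarrow> real" where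
  "meridian_sum F u = (\<integral>x. F (transport 1 x u) + F (transport (- 1) x u) \<partial>\<mu>)"

lemma continuous_transport:
  "continuous_on S (\<lambda>x. transport \<epsilon> x u)" "continuous_on S (\<lambda>u. transport \<epsilon> x u)"
  unfolding transport_def equatorial_part_def by (intro continuous_intros)+

lemma continuous_meridian_sum:
  assumes F: "continuous_on UNIV F"
  shows "continuous_on UNIV (meridian_sum F)"
  unfolding continuous_on_eq_continuous_at[OF open_UNIV]
proof
  fix u
  have F': "isCont F x" for x
    using F by (simp add: continuous_on_eq_continuous_at)
  have cF: "continuous_on S (\<lambda>x. F (transport \<epsilon> x w))" for S \<epsilon> w
    using continuous_on_compose2[OF F continuous_transport(1)] by auto
  show "isCont (meridian_sum F) u"
    unfolding continuous_at_sequentially comp_def meridian_sum_def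
  proof (intro allI impI)
    fix w :: "nat \<Rightarrow> real ^ 'd option" assume w: "w \<longlonglongrightarrow> u"
    then obtain B where B: "\<And>n. norm (w n) \<le> B"
      by (meson Bseq_def convergent_def convergent_imp_Bseq)
    have "continuous_on (cball 0 (1 + B)) F"
      using F by (rule continuous_on_subset) simp
    then obtain K where "\<And>x. x \<in> cball 0 (1 + B) \<Longrightarrow> norm (F x) \<le> K"
      using compact_bounded_image[OF _ compact_cball] by blast
    then have K: "\<bar>F x\<bar> \<le> K" if "norm x \<le> 1 + B" for x
      using that by simp
    have tr: "norm (transport \<epsilon> x (w n)) \<le> 1 + B" if "norm x = 1" "\<bar>\<epsilon>\<bar> = 1" for x \<epsilon> n
    proof -
      have "(norm (equatorial_part x))\<^sup>2 \<le> 1\<^sup>2"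
        using norm_equatorial_part[OF that(1)] by simp
      then have "norm (equatorial_part x) \<le> 1"
        by (rule power2_le_imp_le) simp
      then have "norm (equatorial_part x) * norm (w n) \<le> 1 * B"
        using B by (intro mult_mono) auto
      then have "norm ((\<epsilon> * norm (equatorial_part x)) *\<^sub>R w n) \<le> B"
        using that(2) by (simp add: abs_mult)
      moreover have "norm ((x \<bullet> pole) *\<^sub>R pole :: real ^ 'd option) \<le> 1"
        using abs_inner_pole_le[OF that(1)] by simp
      ultimately show ?thesis
        unfolding transport_def using norm_triangle_le by (metis add_mono)
    qed
    show "(\<lambda>n. \<integral>x. F (transport 1 x (w n)) + F (transport (- 1) x (w n)) \<partial>\<mu>)
        \<longlonglongrightarrow> (\<integral>x. F (transport 1 x u) + F (transport (- 1) x u) \<partial>\<mu>)"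
    proof (rule integral_dominated_convergence[where w = "\<lambda>_. 2 * K"])
      show "AE x in \<mu>. (\<lambda>n. F (transport 1 x (w n)) + F (transport (- 1) x (w n)))
          \<longlonglongrightarrow> F (transport 1 x u) + F (transport (- 1) x u)"
      proof (rule AE_I2)
        fix x
        have "(\<lambda>n. F (transport \<epsilon> x (w n))) \<longlonglongrightarrow> F (transport \<epsilon> x u)" for \<epsilon>
          by (rule isCont_tendsto_compose[OF F']) (auto simp: transport_def intro!: tendsto_intros w)
        then show "(\<lambda>n. F (transport 1 x (w n)) + F (transport (- 1) x (w n)))
          \<longlonglongrightarrow> F (transport 1 x u) + F (transport (- 1) x u)"
          by (intro tendsto_intros)
      qed
      show "AE x in \<mu>. norm (F (transport 1 x (w n)) + F (transport (- 1) x (w n))) \<le> 2 * K" for n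
      proof (rule AE_I2)
        fix x assume "x \<in> space \<mu>"
        then have "\<bar>F (transport 1 x (w n))\<bar> \<le> K" "\<bar>F (transport (- 1) x (w n))\<bar> \<le> K"
          by (intro K tr; simp add: space_mu)+
        then show "norm (F (transport 1 x (w n)) + F (transport (- 1) x (w n))) \<le> 2 * K"
          by simp
      qed
    qed (auto intro!: borel_measurable_mu continuous_intros cF)
  qed
qed

context
  assumes d: "CARD('d) \<ge> 2"
begin

lemma integral_meridian_sum:
  assumes F: "continuous_on UNIV F"
  shows "(\<integral>y. norm (meridian y) * meridian_sum F (meridian y) \<partial>\<mu>) = 2 * off_pole_mass * (\<integral>x. F x \<partial>\<mu>)"
proof -
  interpret P: pair_sigma_finite \<mu> \<mu> ..
  have part: "average \<epsilon> F = (\<integral>y. norm (meridian y) * (\<integral>x. F (transport \<epsilon> x (meridian y)) \<partial>\<mu>) \<partial>\<mu>)"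
    and int: "integrable \<mu> (\<lambda>y. norm (meridian y) * (\<integral>x. F (transport \<epsilon> x (meridian y)) \<partial>\<mu>))"
    if "\<epsilon>\<^sup>2 = 1" for \<epsilon>
    using P.integral_fst[OF integrable_average[OF F that]] P.integrable_fst[OF integrable_average[OF F that]]
    by (simp_all add: average_def)
  have split: "meridian_sum F u = (\<integral>x. F (transport 1 x u) \<partial>\<mu>) + (\<integral>x. F (transport (- 1) x u) \<partial>\<mu>)" for u
    unfolding meridian_sum_def
    using continuous_on_compose2[OF F continuous_transport(1)]
    by (intro Bochner_Integration.integral_add integrable_mu) auto
  have "(\<integral>y. norm (meridian y) * meridian_sum F (meridian y) \<partial>\<mu>) = average 1 F + average (- 1) F"
    unfolding split distrib_left by (simp add: part int)
  also have "\<dots> = 2 * off_pole_mass * (\<integral>x. F x \<partial>\<mu>)"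
    by (simp add: average_eq[OF d F])
  finally show ?thesis .
qed

text \<open>The average of the meridian sums over the meridians of \<open>\<mu>\<close>-random points is a multiple of the integral
  of \<open>F\<close>. If the latter were not positive, almost every meridian sum would vanish, also after rotation. But the rotated copies
  of the open set where the meridian sum is positive cover the equator, and finitely many of them suffice by
  compactness. If \<open>\<mu>\<close> is concentrated at the poles, there is nothing to average: every meridian sum
  is twice the integral of \<open>F\<close>.\<close>

lemma integral_pos_if_meridian_sums_nonneg:
  assumes F: "continuous_on UNIV F"
    and nonneg: "\<And>u. norm u = 1 \<Longrightarrow> u \<bullet> pole = 0 \<Longrightarrow> 0 \<le> meridian_sum F u"
    and u0: "norm u0 = 1" "u0 \<bullet> pole = 0" "0 < meridian_sum F u0"
  shows "0 < (\<integral>x. F x \<partial>\<mu>)"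
proof (rule ccontr)
  assume neg: "\<not> ?thesis"
  define J where "J = meridian_sum F"
  have contJ: "continuous_on S J" for S
    using continuous_meridian_sum[OF F] continuous_on_subset unfolding J_def by blast
  then have [measurable]: "J \<in> borel_measurable borel"
    by (intro borel_measurable_continuous_onI)
  have eq_or: "equatorial_part y = 0 \<or> norm (meridian y) = 1" for y
    by (simp add: norm_meridian)
  have off_nonneg: "off_pole_mass \<ge> 0"
    unfolding off_pole_mass_def by (intro integral_nonneg_AE) auto
  have int_norm: "integrable \<mu> (\<lambda>y. norm (meridian y))"
    by (intro integrable_const_bound[where B = 1]) (auto simp: norm_meridian)
  show False
  proof (cases "off_pole_mass = 0")
    case True
    then have "AE x in \<mu>. norm (meridian x) = 0"
      unfolding off_pole_mass_def using int_norm by (subst (asm) integral_nonneg_eq_0_iff_AE) auto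
    then have "AE x in \<mu>. F (transport 1 x u0) + F (transport (- 1) x u0) = 2 * F x"
    proof eventually_elim
      case (elim x)
      then have e: "equatorial_part x = 0"
        by (simp add: norm_meridian split: if_splits)
      then have "transport \<epsilon> x u0 = x" for \<epsilon>
        by (simp add: transport_def) (simp add: equatorial_part_def)
      then show ?case by simp
    qed
    then have "meridian_sum F u0 = (\<integral>x. 2 * F x \<partial>\<mu>)"
      unfolding meridian_sum_def
      using continuous_on_compose2[OF F continuous_transport(1)] continuous_on_subset[OF F]
      by (intro integral_cong_AE borel_measurable_mu continuous_intros) auto
    then show False
      using u0(3) neg by simp
  next
    case False
    have "(\<integral>y. norm (meridian y) * J (meridian y) \<partial>\<mu>) \<le> 0"
      unfolding J_def integral_meridian_sum[OF F] using off_nonneg neg by (intro mult_nonneg_nonpos) auto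
    moreover have "0 \<le> norm (meridian y) * J (meridian y)" for y
      using eq_or[of y] nonneg[of "meridian y"] by (auto simp: J_def norm_meridian)
    ultimately have zero: "(\<integral>y. norm (meridian y) * J (meridian y) \<partial>\<mu>) = 0"
      by (intro antisym integral_nonneg_AE) auto
    define E where "E = sphere 0 1 \<inter> {u :: real ^ 'd option. u \<bullet> pole = 0}"
    have "compact E"
      unfolding E_def by (intro compact_Int_closed compact_sphere closed_Collect_eq continuous_intros)
    define \<R> where "\<R> = {R :: real ^ 'd option ^ 'd option. rotation_matrix R \<and> R *v pole = pole}"
    define W where "W R = {u. 0 < J (R *v u)}" for R :: "real ^ 'd option ^ 'd option"
    have contJR: "continuous_on S (\<lambda>u. J (R *v u))" for S R
      by (rule continuous_on_compose2[OF contJ[of UNIV]])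
        (auto intro!: linear_continuous_on linear_conv_bounded_linear[THEN iffD1])
    have "E \<subseteq> (\<Union>R\<in>\<R>. W R)"
    proof
      fix u assume "u \<in> E"
      then obtain R where "rotation_matrix R" "R *v pole = pole" "R *v u = u0"
        using polar_rotation_exists[OF d, of u u0] u0 by (auto simp: E_def)
      then show "u \<in> (\<Union>R\<in>\<R>. W R)"
        using u0(3) by (auto simp: \<R>_def W_def J_def)
    qed
    moreover have "open (W R)" for R
      unfolding W_def by (intro open_Collect_less continuous_intros contJR)
    ultimately obtain \<F> where \<F>: "\<F> \<subseteq> \<R>" "finite \<F>" "E \<subseteq> (\<Union>R\<in>\<F>. W R)"
      using compactE_image[OF \<open>compact E\<close>, of \<R> W] by metis
    have R: "rotation_matrix R" "R *v pole = pole" if "R \<in> \<F>" for R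
      using that \<F>(1) by (auto simp: \<R>_def)
    have inE: "R *v u \<in> E" if "R \<in> \<F>" "u \<in> E" for R u
      using that rotation_invariance[OF d R[OF that(1)]] by (auto simp: E_def norm_eq_1)
    have mer_E: "meridian y \<in> E" if "equatorial_part y \<noteq> 0" for y
      using that by (simp add: E_def norm_meridian)
    have pos: "0 \<le> norm (meridian y) * J (R *v meridian y)" if "R \<in> \<F>" for R y
      using inE[OF that mer_E, of y] nonneg[of "R *v meridian y"]
      by (cases "equatorial_part y = 0") (auto simp: J_def norm_meridian E_def)
    have [measurable]: "(\<lambda>u. J (R *v u)) \<in> borel_measurable borel" for R
      by (rule borel_measurable_continuous_onI[OF contJR])
    have AE: "AE y in \<mu>. norm (meridian y) * J (R *v meridian y) = 0" if "R \<in> \<F>" for R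
    proof -
      have "norm (meridian (R *v y)) = norm (meridian y)" for y
        using rotation_invariance[OF d R[OF that]] by (simp add: norm_eq_sqrt_inner)
      then have "(\<integral>y. norm (meridian y) * J (R *v meridian y) \<partial>\<mu>)
          = (\<integral>y. norm (meridian (R *v y)) * J (meridian (R *v y)) \<partial>\<mu>)"
        by (simp add: rotation_invariance[OF d R[OF that]])
      also have "\<dots> = (\<integral>y. norm (meridian y) * J (meridian y) \<partial>\<mu>)"
        by (rule integral_rotation[OF R[OF that]]) measurable
      finally have "(\<integral>y. norm (meridian y) * J (R *v meridian y) \<partial>\<mu>) = 0"
        using zero by simp
      moreover have "integrable \<mu> (\<lambda>y. norm (meridian y) * J (R *v meridian y))"
      proof -
        obtain K where K: "\<And>u. u \<in> E \<Longrightarrow> norm (J (R *v u)) \<le> K"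
          using compact_bounded_image[OF contJR \<open>compact E\<close>] by blast
        have "norm (norm (meridian y) * J (R *v meridian y)) \<le> \<bar>K\<bar>" for y
          using K mer_E[of y] by (cases "equatorial_part y = 0") (force simp: norm_meridian)+
        then show ?thesis
          by (intro integrable_const_bound[where B = "\<bar>K\<bar>"]) auto
      qed
      ultimately show ?thesis
        using pos[OF that] by (subst (asm) integral_nonneg_eq_0_iff_AE) auto
    qed
    have "AE y in \<mu>. \<forall>R\<in>\<F>. norm (meridian y) * J (R *v meridian y) = 0"
      by (rule AE_finite_allI[OF \<F>(2) AE])
    then have "AE y in \<mu>. norm (meridian y) = 0"
    proof eventually_elim
      case (elim y)
      show ?case
      proof (rule ccontr)
        assume ne: "norm (meridian y) \<noteq> 0"
        then have "meridian y \<in> E"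
          by (intro mer_E) (auto simp: norm_meridian split: if_splits)
        then obtain R where "R \<in> \<F>" "0 < J (R *v meridian y)"
          using \<F>(3) by (auto simp: W_def)
        with elim ne show False by auto
      qed
    qed
    then have "off_pole_mass = 0"
      unfolding off_pole_mass_def by (simp add: integral_eq_zero_AE)
    with False show False ..
  qed
qed

end

end

section \<open>Comparison of the two problems\<close>

lemma sign_radius_nonneg: "eventually_nonneg X \<delta> f \<Longrightarrow> 0 \<le> sign_radius X \<delta> f"
  unfolding sign_radius_def eventually_nonneg_def by (intro cInf_greatest) auto

lemma eventually_nonneg_torus: "eventually_nonneg UNIV torus_norm f"
proof -
  have "torus_norm x < 1" for x
    using torus_norm_le_half[of x] by simp
  then show ?thesis
    unfolding eventually_nonneg_def nonneg_outside_ball_def by (intro exI[of _ 1]) auto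
qed

lemma geodesic_dist_pole: "geodesic_dist pole x = 2 * pi * latitude x"
  by (simp add: geodesic_dist_def latitude_def inner_commute)

lemma geodesic_dist_pole_le: "x \<in> sphere 0 1 \<Longrightarrow> geodesic_dist pole x \<le> pi"
  using latitude_bounds(2)[of x] by (simp add: geodesic_dist_pole field_simps)

lemma eventually_nonneg_sphere: "eventually_nonneg (sphere 0 1) (geodesic_dist pole) f"
proof -
  have "geodesic_dist pole x < 4" if "x \<in> sphere 0 1" for x
    using geodesic_dist_pole_le[OF that] pi_less_4 by linarith
  then show ?thesis
    unfolding eventually_nonneg_def nonneg_outside_ball_def by (intro exI[of _ 4]) auto
qed

lemma norm_great_circle:
  assumes "norm u = 1" "u \<bullet> pole = 0"
  shows "norm (great_circle u t) = 1" "great_circle u t \<bullet> pole = cos (2 * pi * t)"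
proof -
  show "great_circle u t \<bullet> pole = cos (2 * pi * t)"
    using assms by (simp add: great_circle_def inner_add)
  have "great_circle u t \<bullet> great_circle u t = (cos (2 * pi * t))\<^sup>2 + (sin (2 * pi * t))\<^sup>2 * (u \<bullet> u)"
    using assms(2) by (simp add: great_circle_def inner_add inner_commute[of pole u] power2_eq_square)
  then show "norm (great_circle u t) = 1"
    using assms(1) by (simp add: norm_eq_1)
qed

lemma equator_nonempty:
  obtains u :: "real ^ 'd::finite option" where "norm u = 1" "u \<bullet> pole = 0"
proof
  show "norm (axis (Some undefined) 1 :: real ^ 'd option) = 1" by simp
  show "(axis (Some undefined) 1 :: real ^ 'd option) \<bullet> pole = 0"
    by (simp add: inner_pole axis_def)
qed

lemma sin_latitude:
  assumes "norm x = 1"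
  shows "sin (2 * pi * latitude x) = norm (equatorial_part x)"
proof (rule power2_eq_imp_eq)
  show "(sin (2 * pi * latitude x))\<^sup>2 = (norm (equatorial_part x))\<^sup>2"
    by (simp add: sin_squared_eq cos_latitude[OF assms] norm_equatorial_part[OF assms])
  show "0 \<le> sin (2 * pi * latitude x)"
    using latitude_bounds[OF assms] by (intro sin_ge_zero) (auto simp: field_simps)
qed auto

lemma great_circle_latitude:
  assumes "norm x = 1"
  shows "great_circle u (latitude x) = transport 1 x u"
    and "great_circle u (- latitude x) = transport (- 1) x u"
  using assms by (simp_all add: great_circle_def transport_def cos_latitude sin_latitude)

text \<open>A pole lies on all great circles through the poles; any other point determines its meridian.\<close>

lemma on_great_circle:
  fixes x :: "real ^ 'd::finite option"
  assumes "norm x = 1"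
  obtains u t where "norm u = 1" "u \<bullet> pole = 0" "x = great_circle u t"
proof (cases "equatorial_part x = 0")
  case True
  obtain u :: "real ^ 'd option" where "norm u = 1" "u \<bullet> pole = 0"
    by (rule equator_nonempty)
  moreover from this have "x = great_circle u (latitude x)"
    using True by (simp add: great_circle_latitude[OF assms] transport_def) (simp add: equatorial_part_def)
  ultimately show ?thesis by (rule that)
next
  case False
  have "norm (equatorial_part x) *\<^sub>R meridian x = equatorial_part x"
    using False by (simp add: meridian_def sgn_div_norm)
  then have "x = great_circle (meridian x) (latitude x)"
    by (simp add: great_circle_latitude[OF assms] transport_def) (simp add: equatorial_part_def)
  then show ?thesis
    using False by (intro that[of "meridian x"]) (auto simp: norm_meridian)
qed

context polar_sphere_measure
begin

lemma integral_trig_poly_polar_part: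
  assumes "trig_poly N (\<lambda>t. complex_of_real (f t))"
  shows "(\<integral>t. f t \<partial>polar_part \<mu>) = (\<integral>x. f (latitude x) + f (- latitude x) \<partial>\<mu>)"
proof -
  obtain G :: "complex \<Rightarrow> real" where "continuous_on UNIV G" "\<And>t. G (torus_exp t) = f t"
    using trig_poly_continuous_on_circle[OF assms] by blast
  then show ?thesis
    using integral_polar_part[of G] by simp
qed

lemma integral_great_circle:
  assumes F: "continuous_on UNIV F"
  shows "(\<integral>t. F (great_circle u t) \<partial>polar_part \<mu>) = meridian_sum F u"
proof -
  define G where "G z = F (Re z *\<^sub>R pole + Im z *\<^sub>R u)" for z
  have "continuous_on UNIV G"
    unfolding G_def by (intro continuous_on_compose2[OF F] continuous_intros) auto
  moreover have "G (torus_exp t) = F (great_circle u t)" for t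
    by (simp add: G_def great_circle_def torus_exp_def)
  ultimately have "(\<integral>t. F (great_circle u t) \<partial>polar_part \<mu>)
      = (\<integral>x. F (great_circle u (latitude x)) + F (great_circle u (- latitude x)) \<partial>\<mu>)"
    using integral_polar_part[of G] by simp
  also have "\<dots> = meridian_sum F u"
    unfolding meridian_sum_def
    by (intro Bochner_Integration.integral_cong refl) (simp add: space_mu great_circle_latitude)
  finally show ?thesis .
qed

lemma zonal_in_sphere_class:
  assumes "degree q \<le> N" "\<And>x. x \<in> sphere 0 1 \<Longrightarrow> F x = poly q (x \<bullet> pole)" "(\<integral>x. F x \<partial>\<mu>) \<le> 0"
  shows "F \<in> sphere_class \<mu> N"
  using poly_inner_eq_sum_spherical_harmonics[OF norm_pole assms(1)] assms(2,3) eventually_nonneg_sphere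
  unfolding sphere_class_def by fastforce

lemma sphere_rho_le:
  assumes "F \<in> sphere_class \<mu> N" "\<exists>x\<in>sphere 0 1. F x \<noteq> 0"
  shows "sphere_rho \<mu> N \<le> sphere_sign_radius F"
  unfolding sphere_rho_def
  by (intro cINF_lower bdd_belowI2[of _ 0]) (use assms in \<open>auto intro: sign_radius_nonneg eventually_nonneg_sphere\<close>)

lemma torus_rho_le:
  assumes "f \<in> torus_class \<nu> N" "\<exists>x. f x \<noteq> 0"
  shows "torus_rho \<nu> N \<le> sign_radius UNIV torus_norm f"
  unfolding torus_rho_def
  by (intro cINF_lower bdd_belowI2[of _ 0]) (use assms in \<open>auto intro: sign_radius_nonneg eventually_nonneg_torus\<close>)

lemma minus_one_in_sphere_class: "(\<lambda>_. - 1) \<in> sphere_class \<mu> N"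
  by (rule zonal_in_sphere_class[of "[:- 1:]"]) auto

lemma minus_one_in_torus_class: "(\<lambda>_. - 1) \<in> torus_class \<nu> N"
  using trig_poly_const[of N "- 1"] eventually_nonneg_torus by (auto simp: torus_class_def trig_poly_iff)

text \<open>The constant \<open>-1\<close> is admissible, and outside a ball of radius greater than \<open>\<pi>\<close> there is nothing to check.\<close>

lemma sphere_rho_le_pi: "sphere_rho \<mu> N \<le> pi"
proof (rule field_le_epsilon)
  fix e :: real assume "e > 0"
  have "sphere_rho \<mu> N \<le> sphere_sign_radius (\<lambda>_ :: real ^ 'd option. - 1)"
    by (rule sphere_rho_le[OF minus_one_in_sphere_class]) (auto intro!: exI[of _ pole])
  also have "\<dots> \<le> pi + e"
  proof (rule sign_radius_le)
    show "0 < pi + e" using \<open>e > 0\<close> pi_gt_zero by linarith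
    show "nonneg_outside_ball (sphere 0 1) (geodesic_dist (pole :: real ^ 'd option)) (\<lambda>_. - 1) (pi + e)"
      unfolding nonneg_outside_ball_def using geodesic_dist_pole_le \<open>e > 0\<close> by force
  qed
  finally show "sphere_rho \<mu> N \<le> pi + e" .
qed

text \<open>The even part of a competitor on the torus, lifted to the sphere. It does not vanish when
  \<open>r < 1/2\<close>: otherwise the values at \<open>t\<close> and \<open>- t\<close>, nonnegative with sum \<open>0\<close>, would vanish
  for \<open>r \<le> t \<le> 1/2\<close>.\<close>

lemma sphere_rho_le_torus_rho: "sphere_rho \<mu> N \<le> 2 * pi * torus_rho (polar_part \<mu>) N"
proof -
  have le: "sphere_rho \<mu> N \<le> 2 * pi * r"
    if f: "f \<in> torus_class (polar_part \<mu>) N" "f s \<noteq> 0" and r: "0 < r" "nonneg_outside_ball UNIV torus_norm f r"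
    for f s r
  proof (cases "r < 1 / 2")
    case False
    then have "pi * 1 \<le> pi * (2 * r)" by (intro mult_left_mono) auto
    also have "\<dots> = 2 * pi * r" by simp
    finally show ?thesis
      using sphere_rho_le_pi[of N] by (simp only: mult_1_right)
  next
    case True
    have nonneg: "0 \<le> f t" if "r \<le> torus_norm t" for t
      using r(2) that by (auto simp: nonneg_outside_ball_def)
    have trig: "trig_poly N (\<lambda>t. complex_of_real (f t))"
      using f(1) by (auto simp: torus_class_def trig_poly_iff)
    obtain q where q: "degree q \<le> N" "\<And>t. f t + f (- t) = poly q (cos (2 * pi * t))"
      using even_part_trig_poly[OF trig] by blast
    define F where "F x = poly q (x \<bullet> (pole :: real ^ 'd option))" for x
    have F: "F x = f (latitude x) + f (- latitude x)" if "norm x = 1" for x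
      by (simp add: F_def q(2) cos_latitude[OF that])
    have norm_lat: "torus_norm (latitude x) = latitude x" "torus_norm (- latitude x) = latitude x"
      if "norm x = 1" for x :: "real ^ 'd option"
      using torus_norm_id latitude_bounds[OF that] torus_norm_eq_arccos[of "latitude x"]
        torus_norm_eq_arccos[of "- latitude x"] by auto
    have "(\<integral>x. F x \<partial>\<mu>) = (\<integral>t. f t \<partial>polar_part \<mu>)"
      unfolding integral_trig_poly_polar_part[OF trig]
      by (intro Bochner_Integration.integral_cong refl) (simp add: space_mu F)
    then have "F \<in> sphere_class \<mu> N"
      using f(1) by (intro zonal_in_sphere_class[OF q(1)]) (auto simp: F_def torus_class_def)
    moreover have "\<exists>x\<in>sphere 0 1. F x \<noteq> 0"
    proof (rule ccontr)
      assume zero: "\<not> ?thesis"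
      obtain u :: "real ^ 'd option" where u: "norm u = 1" "u \<bullet> pole = 0"
        by (rule equator_nonempty)
      have zero_interval: "f t = 0" if t: "t \<in> {r..1/2}" for t
      proof -
        have "poly q (cos (2 * pi * t)) = 0"
        proof -
          have "great_circle u t \<in> sphere 0 1"
            by (simp add: norm_great_circle[OF u])
          with zero have "F (great_circle u t) = 0" by blast
          then show ?thesis
            by (simp add: F_def norm_great_circle[OF u])
        qed
        then have "f t + f (- t) = 0" by (simp add: q(2))
        moreover have "torus_norm t = t" "torus_norm (- t) = t"
          using t r(1) torus_norm_id[of t] torus_norm_eq_arccos[of t] torus_norm_eq_arccos[of "- t"] by auto
        then have "0 \<le> f t" "0 \<le> f (- t)"
          using t by (auto intro: nonneg)
        ultimately show ?thesis by linarith
      qed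
      have "complex_of_real (f s) = 0"
        by (rule trig_poly_eq_0_interval[OF trig, of r "1/2"]) (use True r(1) zero_interval in auto)
      with f(2) show False by simp
    qed
    ultimately have "sphere_rho \<mu> N \<le> sphere_sign_radius F"
      by (rule sphere_rho_le)
    also have "\<dots> \<le> 2 * pi * r"
    proof (rule sign_radius_le)
      show "0 < 2 * pi * r" using r(1) by simp
      show "nonneg_outside_ball (sphere 0 1) (geodesic_dist pole) F (2 * pi * r)"
        unfolding nonneg_outside_ball_def geodesic_dist_pole
        by (auto simp: F norm_lat intro!: add_nonneg_nonneg nonneg)
    qed
    finally show ?thesis .
  qed
  have "sphere_rho \<mu> N / (2 * pi) \<le> torus_rho (polar_part \<mu>) N"
    unfolding torus_rho_def
  proof (rule cINF_greatest)
    show "{f \<in> torus_class (polar_part \<mu>) N. \<exists>x. f x \<noteq> 0} \<noteq> {}"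
      using minus_one_in_torus_class by force
    fix f assume "f \<in> {f \<in> torus_class (polar_part \<mu>) N. \<exists>x. f x \<noteq> 0}"
    then obtain s where f: "f \<in> torus_class (polar_part \<mu>) N" "f s \<noteq> 0" by blast
    show "sphere_rho \<mu> N / (2 * pi) \<le> sign_radius UNIV torus_norm f"
      unfolding sign_radius_def
    proof (rule cInf_greatest)
      show "{r. 0 < r \<and> nonneg_outside_ball UNIV torus_norm f r} \<noteq> {}"
        using eventually_nonneg_torus[of f] by (auto simp: eventually_nonneg_def)
      fix r assume "r \<in> {r. 0 < r \<and> nonneg_outside_ball UNIV torus_norm f r}"
      then show "sphere_rho \<mu> N / (2 * pi) \<le> r"
        using le[OF f, of r] by (simp add: pos_divide_le_eq mult_ac)
    qed
  qed
  then show ?thesis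
    by (simp add: field_simps)
qed

text \<open>Among the restrictions of a competitor to great circles through the poles, one is admissible for
  the polar part and not identically zero.\<close>

lemma torus_rho_le_sphere_rho:
  assumes d: "CARD('d) \<ge> 2"
  shows "2 * pi * torus_rho (polar_part \<mu>) N \<le> sphere_rho \<mu> N"
proof -
  have le: "2 * pi * torus_rho (polar_part \<mu>) N \<le> r"
    if f: "f \<in> sphere_class \<mu> N" "x0 \<in> sphere 0 1" "f x0 \<noteq> 0"
      and r: "0 < r" "nonneg_outside_ball (sphere 0 1) (geodesic_dist pole) f r" for f x0 r
  proof -
    obtain Y where Y: "\<forall>k\<le>N. Y k \<in> spherical_harmonics k" "\<forall>x\<in>sphere 0 1. f x = (\<Sum>k\<le>N. Y k x)"
      using f(1) by (auto simp: sphere_class_def)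
    have "\<exists>p. real_polynomial_function p \<and> (\<forall>c x. p (c *\<^sub>R x) = c ^ k * p x) \<and> (\<forall>x\<in>sphere 0 1. Y k x = p x)"
      if "k \<le> N" for k
      using Y(1) that by (auto simp: spherical_harmonics_def)
    then obtain p where p: "\<And>k. k \<le> N \<Longrightarrow> real_polynomial_function (p k)"
      "\<And>k c x. k \<le> N \<Longrightarrow> p k (c *\<^sub>R x) = c ^ k * p k x"
      "\<And>k x. k \<le> N \<Longrightarrow> x \<in> sphere 0 1 \<Longrightarrow> Y k x = p k x"
      by metis
    define F where "F x = (\<Sum>k\<le>N. p k x)" for x
    have fF: "f x = F x" if "x \<in> sphere 0 1" for x
      using that Y(2) p(3) by (simp add: F_def)
    have contF: "continuous_on UNIV F"
      unfolding F_def using p(1)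
      by (intro continuous_on_sum continuous_on_polymonial_function) (simp add: real_polynomial_function_eq)
    have trig: "trig_poly N (\<lambda>t. complex_of_real (F (great_circle u t)))" for u
    proof -
      have "trig_poly N (\<lambda>t. \<Sum>k\<le>N. complex_of_real (p k (great_circle u t)))"
        by (intro trig_poly_sum) (auto intro: trig_poly_mono[OF trig_poly_homogeneous] p)
      then show ?thesis by (simp add: F_def)
    qed
    have "(\<integral>x. F x \<partial>\<mu>) = (\<integral>x. f x \<partial>\<mu>)"
      by (intro Bochner_Integration.integral_cong refl) (simp add: space_mu fF)
    then have int: "(\<integral>x. F x \<partial>\<mu>) \<le> 0"
      using f(1) by (simp add: sphere_class_def)
    have "\<exists>u. norm u = 1 \<and> u \<bullet> pole = 0 \<and> (\<exists>t. F (great_circle u t) \<noteq> 0) \<and> meridian_sum F u \<le> 0"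
    proof (rule ccontr)
      assume "\<not> ?thesis"
      then have pos: "0 < meridian_sum F u"
        if "norm u = 1" "u \<bullet> pole = 0" "F (great_circle u t) \<noteq> 0" for u t
        using that by force
      have "0 \<le> meridian_sum F u" if "norm u = 1" "u \<bullet> pole = 0" for u
      proof (cases "\<exists>t. F (great_circle u t) \<noteq> 0")
        case True
        with pos that show ?thesis by (meson less_imp_le)
      next
        case False
        then show ?thesis
          by (simp add: integral_great_circle[OF contF, symmetric])
      qed
      moreover obtain u0 t0 where "norm u0 = 1" "u0 \<bullet> pole = 0" "x0 = great_circle u0 t0"
        using on_great_circle[of x0] f(2) by auto
      moreover from this have "0 < meridian_sum F u0"
        using pos[of u0 t0] f fF by auto
      ultimately have "0 < (\<integral>x. F x \<partial>\<mu>)"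
        using integral_pos_if_meridian_sums_nonneg[OF d contF] by blast
      with int show False by simp
    qed
    then obtain u t0 where u: "norm u = 1" "u \<bullet> pole = 0" "F (great_circle u t0) \<noteq> 0" "meridian_sum F u \<le> 0"
      by blast
    have "(\<lambda>t. F (great_circle u t)) \<in> torus_class (polar_part \<mu>) N"
      using trig[of u] u(4) eventually_nonneg_torus
      by (simp add: torus_class_def trig_poly_iff integral_great_circle[OF contF])
    then have "torus_rho (polar_part \<mu>) N \<le> sign_radius UNIV torus_norm (\<lambda>t. F (great_circle u t))"
      using u(3) by (intro torus_rho_le) auto
    also have "\<dots> \<le> r / (2 * pi)"
    proof (rule sign_radius_le)
      show "0 < r / (2 * pi)" using r(1) by simp
      have "0 \<le> F (great_circle u t)" if "r / (2 * pi) \<le> torus_norm t" for t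
      proof -
        have "geodesic_dist pole (great_circle u t) = 2 * pi * torus_norm t"
          by (simp add: geodesic_dist_def inner_commute[of pole] norm_great_circle[OF u(1,2)] torus_norm_eq_arccos)
        then have "r \<le> geodesic_dist pole (great_circle u t)"
          using that by (simp add: field_simps)
        then show ?thesis
          using r(2) fF norm_great_circle[OF u(1,2), of t] by (auto simp: nonneg_outside_ball_def)
      qed
      then show "nonneg_outside_ball UNIV torus_norm (\<lambda>t. F (great_circle u t)) (r / (2 * pi))"
        by (auto simp: nonneg_outside_ball_def)
    qed
    finally show ?thesis
      by (simp add: field_simps)
  qed
  show ?thesis
    unfolding sphere_rho_def
  proof (rule cINF_greatest)
    show "{f \<in> sphere_class \<mu> N. \<exists>x\<in>sphere 0 1. f x \<noteq> 0} \<noteq> {}"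
      using minus_one_in_sphere_class norm_pole by (auto intro!: exI[of _ "\<lambda>_. - 1"] bexI[of _ pole])
    fix f assume "f \<in> {f \<in> sphere_class \<mu> N. \<exists>x\<in>sphere 0 1. f x \<noteq> 0}"
    then obtain x0 where f: "f \<in> sphere_class \<mu> N" "x0 \<in> sphere 0 1" "f x0 \<noteq> 0" by blast
    show "2 * pi * torus_rho (polar_part \<mu>) N \<le> sphere_sign_radius f"
      unfolding sign_radius_def
    proof (rule cInf_greatest)
      show "{r. 0 < r \<and> nonneg_outside_ball (sphere 0 1) (geodesic_dist pole) f r} \<noteq> {}"
        using eventually_nonneg_sphere[of f] by (auto simp: eventually_nonneg_def)
      fix r assume "r \<in> {r. 0 < r \<and> nonneg_outside_ball (sphere 0 1) (geodesic_dist pole) f r}"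
      then show "2 * pi * torus_rho (polar_part \<mu>) N \<le> r"
        using le[OF f] by simp
    qed
  qed
qed

lemma sphere_rho_eq:
  assumes "CARD('d) \<ge> 2"
  shows "sphere_rho \<mu> N = 2 * pi * torus_rho (polar_part \<mu>) N"
  using sphere_rho_le_torus_rho torus_rho_le_sphere_rho[OF assms] by (rule antisym)

text \<open>The extremal function is even, hence a polynomial in the cosine, and its lift to the sphere is a sum of
  zonal harmonics with integral half of that on the torus.\<close>

lemma sphere_extremizer_extremal_fun:
  assumes d: "CARD('d) \<ge> 2" and N: "N \<ge> 1"
    and supp: "less_card N (measure_support (circle_measure (polar_part \<mu>)))"
  shows "sphere_extremizer \<mu> N (\<lambda>x. extremal_fun (polar_part \<mu>) N (latitude x))"
proof -
  define f where "f = extremal_fun (polar_part \<mu>) N"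
  define \<theta> where "\<theta> = first_zero (polar_part \<mu>) (N + 1)"
  note f = torus.trig_poly_extremal_fun[OF N supp, folded f_def]
    torus.extremal_fun_minus[OF N supp, folded f_def]
    torus.integral_extremal_fun[OF N supp, folded f_def]
    torus.extremal_fun_nonzero[OF N supp, folded f_def]
    torus.extremal_fun_nonneg[OF N supp, folded f_def \<theta>_def]
  obtain q where q: "degree q \<le> N" "\<And>t. f t + f (- t) = poly q (cos (2 * pi * t))"
    using even_part_trig_poly[OF f(1)] by blast
  then have fq: "f t = poly (smult (1/2) q) (cos (2 * pi * t))" for t
    unfolding poly_smult using q(2)[of t] f(2)[of t] by simp
  have "(\<integral>x. f (latitude x) \<partial>\<mu>) = (\<integral>x. (1/2) * (f (latitude x) + f (- latitude x)) \<partial>\<mu>)"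
    by (simp add: f(2))
  also have "\<dots> = 0"
    unfolding integral_mult_right_zero integral_trig_poly_polar_part[OF f(1), symmetric] f(3) by simp
  finally have "(\<lambda>x. f (latitude x)) \<in> sphere_class \<mu> N"
    using q(1) by (intro zonal_in_sphere_class[of "smult (1/2) q"]) (auto simp: fq cos_latitude)
  moreover have "\<exists>x\<in>sphere (0 :: real ^ 'd option) 1. f (latitude x) \<noteq> 0"
  proof -
    obtain t where "f t \<noteq> 0" using f(4) by blast
    moreover obtain u :: "real ^ 'd option" where "norm u = 1" "u \<bullet> pole = 0"
      by (rule equator_nonempty)
    note u = norm_great_circle[OF this, of t]
    have "f (latitude (great_circle u t)) = f t"
      unfolding fq cos_latitude[OF u(1)] u(2) ..
    ultimately show ?thesis
      using u(1) by (intro bexI[of _ "great_circle u t"]) auto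
  qed
  moreover have "sphere_sign_radius (\<lambda>x :: real ^ 'd option. f (latitude x)) = sphere_rho \<mu> N"
  proof (rule antisym)
    have \<theta>: "0 < \<theta>" "torus_rho (polar_part \<mu>) N = \<theta>"
      using torus.first_zero_bounds[OF N supp] torus.torus_rho_eq[OF N supp] by (simp_all add: \<theta>_def)
    have "0 \<le> f (latitude x)" if "norm x = 1" "\<theta> \<le> latitude x" for x :: "real ^ 'd option"
      using that latitude_bounds[OF that(1)] torus_norm_id[of "latitude x"] by (intro f(5)) auto
    then have "sphere_sign_radius (\<lambda>x :: real ^ 'd option. f (latitude x)) \<le> 2 * pi * \<theta>"
      using \<theta>(1) by (intro sign_radius_le) (auto simp: nonneg_outside_ball_def geodesic_dist_pole)
    then show "sphere_sign_radius (\<lambda>x :: real ^ 'd option. f (latitude x)) \<le> sphere_rho \<mu> N"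
      by (simp add: sphere_rho_eq[OF d] \<theta>(2))
    show "sphere_rho \<mu> N \<le> sphere_sign_radius (\<lambda>x :: real ^ 'd option. f (latitude x))"
      by (rule sphere_rho_le) fact+
  qed
  ultimately show ?thesis
    unfolding sphere_extremizer_def f_def by blast
qed

end

theorem theorem2:
  fixes \<mu> :: "(real ^ 'd::finite option) measure" and N :: nat
  assumes "CARD('d) \<ge> 2"
    and "polar_measure \<mu>"
    and "N \<ge> 1"
  shows "sphere_rho \<mu> N = 2 * pi * torus_rho (polar_part \<mu>) N \<and>
    (less_card N (measure_support (circle_measure (polar_part \<mu>))) \<longrightarrow>
      sphere_extremizer \<mu> N
        (\<lambda>x. extremal_fun (polar_part \<mu>) N (arccos (x \<bullet> pole) / (2 * pi))))"
proof -
  interpret polar_sphere_measure \<mu>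
    by unfold_locales (rule assms(2))
  show ?thesis
    using sphere_rho_eq[OF assms(1)] sphere_extremizer_extremal_fun[OF assms(1,3)]
    unfolding latitude_def by blast
qed

end
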